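(* For every $\alpha\in[0,1/2)$, there exists $c_\alpha>0$ such that for every sufficiently large integer $n$, $$\sum_{i=0}^{\lfloor\alpha n\rfloor}e_{\mathbb R}(i,n-i)\le\exp(-c_\alpha n^2).$$
   Context: $\mathrm{Sym}(n,\mathbb R)$ is the space of real symmetric $n\times n$ matrices with the scalar product for which the matrices $\sqrt2E_{ii}$ ($1\le i\le n$) and $E_{ij}+E_{ji}$ ($1\le i<j\le n$) form an orthonormal basis, where $E_{ij}$ are the elementary matrices; $\|\cdot\|$ is the associated norm. It is equipped with the Gaussian probability measure $d\mu_{\mathbb R}(A)=\pi^{-n(n+1)/4}e^{-\|A\|^2}dA$. For $p+q=n$, $\mathrm{Sym}(p,q,\mathbb R)\subset\mathrm{Sym}(n,\mathbb R)$ is the open subset of nondegenerate matrices of signature $(p,q)$, and $e_{\mathbb R}(p,q)=\int_{\mathrm{Sym}(p,q,\mathbb R)}|\det A|\,d\mu_{\mathbb R}(A)$. *)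

theory Defs
  imports "HOL-Probability.Probability" "Jordan_Normal_Form.Char_Poly"
begin

definition sym_mats :: "nat \<Rightarrow> real mat set" where
  "sym_mats n = {A \<in> carrier_mat n n. transpose_mat A = A}"

definition sym_index :: "nat \<Rightarrow> (nat \<times> nat) set" where
  "sym_index n = {(i, j). i \<le> j \<and> j < n}"

definition elem_mat :: "nat \<Rightarrow> nat \<Rightarrow> nat \<Rightarrow> real mat" where
  "elem_mat n i j = mat n n (\<lambda>(k, l). if k = i \<and> l = j then 1 else 0)"

definition sym_basis :: "nat \<Rightarrow> nat \<times> nat \<Rightarrow> real mat" where
  "sym_basis n = (\<lambda>(i, j). if i = j then sqrt 2 \<cdot>\<^sub>m elem_mat n i i
                           else elem_mat n i j + elem_mat n j i)"

text \<open>The weight 1/2 on the diagonal is forced by the requirement that \<open>sym_basis\<close> be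
  orthonormal; see \<open>sym_basis_orthonormal\<close> and \<open>sym_basis_expansion\<close> below.\<close>

definition sym_inner :: "nat \<Rightarrow> real mat \<Rightarrow> real mat \<Rightarrow> real" where
  "sym_inner n A B = (\<Sum>(i, j)\<in>sym_index n.
     if i = j then A $$ (i, i) * B $$ (i, i) / 2 else A $$ (i, j) * B $$ (i, j))"

definition sym_norm :: "nat \<Rightarrow> real mat \<Rightarrow> real" where
  "sym_norm n A = sqrt (sym_inner n A A)"

definition sym_coords :: "nat \<Rightarrow> real mat \<Rightarrow> nat \<times> nat \<Rightarrow> real" where
  "sym_coords n A = (\<lambda>p\<in>sym_index n. sym_inner n A (sym_basis n p))"

definition sym_of_coords :: "nat \<Rightarrow> (nat \<times> nat \<Rightarrow> real) \<Rightarrow> real mat" where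
  "sym_of_coords n x = mat n n (\<lambda>(k, l). \<Sum>p\<in>sym_index n. x p * sym_basis n p $$ (k, l))"

text \<open>Lebesgue measure of the Euclidean space of symmetric matrices: the type of matrices carries
  no topology, so both the Borel sigma-algebra and the measure are transported from the product
  space of coordinates in the orthonormal basis \<open>sym_basis\<close>.\<close>

definition sym_lebesgue :: "nat \<Rightarrow> real mat measure" where
  "sym_lebesgue n =
     distr (\<Pi>\<^sub>M p\<in>sym_index n. (lborel :: real measure))
       (vimage_algebra (sym_mats n) (sym_coords n) (\<Pi>\<^sub>M p\<in>sym_index n. lborel))
       (sym_of_coords n)"

definition sym_gauss :: "nat \<Rightarrow> real mat measure" where
  "sym_gauss n = density (sym_lebesgue n)
     (\<lambda>A. ennreal (pi powr (- (real n * (real n + 1) / 4)) * exp (- (sym_norm n A)\<^sup>2)))"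

definition pos_index :: "real mat \<Rightarrow> nat" where
  "pos_index A = (\<Sum>x | eigenvalue A x \<and> 0 < x. Polynomial.order x (char_poly A))"

definition neg_index :: "real mat \<Rightarrow> nat" where
  "neg_index A = (\<Sum>x | eigenvalue A x \<and> x < 0. Polynomial.order x (char_poly A))"

text \<open>Signature \<open>(p, q)\<close>: \<open>p\<close> positive and \<open>q\<close> negative eigenvalues, with multiplicity.\<close>

definition sym_sig :: "nat \<Rightarrow> nat \<Rightarrow> real mat set" where
  "sym_sig p q = {A \<in> sym_mats (p + q).
     Determinant.det A \<noteq> 0 \<and> pos_index A = p \<and> neg_index A = q}"

text \<open>The integrand is nonnegative; the integral is taken in \<open>ennreal\<close> so that finiteness is part of
  any upper bound rather than a default value.\<close>

definition e_real :: "nat \<Rightarrow> nat \<Rightarrow> ennreal" where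
  "e_real p q = (\<integral>\<^sup>+A\<in>sym_sig p q. ennreal \<bar>Determinant.det A\<bar> \<partial>sym_gauss (p + q))"

lemma finite_sym_index [simp]: "finite (sym_index n)"
  by (rule finite_subset[of _ "{..<n} \<times> {..<n}"]) (auto simp: sym_index_def)

lemma sym_basis_in: "p \<in> sym_index n \<Longrightarrow> sym_basis n p \<in> sym_mats n"
  by (cases p) (auto simp: sym_index_def sym_mats_def sym_basis_def elem_mat_def)

lemma sym_basis_entry:
  assumes "(i, j) \<in> sym_index n" "k < n" "l < n"
  shows "sym_basis n (i, j) $$ (k, l) =
    (if i = j then (if k = i \<and> l = i then sqrt 2 else 0)
     else if (k, l) = (i, j) \<or> (k, l) = (j, i) then 1 else 0)"
  using assms by (auto simp: sym_index_def sym_basis_def elem_mat_def)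

lemma sym_inner_basis:
  assumes "(i, j) \<in> sym_index n"
  shows "sym_inner n A (sym_basis n (i, j)) =
    (if i = j then A $$ (i, i) / sqrt 2 else A $$ (i, j))"
proof -
  have s: "sqrt 2 / 2 = 1 / sqrt (2::real)" by (simp add: field_simps)
  have "sym_inner n A (sym_basis n (i, j)) =
    (\<Sum>p\<in>sym_index n. if p = (i, j) then (if i = j then A $$ (i, i) / sqrt 2 else A $$ (i, j)) else 0)"
    unfolding sym_inner_def
  proof (rule sum.cong[OF refl])
    fix p assume "p \<in> sym_index n"
    moreover obtain k l where "p = (k, l)" by (cases p)
    moreover have "A $$ (i, i) * sqrt 2 / 2 = A $$ (i, i) / sqrt 2"
      using s by (metis times_divide_eq_right mult.right_neutral)
    ultimately show "(case p of (k, l) \<Rightarrow>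
        if k = l then A $$ (k, k) * sym_basis n (i, j) $$ (k, k) / 2
        else A $$ (k, l) * sym_basis n (i, j) $$ (k, l)) =
      (if p = (i, j) then (if i = j then A $$ (i, i) / sqrt 2 else A $$ (i, j)) else 0)"
      using assms by (auto simp: sym_basis_entry sym_index_def)
  qed
  then show ?thesis using assms by simp
qed

lemma sym_basis_orthonormal:
  assumes "p \<in> sym_index n" "q \<in> sym_index n"
  shows "sym_inner n (sym_basis n p) (sym_basis n q) = (if p = q then 1 else 0)"
  using assms
  by (cases p; cases q) (auto simp: sym_inner_basis sym_basis_entry sym_index_def)

lemma sym_of_coords_entry:
  assumes "i \<le> j" "j < n"
  shows "sym_of_coords n x $$ (i, j) = (if i = j then sqrt 2 * x (i, i) else x (i, j))"
    and "sym_of_coords n x $$ (j, i) = (if i = j then sqrt 2 * x (i, i) else x (i, j))"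
proof -
  have m: "(i, j) \<in> sym_index n" using assms by (simp add: sym_index_def)
  have "sym_of_coords n x $$ (i, j) = (\<Sum>p\<in>sym_index n. if p = (i, j) then
      (if i = j then sqrt 2 * x (i, i) else x (i, j)) else 0)"
    using assms unfolding sym_of_coords_def
    by (auto simp: sym_basis_entry sym_index_def intro!: sum.cong)
  then show "sym_of_coords n x $$ (i, j) = (if i = j then sqrt 2 * x (i, i) else x (i, j))"
    using m by simp
  have "sym_of_coords n x $$ (j, i) = (\<Sum>p\<in>sym_index n. if p = (i, j) then
      (if i = j then sqrt 2 * x (i, i) else x (i, j)) else 0)"
    using assms unfolding sym_of_coords_def
    by (auto simp: sym_basis_entry sym_index_def intro!: sum.cong)
  then show "sym_of_coords n x $$ (j, i) = (if i = j then sqrt 2 * x (i, i) else x (i, j))"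
    using m by simp
qed

lemma sym_of_coords_in: "sym_of_coords n x \<in> sym_mats n"
proof -
  have "sym_of_coords n x $$ (j, i) = sym_of_coords n x $$ (i, j)" if "i < n" "j < n" for i j
    using that sym_of_coords_entry[of i j n x] sym_of_coords_entry[of j i n x]
    by (cases "i \<le> j") auto
  then show ?thesis
    by (auto simp: sym_mats_def intro!: eq_matI) (auto simp: sym_of_coords_def)
qed

lemma sym_basis_expansion:
  assumes "A \<in> sym_mats n"
  shows "sym_of_coords n (sym_coords n A) = A"
proof (rule eq_matI)
  have d: "dim_row A = n" "dim_col A = n" and t: "transpose_mat A = A"
    using assms by (auto simp: sym_mats_def)
  then show "dim_row (sym_of_coords n (sym_coords n A)) = dim_row A"
    "dim_col (sym_of_coords n (sym_coords n A)) = dim_col A"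
    by (auto simp: sym_of_coords_def)
  fix i j assume ij: "i < dim_row A" "j < dim_col A"
  have sym: "A $$ (i, j) = A $$ (j, i)"
    using t ij d by (metis index_transpose_mat(1))
  have main: "sym_of_coords n (sym_coords n A) $$ (k, l) = A $$ (k, l) \<and>
      sym_of_coords n (sym_coords n A) $$ (l, k) = A $$ (k, l)" if "k \<le> l" "l < n" for k l
    using that by (auto simp: sym_of_coords_entry sym_coords_def sym_inner_basis sym_index_def)
  show "sym_of_coords n (sym_coords n A) $$ (i, j) = A $$ (i, j)"
    using main[of i j] main[of j i] ij d sym by (cases "i \<le> j") auto
qed

lemma sym_coords_of_coords:
  "sym_coords n (sym_of_coords n x) = restrict x (sym_index n)"
  unfolding sym_coords_def
  by (rule restrict_ext)
    (auto simp: sym_inner_basis sym_of_coords_entry sym_index_def)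

lemma sym_of_coords_measurable:
  "sym_of_coords n \<in> (\<Pi>\<^sub>M p\<in>sym_index n. (lborel :: real measure)) \<rightarrow>\<^sub>M
     vimage_algebra (sym_mats n) (sym_coords n) (\<Pi>\<^sub>M p\<in>sym_index n. lborel)"
proof (rule measurable_vimage_algebra2)
  show "(\<lambda>x. sym_coords n (sym_of_coords n x)) \<in>
    (\<Pi>\<^sub>M p\<in>sym_index n. (lborel :: real measure)) \<rightarrow>\<^sub>M (\<Pi>\<^sub>M p\<in>sym_index n. lborel)"
    unfolding sym_coords_of_coords by measurable
qed (simp add: sym_of_coords_in)

lemma sym_coords_measurable:
  "sym_coords n \<in>
     vimage_algebra (sym_mats n) (sym_coords n) (\<Pi>\<^sub>M p\<in>sym_index n. (lborel :: real measure))
     \<rightarrow>\<^sub>M (\<Pi>\<^sub>M p\<in>sym_index n. lborel)"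
  by (rule measurable_vimage_algebra1) (auto simp: space_PiM sym_coords_def)

lemma sym_norm_coords:
  "(sym_norm n A)\<^sup>2 = (\<Sum>p\<in>sym_index n. (sym_coords n A p)\<^sup>2)"
proof -
  have "sym_inner n A A = (\<Sum>p\<in>sym_index n. (sym_coords n A p)\<^sup>2)"
    unfolding sym_inner_def
    by (rule sum.cong)
      (auto simp: sym_coords_def sym_inner_basis power_divide power2_eq_square)
  then show ?thesis by (simp add: sym_norm_def sum_nonneg)
qed

lemma card_sym_index: "card (sym_index n) = n * (n + 1) div 2"
proof -
  have "sym_index n = (SIGMA j:{..<n}. {..j}) ^-1" by (auto simp: sym_index_def)
  then have "card (sym_index n) = card (SIGMA j:{..<n}. {..j})" by (simp add: card_inverse)
  also have "\<dots> = (\<Sum>j<n. Suc j)" by (simp add: card_SigmaI)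
  also have "\<dots> = n * (n + 1) div 2" by (induction n) auto
  finally show ?thesis .
qed

lemma nn_integral_exp_minus_square: "(\<integral>\<^sup>+x. ennreal (exp (- x\<^sup>2)) \<partial>lborel) = ennreal (sqrt pi)"
proof -
  have d: "exp (- x\<^sup>2) = sqrt pi * normal_density 0 (1 / sqrt 2) x" for x :: real
    by (simp add: normal_density_def power_divide real_sqrt_divide)
  have "(\<integral>\<^sup>+x. ennreal (exp (- x\<^sup>2)) \<partial>lborel) =
    ennreal (integral\<^sup>L lborel (\<lambda>x::real. exp (- x\<^sup>2)))"
    unfolding d by (intro nn_integral_eq_integral integrable_mult_right integrable_normal_density) auto
  also have "integral\<^sup>L lborel (\<lambda>x::real. exp (- x\<^sup>2)) = sqrt pi"
    unfolding d by simp
  finally show ?thesis .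
qed

lemma prob_space_sym_gauss: "prob_space (sym_gauss n)"
proof
  interpret product_sigma_finite "\<lambda>_::nat\<times>nat. lborel :: real measure" ..
  let ?P = "\<Pi>\<^sub>M p\<in>sym_index n. (lborel :: real measure)"
  let ?V = "vimage_algebra (sym_mats n) (sym_coords n) ?P"
  let ?k = "pi powr (- (real n * (real n + 1) / 4))"
  have k: "?k * (sqrt pi) ^ card (sym_index n) = 1"
  proof -
    have "(sqrt pi) ^ card (sym_index n) = pi powr (real (card (sym_index n)) / 2)"
      by (simp add: powr_half_sqrt[symmetric] powr_powr powr_realpow[symmetric])
    also have "real (card (sym_index n)) = real n * (real n + 1) / 2"
      unfolding card_sym_index by (subst real_of_nat_div) (auto simp: algebra_simps)
    finally show ?thesis by (simp add: powr_add[symmetric])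
  qed
  have m: "(\<lambda>A. ennreal (?k * exp (- (sym_norm n A)\<^sup>2))) \<in> borel_measurable ?V"
  proof -
    have c: "(\<lambda>A. sym_coords n A p) \<in> borel_measurable ?V" if "p \<in> sym_index n" for p
      using measurable_compose[OF sym_coords_measurable measurable_component_singleton[OF that]]
      by simp
    have "(\<lambda>A. (sym_norm n A)\<^sup>2) \<in> borel_measurable ?V"
      unfolding sym_norm_coords by (intro borel_measurable_sum borel_measurable_power c)
    then show ?thesis
      by (intro measurable_compose[OF _ measurable_ennreal] borel_measurable_times
          borel_measurable_const borel_measurable_uminus
          measurable_compose[OF _ borel_measurable_exp])
  qed
  let ?f = "\<lambda>A. ennreal (?k * exp (- (sym_norm n A)\<^sup>2))"
  have mL: "?f \<in> borel_measurable (sym_lebesgue n)"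
    unfolding sym_lebesgue_def measurable_distr_eq1 by (rule m)
  have "emeasure (sym_gauss n) (space (sym_gauss n)) =
     (\<integral>\<^sup>+A. ?f A * indicator (space (sym_lebesgue n)) A \<partial>sym_lebesgue n)"
    unfolding sym_gauss_def space_density by (rule emeasure_density[OF mL sets.top])
  also have "\<dots> = (\<integral>\<^sup>+A. ?f A \<partial>sym_lebesgue n)"
    by (rule nn_integral_cong) simp
  also have "\<dots> = (\<integral>\<^sup>+x. ?f (sym_of_coords n x) \<partial>?P)"
    unfolding sym_lebesgue_def by (rule nn_integral_distr[OF sym_of_coords_measurable mL[unfolded sym_lebesgue_def]])
  also have "\<dots> = (\<integral>\<^sup>+x. (\<Prod>p\<in>sym_index n. ennreal (exp (- (x p)\<^sup>2))) * ennreal ?k \<partial>?P)"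
  proof (rule nn_integral_cong)
    fix x :: "nat \<times> nat \<Rightarrow> real"
    have "(sym_norm n (sym_of_coords n x))\<^sup>2 = (\<Sum>p\<in>sym_index n. (x p)\<^sup>2)"
      unfolding sym_norm_coords sym_coords_of_coords by simp
    then show "?f (sym_of_coords n x) = (\<Prod>p\<in>sym_index n. ennreal (exp (- (x p)\<^sup>2))) * ennreal ?k"
      by (simp add: ennreal_mult[symmetric] prod_ennreal exp_sum[symmetric] sum_negf mult.commute)
  qed
  also have "\<dots> = (\<integral>\<^sup>+x. (\<Prod>p\<in>sym_index n. ennreal (exp (- (x p)\<^sup>2))) \<partial>?P) * ennreal ?k"
  proof (rule nn_integral_multc)
    have "(\<lambda>x. ennreal (exp (- (x p)\<^sup>2))) \<in> borel_measurable ?P" if "p \<in> sym_index n" for p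
      by (rule measurable_compose[OF measurable_component_singleton[OF that]]) simp
    then show "(\<lambda>x. \<Prod>p\<in>sym_index n. ennreal (exp (- (x p)\<^sup>2))) \<in> borel_measurable ?P"
      by (rule borel_measurable_prod_ennreal)
  qed
  also have "\<dots> = (\<Prod>p\<in>sym_index n. \<integral>\<^sup>+x. ennreal (exp (- x\<^sup>2)) \<partial>lborel) * ennreal ?k"
    by (subst product_nn_integral_prod) simp_all
  also have "\<dots> = 1"
    using k by (simp add: nn_integral_exp_minus_square ennreal_power ennreal_mult[symmetric] mult.commute)
  finally show "emeasure (sym_gauss n) (space (sym_gauss n)) = 1" .
qed

end

theory Submission
  imports Defs "HOL-Real_Asymp.Real_Asymp"
begin

text \<open>
  Write \<open>A\<close> for a random matrix with law \<open>\<mu>\<close>. Having at most \<open>\<alpha> n\<close> positive eigenvalues, with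
  \<open>\<alpha> < 1/2\<close>, is exponentially unlikely in \<open>n\<^sup>2\<close> because such matrices lie at distance of order \<open>n\<close>
  from a set of matrices that is not too improbable, and Gaussian measure does not allow two
  distant sets to be both large. Two facts make this precise.

  \<^item> Concentration (\<open>gauss_two_set_inequality\<close>). If \<open>K\<close> and \<open>L\<close> are at squared distance \<open>D\<close>,
    then \<open>\<mu> K * \<mu> L \<le> exp (- D / 2)\<close>. This is the Prekopa-Leindler inequality for the Gaussian
    density. It tensorises by Fubini, and its one-dimensional case is elementary since the level
    sets of the Gaussian density are intervals.

  \<^item> Distance from spectra (\<open>spectral_distance\<close>). If all eigenvalues of \<open>A\<close> in a family \<open>I\<close> are at
    least \<open>g\<close> away from all eigenvalues of \<open>B\<close> in a family \<open>J\<close>, then the squared Frobenius distance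
    of \<open>A\<close> and \<open>B\<close> is at least \<open>(card I + card J - n) * g\<^sup>2\<close>. The reason is that the squared overlaps
    of the two eigenbases form a doubly stochastic matrix, which puts mass at least
    \<open>card I + card J - n\<close> on \<open>I \<times> J\<close>.

  Put \<open>\<delta> = 1/2 - \<alpha>\<close> and \<open>\<eta> = exp (- 8 / \<delta>)\<close>. Take for \<open>K\<close> the matrices with at most \<open>\<alpha> n\<close> positive
  eigenvalues and for \<open>L\<close> those with at least \<open>(1 - \<delta>) n / 2\<close> eigenvalues above \<open>\<eta> * sqrt n\<close>. With \<open>I\<close>
  the nonpositive eigenvalues of a member of \<open>K\<close> and \<open>J\<close> the large ones of a member of \<open>L\<close>, the sum
  of the cardinalities exceeds \<open>n\<close> by at least \<open>\<delta> n / 2\<close>, so that \<open>K\<close> and \<open>L\<close> are at squared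
  distance of order \<open>n\<^sup>2\<close> (\<open>few_half_positive_distance\<close>).

  It remains to see that \<open>\<mu> L\<close> is only subexponentially small on the scale \<open>n\<^sup>2\<close>, and this comes from
  the determinant. By the Leibniz formula and independence of the entries, the mean of \<open>\<bar>det A\<bar>\<close> is at
  least \<open>(n div 2)!\<close> up to a factor exponential in \<open>n\<close> (\<open>mean_abs_det_ge\<close>): only involutions
  contribute, all with the same sign, and there are enough of them. On the other hand a matrix
  with \<open>\<parallel>A\<parallel>\<^sup>2 \<le> 4 n\<^sup>2\<close> and at least \<open>\<delta> n\<close> eigenvalues in \<open>[- \<eta> * sqrt n, \<eta> * sqrt n]\<close> has a determinant
  that is too small to matter (\<open>few_small_eigenvalues\<close>). Hence the matrices with few small
  eigenvalues carry a fixed part of the mean; as \<open>\<bar>det A\<bar>\<close> is at most \<open>exp (O (n * ln n))\<close> on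
  \<open>\<parallel>A\<parallel>\<^sup>2 \<le> 4 n\<^sup>2\<close>, their probability is at least \<open>exp (- O (n * ln n))\<close>. By the symmetry of \<open>\<mu>\<close>
  under \<open>A \<mapsto> - A\<close> at least half of it belongs to \<open>L\<close>.

  Finally, the factor \<open>\<bar>det A\<bar>\<close> in the definition of \<open>e_real\<close> costs only \<open>exp (O (n * ln n))\<close> where
  \<open>\<parallel>A\<parallel>\<^sup>2 \<le> 4 n\<^sup>2\<close>, and the integral of \<open>\<bar>det A\<bar>\<close> over the rest of the space is at most
  \<open>exp (- n\<^sup>2 / 2 + O n)\<close> (\<open>det_tail\<close>).
\<close>

section \<open>Gaussian concentration\<close>

text \<open>The law of one coordinate in an orthonormal basis: variance \<open>1/2\<close>, so that the density is
  proportional to \<open>exp (- x\<^sup>2)\<close>.\<close>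
definition gauss :: "real measure" where
  "gauss = density lborel (\<lambda>x. ennreal (normal_density 0 (1 / sqrt 2) x))"

lemma gauss_density: "normal_density 0 (1 / sqrt 2) x = exp (- x\<^sup>2) / sqrt pi"
  by (simp add: normal_density_def power_divide real_sqrt_divide)

lemma sets_gauss [measurable_cong, simp]: "sets gauss = sets borel"
  by (simp add: gauss_def)

lemma space_gauss [simp]: "space gauss = UNIV"
  by (simp add: gauss_def)

lemma prob_space_gauss: "prob_space gauss"
  unfolding gauss_def by (rule prob_space_normal_density) simp

lemma nn_integral_gauss:
  assumes "f \<in> borel_measurable borel"
  shows "(\<integral>\<^sup>+x. f x \<partial>gauss) = (\<integral>\<^sup>+x. ennreal (exp (- x\<^sup>2)) * f x \<partial>lborel) / ennreal (sqrt pi)"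
proof -
  have "(\<integral>\<^sup>+x. f x \<partial>gauss) = (\<integral>\<^sup>+x. ennreal (exp (- x\<^sup>2) / sqrt pi) * f x \<partial>lborel)"
    unfolding gauss_def gauss_density using assms by (subst nn_integral_density) auto
  also have "\<dots> = (\<integral>\<^sup>+x. (ennreal (exp (- x\<^sup>2)) * f x) * ennreal (1 / sqrt pi) \<partial>lborel)"
    by (rule nn_integral_cong) (simp add: divide_inverse ennreal_mult' ac_simps)
  also have "\<dots> = (\<integral>\<^sup>+x. ennreal (exp (- x\<^sup>2)) * f x \<partial>lborel) * ennreal (1 / sqrt pi)"
    using assms by (intro nn_integral_multc) auto
  also have "ennreal (1 / sqrt pi) = inverse (ennreal (sqrt pi))"
    by (simp add: divide_inverse inverse_ennreal)
  finally show ?thesis by (simp add: divide_ennreal_def)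
qed

text \<open>The one-dimensional Brunn-Minkowski inequality in the case where the sumset is contained in
  an interval: the enclosing intervals of \<open>A\<close> and \<open>B\<close> add up to an interval of length at most \<open>2 * r\<close>,
  because suprema and infima add.\<close>
lemma emeasure_add_le_of_bounded_sums:
  fixes A B :: "real set"
  assumes "A \<noteq> {}" "B \<noteq> {}" and bd: "\<And>a b. a \<in> A \<Longrightarrow> b \<in> B \<Longrightarrow> \<bar>a + b\<bar> \<le> r"
  shows "emeasure lborel A + emeasure lborel B \<le> ennreal (2 * r)"
proof -
  obtain a0 b0 where 0: "a0 \<in> A" "b0 \<in> B" using assms by blast
  have A: "bdd_above A" "bdd_below A"
    using bd[OF _ 0(2)] unfolding bdd_above_def bdd_below_def
    by (intro exI[of _ "r - b0"] ballI, fastforce, intro exI[of _ "- r - b0"] ballI, fastforce)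
  have B: "bdd_above B" "bdd_below B"
    using bd[OF 0(1)] unfolding bdd_above_def bdd_below_def
    by (intro exI[of _ "r - a0"] ballI, fastforce, intro exI[of _ "- r - a0"] ballI, fastforce)
  have *: "a + b \<le> r" "- r \<le> a + b" if "a \<in> A" "b \<in> B" for a b
    using bd[OF that] by auto
  have "a \<le> r - Sup B" if "a \<in> A" for a
  proof -
    have "Sup B \<le> r - a" by (rule cSup_least) (use *(1)[OF that] assms in force)+
    then show ?thesis by simp
  qed
  then have s: "Sup A + Sup B \<le> r" using cSup_least[OF assms(1), of "r - Sup B"] by force
  have "- r - Inf B \<le> a" if "a \<in> A" for a
  proof -
    have "- r - a \<le> Inf B" by (rule cInf_greatest) (use *(2)[OF that] assms in force)+
    then show ?thesis by simp
  qed
  then have i: "- r \<le> Inf A + Inf B" using cInf_greatest[OF assms(1), of "- r - Inf B"] by force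
  have "A \<subseteq> {Inf A..Sup A}" "B \<subseteq> {Inf B..Sup B}"
    using A B by (auto intro: cInf_lower cSup_upper)
  then have "emeasure lborel A \<le> emeasure lborel {Inf A..Sup A}"
    "emeasure lborel B \<le> emeasure lborel {Inf B..Sup B}"
    by (auto intro!: emeasure_mono)
  moreover have "Inf A \<le> Sup A" "Inf B \<le> Sup B"
    using 0 A B by (meson cInf_lower cSup_upper order.trans)+
  ultimately have "emeasure lborel A + emeasure lborel B \<le>
      ennreal (Sup A - Inf A) + ennreal (Sup B - Inf B)"
    by (auto intro: add_mono)
  also have "\<dots> = ennreal (Sup A - Inf A + (Sup B - Inf B))"
    using \<open>Inf A \<le> Sup A\<close> \<open>Inf B \<le> Sup B\<close> by (simp add: ennreal_plus)
  also have "\<dots> \<le> ennreal (2 * r)" using s i by (intro ennreal_leI) linarith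
  finally show ?thesis .
qed

text \<open>The integral as an integral over levels. The truncation at \<open>1\<close> restricts the levels to
  \<open>(0, 1)\<close>, where the level sets of two functions with supremum \<open>1\<close> are both nonempty.\<close>
lemma layer_cake_truncated:
  fixes f :: "real \<Rightarrow> real"
  assumes [measurable]: "f \<in> borel_measurable borel"
  shows "(\<integral>\<^sup>+\<tau>\<in>{0<..<1}. emeasure lborel {s. \<tau> < f s} \<partial>lborel)
    = (\<integral>\<^sup>+s. ennreal (min 1 (f s)) \<partial>lborel)"
proof -
  define g where "g s \<tau> = (if 0 < \<tau> \<and> \<tau> < 1 \<and> \<tau> < f s then 1 else 0 :: ennreal)" for s \<tau>
  have "(\<integral>\<^sup>+\<tau>\<in>{0<..<1}. emeasure lborel {s. \<tau> < f s} \<partial>lborel) = (\<integral>\<^sup>+\<tau>. (\<integral>\<^sup>+s. g s \<tau> \<partial>lborel) \<partial>lborel)"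
  proof (rule nn_integral_cong)
    fix \<tau> :: real
    have "(\<integral>\<^sup>+s. g s \<tau> \<partial>lborel) = (\<integral>\<^sup>+s. indicator {0<..<1} \<tau> * indicator {s. \<tau> < f s} s \<partial>lborel)"
      by (rule nn_integral_cong) (auto simp: indicator_def g_def)
    also have "\<dots> = indicator {0<..<1} \<tau> * emeasure lborel {s. \<tau> < f s}"
      by (subst nn_integral_cmult) auto
    finally show "emeasure lborel {s. \<tau> < f s} * indicator {0<..<1} \<tau> = (\<integral>\<^sup>+s. g s \<tau> \<partial>lborel)"
      by (simp add: mult.commute)
  qed
  also have "\<dots> = (\<integral>\<^sup>+s. (\<integral>\<^sup>+\<tau>. g s \<tau> \<partial>lborel) \<partial>lborel)"
  proof (rule lborel_pair.Fubini')
    show "(\<lambda>(s, \<tau>). g s \<tau>) \<in> borel_measurable (lborel \<Otimes>\<^sub>M (lborel :: real measure))"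
      unfolding g_def by measurable
  qed
  also have "\<dots> = (\<integral>\<^sup>+s. ennreal (min 1 (f s)) \<partial>lborel)"
  proof (rule nn_integral_cong)
    fix s :: real
    have "(\<integral>\<^sup>+\<tau>. g s \<tau> \<partial>lborel) = (\<integral>\<^sup>+\<tau>. indicator {0<..<min 1 (f s)} \<tau> \<partial>lborel)"
      by (rule nn_integral_cong) (auto simp: indicator_def g_def)
    also have "\<dots> = ennreal (min 1 (f s))"
      by (cases "0 \<le> min 1 (f s)") (auto simp: ennreal_neg greaterThanLessThan_empty_iff)
    finally show "(\<integral>\<^sup>+\<tau>. g s \<tau> \<partial>lborel) = ennreal (min 1 (f s))" .
  qed
  finally show ?thesis .
qed

text \<open>With \<open>f s = exp (- s\<^sup>2) * u s\<close> and \<open>g t = exp (- t\<^sup>2) * v t\<close> the hypothesis reads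
  \<open>f s * g t \<le> (exp (- z\<^sup>2))\<^sup>2\<close> for the midpoint \<open>z\<close> of \<open>s\<close> and \<open>t\<close>, and the claim is
  \<open>\<integral>f * \<integral>g \<le> pi\<close>. After normalising \<open>f\<close> and \<open>g\<close> to supremum \<open>1\<close>, the midpoints of the
  \<open>\<tau>\<close>-level sets lie in a level set of the Gaussian density, which is an interval. Brunn-Minkowski
  at each level, integration over \<open>\<tau>\<close> and the inequality of arithmetic and geometric means finish
  the proof.\<close>
lemma prekopa_leindler_real:
  fixes u v :: "real \<Rightarrow> ennreal"
  assumes [measurable]: "u \<in> borel_measurable borel" "v \<in> borel_measurable borel"
    and uv: "\<And>s t. u s * v t \<le> ennreal (exp ((s - t)\<^sup>2 / 2))"
  shows "(\<integral>\<^sup>+s. u s \<partial>gauss) * (\<integral>\<^sup>+t. v t \<partial>gauss) \<le> 1"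
proof -
  define f where "f s = ennreal (exp (- s\<^sup>2)) * u s" for s
  define g where "g s = ennreal (exp (- s\<^sup>2)) * v s" for s
  have [measurable]: "f \<in> borel_measurable borel" "g \<in> borel_measurable borel"
    unfolding f_def g_def by measurable
  have fg: "f s * g t \<le> ennreal (exp (- (s + t)\<^sup>2 / 2))" for s t
  proof -
    have "f s * g t = ennreal (exp (- s\<^sup>2) * exp (- t\<^sup>2)) * (u s * v t)"
      by (simp add: f_def g_def ennreal_mult ac_simps)
    also have "\<dots> \<le> ennreal (exp (- s\<^sup>2) * exp (- t\<^sup>2)) * ennreal (exp ((s - t)\<^sup>2 / 2))"
      by (intro mult_left_mono uv) auto
    also have "\<dots> = ennreal (exp (- s\<^sup>2 - t\<^sup>2 + (s - t)\<^sup>2 / 2))"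
      by (simp add: ennreal_mult[symmetric] exp_add[symmetric])
    also have "- s\<^sup>2 - t\<^sup>2 + (s - t)\<^sup>2 / 2 = - (s + t)\<^sup>2 / 2"
      by (simp add: power2_eq_square field_simps)
    finally show ?thesis .
  qed
  have "(\<integral>\<^sup>+s. f s \<partial>lborel) * (\<integral>\<^sup>+t. g t \<partial>lborel) \<le> ennreal pi"
  proof (cases "(\<forall>s. f s = 0) \<or> (\<forall>s. g s = 0)")
    case True
    then have "(\<integral>\<^sup>+s. f s \<partial>lborel) = 0 \<or> (\<integral>\<^sup>+t. g t \<partial>lborel) = 0" by auto
    then show ?thesis by auto
  next
    case False
    define F where "F = (SUP s. f s)"
    define G where "G = (SUP s. g s)"
    have F0: "F \<noteq> 0" "G \<noteq> 0"
      using False unfolding F_def G_def by (auto simp: SUP_eq_iff bot_ennreal)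
    have FG: "F * G \<le> 1"
    proof -
      have "F * G = (SUP s. SUP t. f s * g t)"
        unfolding F_def G_def by (subst SUP_mult_right_ennreal) (simp add: SUP_mult_left_ennreal)
      also have "\<dots> \<le> 1"
      proof (intro SUP_least)
        fix s t
        have "f s * g t \<le> ennreal (exp (- (s + t)\<^sup>2 / 2))" by (rule fg)
        also have "\<dots> \<le> ennreal 1" by (rule ennreal_leI) simp
        finally show "f s * g t \<le> 1" by simp
      qed
      finally show ?thesis .
    qed
    have "F \<noteq> Orderings.top" "G \<noteq> Orderings.top" using FG F0
      by (auto simp: ennreal_mult_top ennreal_top_mult top_unique)
    then obtain a b where ab: "F = ennreal a" "G = ennreal b" "0 < a" "0 < b"
      using F0 by (metis ennreal_cases ennreal_0 less_eq_real_def)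
    have ab1: "a * b \<le> 1" using FG ab by (simp add: ennreal_mult[symmetric])
    have fF: "f s \<le> ennreal a" "g s \<le> ennreal b" for s
      unfolding ab(1,2)[symmetric] F_def G_def by (auto intro: SUP_upper)
    define p where "p s = enn2real (f s) / a" for s
    define q where "q s = enn2real (g s) / b" for s
    have [measurable]: "p \<in> borel_measurable borel" "q \<in> borel_measurable borel"
      unfolding p_def q_def by measurable
    have fp: "f s = ennreal a * ennreal (p s)" "g s = ennreal b * ennreal (q s)" for s
      using fF[of s] ab(3,4) unfolding p_def q_def
      by (auto simp: ennreal_mult[symmetric] ennreal_enn2real_if top_unique)
    have p01: "0 \<le> p s" "p s \<le> 1" "0 \<le> q s" "q s \<le> 1" for s
      using fF[of s] ab(3,4) unfolding p_def q_def
      by (auto simp: divide_le_eq_1 enn2real_leI)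
    \<comment> \<open>Dividing the Gaussian density by the geometric mean of the two suprema keeps the hypothesis
      intact when \<open>f\<close> and \<open>g\<close> are normalised.\<close>
    define c where "c = sqrt (a * b)"
    have c: "0 < c" "c \<le> 1" "c\<^sup>2 = a * b" using ab ab1 by (auto simp: c_def)
    have pq: "p s * q t * (a * b) \<le> exp (- (s + t)\<^sup>2 / 2)" for s t
    proof -
      have "ennreal (p s * q t * (a * b)) = f s * g t"
        using ab(3,4) p01 by (simp add: fp ennreal_mult mult_ac)
      also note fg[of s t]
      finally show ?thesis by simp
    qed
    define h where "h z = exp (- z\<^sup>2) / c" for z :: real
    have [measurable]: "h \<in> borel_measurable borel" unfolding h_def by measurable
    have level: "emeasure lborel {s. \<tau> < p s} + emeasure lborel {s. \<tau> < q s}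
        \<le> 2 * emeasure lborel {z. \<tau> < h z}" if \<tau>: "0 < \<tau>" "\<tau> < 1" for \<tau>
    proof -
      define r where "r = sqrt (- ln (c * \<tau>))"
      have "c * \<tau> \<le> \<tau>" using mult_right_mono[OF c(2), of \<tau>] \<tau> by simp
      then have ct1: "c * \<tau> < 1" using \<tau>(2) by linarith
      have ct: "0 < c * \<tau>" "c * \<tau> < 1" using c \<tau> ct1 by simp_all
      have r: "0 < r" "r\<^sup>2 = - ln (c * \<tau>)" using ct by (auto simp: r_def)
      have iff: "c * \<tau> < exp (- z\<^sup>2) \<longleftrightarrow> \<bar>z\<bar> < r" for z :: real
      proof -
        have "c * \<tau> < exp (- z\<^sup>2) \<longleftrightarrow> ln (c * \<tau>) < - z\<^sup>2"
          using ct by (metis exp_ln exp_less_cancel_iff)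
        also have "\<dots> \<longleftrightarrow> z\<^sup>2 < r\<^sup>2" unfolding r by linarith
        also have "\<dots> \<longleftrightarrow> \<bar>z\<bar> < r" using r(1) by (metis abs_le_square_iff abs_of_pos not_le)
        finally show ?thesis .
      qed
      have ne: "{s. \<tau> < p s} \<noteq> {}" "{s. \<tau> < q s} \<noteq> {}"
      proof -
        have "ennreal (a * \<tau>) < F" "ennreal (b * \<tau>) < G" using ab \<tau> by (auto intro!: ennreal_lessI)
        then obtain s t where "ennreal (a * \<tau>) < f s" "ennreal (b * \<tau>) < g t"
          unfolding F_def G_def by (auto simp: less_SUP_iff)
        then have "\<tau> < p s" "\<tau> < q t" using ab(3,4) \<tau> p01
          by (auto simp: fp ennreal_mult[symmetric] ennreal_less_iff)
        then show "{s. \<tau> < p s} \<noteq> {}" "{s. \<tau> < q s} \<noteq> {}" by auto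
      qed
      have bound: "emeasure lborel {s. \<tau> < p s} + emeasure lborel {s. \<tau> < q s} \<le> ennreal (2 * (2 * r))"
      proof (rule emeasure_add_le_of_bounded_sums[OF ne])
        fix s t assume "s \<in> {s. \<tau> < p s}" "t \<in> {s. \<tau> < q s}"
        then have "\<tau> * \<tau> < p s * q t" using \<tau> by (intro mult_strict_mono) auto
        then have "\<tau> * \<tau> * (a * b) < p s * q t * (a * b)" using ab by simp
        also note pq[of s t]
        also have "exp (- (s + t)\<^sup>2 / 2) = (exp (- ((s + t) / 2)\<^sup>2))\<^sup>2"
          by (simp add: exp_double[symmetric] power_divide field_simps)
        also have "\<tau> * \<tau> * (a * b) = (c * \<tau>)\<^sup>2"
          using c by (simp add: power_mult_distrib power2_eq_square)
        finally have "c * \<tau> < exp (- ((s + t) / 2)\<^sup>2)"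
          by (rule power2_less_imp_less) simp
        then have "\<bar>(s + t) / 2\<bar> < r" by (simp only: iff)
        then show "\<bar>s + t\<bar> \<le> 2 * r" by simp
      qed
      have hiff: "\<tau> < h z \<longleftrightarrow> \<bar>z\<bar> < r" for z
        using iff[of z] c by (simp add: h_def pos_less_divide_eq mult.commute)
      have "{z. \<tau> < h z} = {-r<..<r}" unfolding hiff by (auto simp: abs_less_iff)
      then have "ennreal (2 * (2 * r)) = 2 * emeasure lborel {z. \<tau> < h z}"
        using r by (simp add: ennreal_mult)
      with bound show ?thesis by simp
    qed
    have "(\<integral>\<^sup>+s. ennreal (p s) \<partial>lborel) + (\<integral>\<^sup>+s. ennreal (q s) \<partial>lborel)
      = (\<integral>\<^sup>+\<tau>\<in>{0<..<1}. emeasure lborel {s. \<tau> < p s} \<partial>lborel)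
      + (\<integral>\<^sup>+\<tau>\<in>{0<..<1}. emeasure lborel {s. \<tau> < q s} \<partial>lborel)"
      using p01 by (simp add: layer_cake_truncated min_absorb2)
    also have "\<dots> = (\<integral>\<^sup>+\<tau>\<in>{0<..<1}. (emeasure lborel {s. \<tau> < p s} + emeasure lborel {s. \<tau> < q s}) \<partial>lborel)"
    proof -
      have m: "(\<lambda>\<tau>. emeasure lborel {s. \<tau> < w s}) \<in> borel_measurable lborel"
        if [measurable]: "w \<in> borel_measurable borel" for w :: "real \<Rightarrow> real"
      proof -
        have "(\<lambda>\<tau>. emeasure lborel {s \<in> space lborel. \<tau> < w s}) \<in> borel_measurable lborel" by measurable
        then show ?thesis by simp
      qed
      have [measurable]: "(\<lambda>\<tau>. emeasure lborel {s. \<tau> < p s}) \<in> borel_measurable lborel"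
        "(\<lambda>\<tau>. emeasure lborel {s. \<tau> < q s}) \<in> borel_measurable lborel"
        by (intro m; measurable)+
      show ?thesis
        by (subst nn_integral_add[symmetric]) (auto simp: distrib_right)
    qed
    also have "\<dots> \<le> (\<integral>\<^sup>+\<tau>. 2 * (emeasure lborel {z. \<tau> < h z} * indicator {0<..<1} \<tau>) \<partial>lborel)"
      by (rule nn_integral_mono) (use level in \<open>auto simp: indicator_def\<close>)
    also have "\<dots> = 2 * (\<integral>\<^sup>+\<tau>\<in>{0<..<1}. emeasure lborel {z. \<tau> < h z} \<partial>lborel)"
    proof -
      have "(\<lambda>\<tau>. emeasure lborel {s \<in> space lborel. \<tau> < h s}) \<in> borel_measurable lborel" by measurable
      then have [measurable]: "(\<lambda>\<tau>. emeasure lborel {s. \<tau> < h s}) \<in> borel_measurable lborel" by simp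
      show ?thesis by (rule nn_integral_cmult) measurable
    qed
    also have "\<dots> \<le> 2 * (\<integral>\<^sup>+z. ennreal (exp (- z\<^sup>2)) * ennreal (1 / c) \<partial>lborel)"
      unfolding layer_cake_truncated[OF \<open>h \<in> borel_measurable borel\<close>]
      by (intro mult_left_mono nn_integral_mono)
         (use c in \<open>auto simp: h_def ennreal_mult[symmetric] intro!: ennreal_leI\<close>)
    also have "\<dots> = ennreal (2 * (sqrt pi / c))"
    proof -
      have "ennreal (2 * (sqrt pi / c)) = ennreal 2 * (ennreal (sqrt pi) * ennreal (1 / c))"
        using c ennreal_mult[of "sqrt pi" "1 / c"] ennreal_mult[of 2 "sqrt pi / c"] by simp
      then show ?thesis by (subst nn_integral_multc) (auto simp: nn_integral_exp_minus_square)
    qed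
    finally have sum: "(\<integral>\<^sup>+s. ennreal (p s) \<partial>lborel) + (\<integral>\<^sup>+s. ennreal (q s) \<partial>lborel) \<le> ennreal (2 * (sqrt pi / c))" .
    then have "(\<integral>\<^sup>+s. ennreal (p s) \<partial>lborel) \<noteq> Orderings.top" "(\<integral>\<^sup>+s. ennreal (q s) \<partial>lborel) \<noteq> Orderings.top"
      by (auto simp: top_unique)
    then obtain X Y where XY: "(\<integral>\<^sup>+s. ennreal (p s) \<partial>lborel) = ennreal X" "0 \<le> X"
      "(\<integral>\<^sup>+s. ennreal (q s) \<partial>lborel) = ennreal Y" "0 \<le> Y"
      by (metis ennreal_cases)
    have "X + Y \<le> 2 * (sqrt pi / c)"
      using sum XY c by (simp add: ennreal_plus[symmetric] del: ennreal_plus)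
    then have "(X + Y)\<^sup>2 \<le> (2 * (sqrt pi / c))\<^sup>2" using XY by (intro power_mono) auto
    then have "X * Y \<le> pi / (a * b)"
      using zero_le_power2[of "X - Y"] c(3)
      by (simp add: power2_sum power2_diff power_mult_distrib power_divide)
    then have "a * b * (X * Y) \<le> pi" using ab by (simp add: field_simps)
    then have "ennreal (a * X) * ennreal (b * Y) \<le> ennreal pi"
      using ab XY by (simp add: ennreal_mult[symmetric] ac_simps)
    moreover have "(\<integral>\<^sup>+s. f s \<partial>lborel) = ennreal (a * X)" "(\<integral>\<^sup>+s. g s \<partial>lborel) = ennreal (b * Y)"
      unfolding fp using ab XY by (subst nn_integral_cmult; simp add: ennreal_mult)+
    ultimately show ?thesis by simp
  qed
  then have "(\<integral>\<^sup>+s. f s \<partial>lborel) * (\<integral>\<^sup>+t. g t \<partial>lborel) / ennreal pi \<le> ennreal pi / ennreal pi"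
    by (rule divide_right_mono_ennreal)
  also have "ennreal pi / ennreal pi = 1" by (simp add: divide_ennreal)
  also have "(\<integral>\<^sup>+s. f s \<partial>lborel) * (\<integral>\<^sup>+t. g t \<partial>lborel) / ennreal pi
     = ((\<integral>\<^sup>+s. f s \<partial>lborel) / ennreal (sqrt pi)) * ((\<integral>\<^sup>+t. g t \<partial>lborel) / ennreal (sqrt pi))"
  proof -
    have "inverse (ennreal pi) = inverse (ennreal (sqrt pi)) * inverse (ennreal (sqrt pi))"
      by (simp add: inverse_ennreal ennreal_mult[symmetric] inverse_mult_distrib[symmetric] del: inverse_mult_distrib)
    then show ?thesis by (simp add: divide_ennreal_def ac_simps)
  qed
  finally show ?thesis by (simp add: nn_integral_gauss f_def g_def)
qed

lemma sum_sq_fun_upd: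
  fixes x y :: "'a \<Rightarrow> real"
  assumes "finite I" "i \<notin> I"
  shows "(\<Sum>j\<in>insert i I. ((x(i := s)) j - (y(i := t)) j)\<^sup>2) = (s - t)\<^sup>2 + (\<Sum>j\<in>I. (x j - y j)\<^sup>2)"
proof -
  have "(\<Sum>j\<in>I. ((x(i := s)) j - (y(i := t)) j)\<^sup>2) = (\<Sum>j\<in>I. (x j - y j)\<^sup>2)"
    using assms by (intro sum.cong) auto
  then show ?thesis using assms by simp
qed

text \<open>Integrating out all coordinates but one turns the hypothesis for \<open>n + 1\<close> coordinates into the
  one-dimensional hypothesis for the two marginals: for fixed last coordinates \<open>s\<close>, \<open>t\<close> the induction
  hypothesis applies once the factor \<open>exp (- (s - t)\<^sup>2 / 2)\<close> is moved into one of the functions.\<close>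
lemma prekopa_leindler_gauss:
  fixes u v :: "('a \<Rightarrow> real) \<Rightarrow> ennreal"
  assumes "finite I"
    and "u \<in> borel_measurable (Pi\<^sub>M I (\<lambda>_. gauss))" "v \<in> borel_measurable (Pi\<^sub>M I (\<lambda>_. gauss))"
    and "\<And>x y. x \<in> space (Pi\<^sub>M I (\<lambda>_. gauss)) \<Longrightarrow> y \<in> space (Pi\<^sub>M I (\<lambda>_. gauss)) \<Longrightarrow>
      u x * v y \<le> ennreal (exp ((\<Sum>i\<in>I. (x i - y i)\<^sup>2) / 2))"
  shows "(\<integral>\<^sup>+x. u x \<partial>Pi\<^sub>M I (\<lambda>_. gauss)) * (\<integral>\<^sup>+x. v x \<partial>Pi\<^sub>M I (\<lambda>_. gauss)) \<le> 1"
  using assms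
proof (induction I arbitrary: u v rule: finite_induct)
  case empty
  interpret product_sigma_finite "\<lambda>_::'a. gauss"
    by (intro product_sigma_finite.intro prob_space_imp_sigma_finite prob_space_gauss)
  show ?case using empty(3)[of "\<lambda>_. undefined" "\<lambda>_. undefined"]
    by (simp add: nn_integral_empty space_PiM_empty)
next
  case (insert i I)
  interpret product_sigma_finite "\<lambda>_::'a. gauss"
    by (intro product_sigma_finite.intro prob_space_imp_sigma_finite prob_space_gauss)
  let ?P = "Pi\<^sub>M I (\<lambda>_. gauss)"
  interpret P: sigma_finite_measure ?P using insert(1) by (rule sigma_finite)
  have [measurable]: "u \<in> borel_measurable (Pi\<^sub>M (insert i I) (\<lambda>_. gauss))"
    "v \<in> borel_measurable (Pi\<^sub>M (insert i I) (\<lambda>_. gauss))" by fact+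
  have sp: "x(i := s) \<in> space (Pi\<^sub>M (insert i I) (\<lambda>_. gauss))" if "x \<in> space ?P" for x s
    using that by (auto simp: space_PiM PiE_def extensional_def)
  have split: "(\<integral>\<^sup>+x. w x \<partial>Pi\<^sub>M (insert i I) (\<lambda>_. gauss)) = (\<integral>\<^sup>+s. \<integral>\<^sup>+x. w (x(i := s)) \<partial>?P \<partial>gauss)"
    if "w \<in> borel_measurable (Pi\<^sub>M (insert i I) (\<lambda>_. gauss))" for w
    using insert(1,2) that by (rule product_nn_integral_insert_rev)
  have mU: "(\<lambda>s. \<integral>\<^sup>+x. w (x(i := s)) \<partial>?P) \<in> borel_measurable borel"
    if [measurable]: "w \<in> borel_measurable (Pi\<^sub>M (insert i I) (\<lambda>_. gauss))" for w
  proof -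
    have "(\<lambda>(s, x). w (x(i := s))) \<in> borel_measurable (gauss \<Otimes>\<^sub>M ?P)" by measurable
    from P.borel_measurable_nn_integral[OF this] show ?thesis by simp
  qed
  show ?case unfolding split[OF insert(4)] split[OF insert(5)]
  proof (rule prekopa_leindler_real[OF mU mU])
    fix s t :: real
    let ?e = "ennreal (exp ((s - t)\<^sup>2 / 2))" and ?e' = "ennreal (exp (- (s - t)\<^sup>2 / 2))"
    have ee: "?e * ?e' = 1" by (simp add: ennreal_mult[symmetric] exp_add[symmetric])
    have us: "(\<lambda>x. w (x(i := s))) \<in> borel_measurable ?P"
      if [measurable]: "w \<in> borel_measurable (Pi\<^sub>M (insert i I) (\<lambda>_. gauss))" for w s
      by measurable
    note [measurable] = us[OF insert(4)] us[OF insert(5)]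
    have "(\<integral>\<^sup>+x. u (x(i := s)) \<partial>?P) * (\<integral>\<^sup>+x. ?e' * v (x(i := t)) \<partial>?P) \<le> 1"
    proof (rule insert.IH)
      fix x y assume xy: "x \<in> space ?P" "y \<in> space ?P"
      have "u (x(i := s)) * (?e' * v (y(i := t))) = ?e' * (u (x(i := s)) * v (y(i := t)))"
        by (simp add: ac_simps)
      also have "\<dots> \<le> ?e' * ennreal (exp ((\<Sum>j\<in>insert i I. ((x(i := s)) j - (y(i := t)) j)\<^sup>2) / 2))"
        by (intro mult_left_mono insert.prems(3) sp xy) auto
      also have "\<dots> = ennreal (exp ((\<Sum>j\<in>I. (x j - y j)\<^sup>2) / 2))"
        unfolding sum_sq_fun_upd[OF insert(1,2)]
        by (simp add: ennreal_mult[symmetric] exp_add[symmetric] add_divide_distrib)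
      finally show "u (x(i := s)) * (?e' * v (y(i := t))) \<le> ennreal (exp ((\<Sum>j\<in>I. (x j - y j)\<^sup>2) / 2))" .
    qed measurable
    then have "?e' * ((\<integral>\<^sup>+x. u (x(i := s)) \<partial>?P) * (\<integral>\<^sup>+x. v (x(i := t)) \<partial>?P)) \<le> 1"
      by (subst (asm) nn_integral_cmult) (auto simp: ac_simps)
    then have "?e * (?e' * ((\<integral>\<^sup>+x. u (x(i := s)) \<partial>?P) * (\<integral>\<^sup>+x. v (x(i := t)) \<partial>?P))) \<le> ?e * 1"
      by (rule mult_left_mono) simp
    then show "(\<integral>\<^sup>+x. u (x(i := s)) \<partial>?P) * (\<integral>\<^sup>+x. v (x(i := t)) \<partial>?P) \<le> ?e"
      unfolding mult.assoc[symmetric] ee by simp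
  qed (use insert in auto)
qed

lemma prob_space_PiM_gauss: "prob_space (Pi\<^sub>M I (\<lambda>_. gauss))"
  by (intro prob_space_PiM prob_space_gauss)

text \<open>The functional inequality for \<open>u = exp (D / 2) * indicator K\<close> and \<open>v = indicator L\<close>.\<close>
theorem gauss_two_set_inequality:
  fixes K L :: "('a \<Rightarrow> real) set"
  defines "P \<equiv> \<lambda>I. Pi\<^sub>M I (\<lambda>_. gauss)"
  assumes "finite I" and [measurable]: "K \<in> sets (P I)" "L \<in> sets (P I)"
    and D: "\<And>x y. x \<in> K \<Longrightarrow> y \<in> L \<Longrightarrow> D \<le> (\<Sum>i\<in>I. (x i - y i)\<^sup>2)"
  shows "measure (P I) K * measure (P I) L \<le> exp (- D / 2)"
proof -
  interpret prob_space "P I" unfolding P_def by (rule prob_space_PiM_gauss)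
  have mK: "K \<in> sets (Pi\<^sub>M I (\<lambda>_. gauss))" and mL: "L \<in> sets (Pi\<^sub>M I (\<lambda>_. gauss))"
    using assms(3,4) by (simp_all add: P_def)
  let ?e = "ennreal (exp (D / 2))"
  have "(\<integral>\<^sup>+x. ?e * indicator K x \<partial>P I) * (\<integral>\<^sup>+x. indicator L x \<partial>P I) \<le> 1"
    unfolding P_def
  proof (rule prekopa_leindler_gauss[OF assms(2)])
    show "?e * indicator K x * indicator L y \<le> ennreal (exp ((\<Sum>i\<in>I. (x i - y i)\<^sup>2) / 2))" for x y
      using D[of x y] by (auto simp: indicator_def intro!: ennreal_leI)
  qed (use mK mL in measurable)
  then have "?e * emeasure (P I) K * emeasure (P I) L \<le> 1"
    by (simp add: nn_integral_cmult)
  then have "exp (D / 2) * (measure (P I) K * measure (P I) L) \<le> 1"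
    by (simp add: emeasure_eq_measure ennreal_mult[symmetric] mult.assoc)
  then show ?thesis by (simp add: exp_minus field_simps)
qed

section \<open>Spectral theory of real symmetric matrices\<close>

text \<open>The characteristic polynomial has a complex root \<open>z\<close>; for an eigenvector \<open>v\<close> the form
  \<open>v\<^sup>* A v\<close> equals both its own conjugate and \<open>z * \<parallel>v\<parallel>\<^sup>2\<close>, so \<open>z\<close> is real.\<close>
lemma symmetric_eigenvalue_exists:
  fixes A :: "real mat"
  assumes A: "A \<in> carrier_mat n n" and sym: "transpose_mat A = A" and n: "0 < n"
  shows "\<exists>e. eigenvalue A e"
proof -
  let ?c = complex_of_real
  let ?A = "map_mat ?c A"
  have cA: "?A \<in> carrier_mat n n" using A by simp
  obtain as where as: "char_poly ?A = (\<Prod>a\<leftarrow>as. [:- a, 1:])" "length as = n"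
    using char_poly_factorized[OF cA] by auto
  then obtain z where z: "z \<in> set as" using n by (cases as) auto
  have "poly (char_poly ?A) z = 0"
    unfolding as(1) poly_prod_list by (rule prod_list_zero_iff[THEN iffD2]) (use z in force)
  then have "eigenvalue ?A z" using eigenvalue_root_char_poly[OF cA] by blast
  then obtain v where v: "v \<in> carrier_vec n" "v \<noteq> 0\<^sub>v n" "?A *\<^sub>v v = z \<cdot>\<^sub>v v"
    using cA unfolding eigenvalue_def eigenvector_def by auto
  define q where "q = (\<Sum>i<n. \<Sum>j<n. ?c (A $$ (i, j)) * (cnj (v $ i) * v $ j))"
  define s where "s = (\<Sum>i<n. (cmod (v $ i))\<^sup>2)"
  have "q = (\<Sum>i<n. cnj (v $ i) * (?A *\<^sub>v v) $ i)"
    unfolding q_def using A v(1)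
    by (intro sum.cong refl)
      (auto simp: scalar_prod_def lessThan_atLeast0 sum_distrib_left ac_simps intro!: sum.cong)
  also have "\<dots> = (\<Sum>i<n. z * ?c ((cmod (v $ i))\<^sup>2))"
    unfolding v(3) using v(1) by (intro sum.cong refl)
      (auto simp: complex_norm_square ac_simps simp del: of_real_power)
  also have "\<dots> = z * ?c s" by (simp add: s_def sum_distrib_left)
  finally have qs: "q = z * ?c s" .
  have "A $$ (i, j) = A $$ (j, i)" if "i < n" "j < n" for i j
    using sym A that by (metis carrier_matD index_transpose_mat(1))
  then have "cnj q = (\<Sum>i<n. \<Sum>j<n. ?c (A $$ (j, i)) * (v $ i * cnj (v $ j)))"
    unfolding q_def by (auto intro!: sum.cong)
  also have "\<dots> = q" unfolding q_def by (subst sum.swap) (simp add: ac_simps)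
  finally have qr: "cnj q = q" .
  obtain k where k: "k < n" "v $ k \<noteq> 0" using v(1,2) by (metis eq_vecI carrier_vecD index_zero_vec)
  have "0 < (cmod (v $ k))\<^sup>2" using k by simp
  also have "\<dots> \<le> s" unfolding s_def using k by (intro member_le_sum) auto
  finally have s: "s \<noteq> 0" by simp
  have "cnj z = z" using qr s unfolding qs by simp
  then obtain e where e: "z = ?c e" by (metis Reals_cases Reals_cnj_iff)
  have "?c (poly (char_poly A) e) = poly (char_poly ?A) z"
    unfolding e of_real_hom.char_poly_hom[OF A] by simp
  also have "\<dots> = 0" by fact
  finally show ?thesis using eigenvalue_root_char_poly[OF A] by auto
qed

text \<open>The reflection in the hyperplane orthogonal to \<open>e\<^sub>0 - w\<close> exchanges \<open>e\<^sub>0\<close> and \<open>w\<close>. It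
  supplies an orthogonal matrix with prescribed first column that is moreover its own inverse.\<close>
lemma householder_reflection:
  fixes w :: "real vec"
  assumes w: "w \<in> carrier_vec n" "w \<bullet> w = 1" and n: "0 < n"
  shows "\<exists>H \<in> carrier_mat n n. transpose_mat H = H \<and> H * H = 1\<^sub>m n \<and> (\<forall>i<n. H $$ (i, 0) = w $ i)"
proof (cases "w = unit_vec n 0")
  case True
  then show ?thesis using n by (intro bexI[of _ "1\<^sub>m n"]) auto
next
  case False
  define u where "u i = (if i = 0 then 1 else 0) - w $ i" for i
  define s where "s = (\<Sum>k<n. (u k)\<^sup>2)"
  have ww: "(\<Sum>k<n. (w $ k)\<^sup>2) = 1"
    using w by (simp add: scalar_prod_def lessThan_atLeast0 power2_eq_square)
  have "s = (\<Sum>k<n. (if k = 0 then 1 - 2 * w $ 0 else 0) + (w $ k)\<^sup>2)"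
    unfolding s_def u_def by (intro sum.cong) (auto simp: power2_eq_square algebra_simps)
  also have "\<dots> = 2 * (1 - w $ 0)"
    using n ww by (simp add: sum.distrib)
  finally have s: "s = 2 * u 0" by (simp add: u_def)
  obtain k where "k < n" "u k \<noteq> 0"
    using False w(1) n unfolding u_def by (auto simp: vec_eq_iff unit_vec_def)
  then have "0 < (u k)\<^sup>2" "(u k)\<^sup>2 \<le> s" unfolding s_def by (auto intro: member_le_sum)
  then have s0: "s \<noteq> 0" by linarith
  define H where "H = mat n n (\<lambda>(i, j). (if i = j then 1 else 0) - 2 / s * (u i * u j))"
  have "H * H = 1\<^sub>m n"
  proof (rule eq_matI)
    fix i j assume ij: "i < dim_row (1\<^sub>m n :: real mat)" "j < dim_col (1\<^sub>m n :: real mat)"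
    have "(H * H) $$ (i, j) = (\<Sum>k<n. ((if i = k then 1 else 0) - 2 / s * (u i * u k)) *
        ((if k = j then 1 else 0) - 2 / s * (u k * u j)))"
      using ij by (simp add: H_def scalar_prod_def lessThan_atLeast0)
    also have "\<dots> = (\<Sum>k<n. (if k = i then (if i = j then 1 else 0) - 2 / s * (u i * u j) else 0) +
        (if k = j then - 2 / s * (u i * u j) else 0) + 4 / s\<^sup>2 * u i * u j * (u k)\<^sup>2)"
      by (intro sum.cong refl) (auto simp: algebra_simps power2_eq_square divide_simps)
    also have "\<dots> = (if i = j then 1 else 0) - 4 / s * (u i * u j) + 4 / s\<^sup>2 * u i * u j * s"
    proof -
      have "(\<Sum>k<n. 4 / s\<^sup>2 * u i * u j * (u k)\<^sup>2) = 4 / s\<^sup>2 * u i * u j * s"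
        by (simp only: s_def sum_distrib_left)
      then show ?thesis using ij unfolding sum.distrib by simp
    qed
    also have "\<dots> = 1\<^sub>m n $$ (i, j)" using s0 ij by (simp add: power2_eq_square)
    finally show "(H * H) $$ (i, j) = 1\<^sub>m n $$ (i, j)" .
  qed (auto simp: H_def)
  moreover have "transpose_mat H = H" by (rule eq_matI) (auto simp: H_def)
  moreover have "H $$ (i, 0) = w $ i" if "i < n" for i
  proof -
    have "H $$ (i, 0) = (if i = 0 then 1 else 0) - u i * (2 * u 0 / s)"
      using that n by (simp add: H_def)
    also have "2 * u 0 / s = 1" using s s0 by simp
    finally show ?thesis by (simp add: u_def)
  qed
  ultimately show ?thesis by (intro bexI[of _ H]) (auto simp: H_def)
qed

definition spectral_decomp :: "nat \<Rightarrow> real mat \<Rightarrow> real mat \<Rightarrow> (nat \<Rightarrow> real) \<Rightarrow> bool" where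
  "spectral_decomp n A U d \<longleftrightarrow> U \<in> carrier_mat n n \<and> transpose_mat U * U = 1\<^sub>m n \<and>
     U * transpose_mat U = 1\<^sub>m n \<and> A = U * mat_diag n d * transpose_mat U"

text \<open>Conjugation by a reflection that moves \<open>e\<^sub>0\<close> to a unit eigenvector splits off a \<open>1 \<times> 1\<close> block,
  and the induction hypothesis diagonalises the complementary symmetric block.\<close>
lemma spectral_theorem:
  assumes "A \<in> sym_mats n"
  shows "\<exists>U d. spectral_decomp n A U d"
  using assms
proof (induction n arbitrary: A)
  case 0
  then show ?case
    by (intro exI[of _ "1\<^sub>m 0"] exI[of _ "\<lambda>_. 0"])
      (auto simp: spectral_decomp_def sym_mats_def intro!: eq_matI)
next
  case (Suc n)
  let ?n = "Suc n"
  note [simp] = mult_carrier_mat[of _ ?n ?n _ ?n]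
  have A[simp]: "A \<in> carrier_mat ?n ?n" and sym: "transpose_mat A = A"
    using Suc.prems by (auto simp: sym_mats_def)
  obtain e v where v: "v \<in> carrier_vec ?n" "v \<noteq> 0\<^sub>v ?n" "A *\<^sub>v v = e \<cdot>\<^sub>v v"
    using symmetric_eigenvalue_exists[OF A sym] A unfolding eigenvalue_def eigenvector_def by auto
  define r where "r = v \<bullet> v"
  have r: "0 < r"
  proof -
    obtain k where k: "k < ?n" "v $ k \<noteq> 0" using v(1,2) by (metis eq_vecI carrier_vecD index_zero_vec)
    have "0 < (v $ k)\<^sup>2" using k by simp
    also have "\<dots> \<le> (\<Sum>k<?n. (v $ k)\<^sup>2)" using k by (intro member_le_sum) auto
    also have "\<dots> = r" using v(1) by (simp add: r_def scalar_prod_def lessThan_atLeast0 power2_eq_square)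
    finally show ?thesis .
  qed
  define w where "w = (1 / sqrt r) \<cdot>\<^sub>v v"
  have w: "w \<in> carrier_vec ?n" using v(1) by (simp add: w_def)
  have ww: "w \<bullet> w = 1" using r v(1) by (simp add: w_def r_def[symmetric])
  have Aw: "A *\<^sub>v w = e \<cdot>\<^sub>v w"
    using v unfolding w_def by (simp add: mult_mat_vec[OF A v(1)] smult_smult_assoc mult.commute)
  obtain H where H[simp]: "H \<in> carrier_mat ?n ?n" and Ht: "transpose_mat H = H"
    and HH: "H * H = 1\<^sub>m ?n" and H0: "\<And>i. i < ?n \<Longrightarrow> H $$ (i, 0) = w $ i"
    using householder_reflection[OF w ww] by auto
  have Hc: "col H 0 = w" using w H0 carrier_matD[OF H] by (intro eq_vecI) auto
  define B where "B = H * A * H"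
  have B[simp]: "B \<in> carrier_mat ?n ?n" by (simp add: B_def)
  have Bt: "transpose_mat B = B"
    unfolding B_def by (simp add: transpose_mult[of _ ?n ?n _ ?n] Ht sym assoc_mult_mat[of _ ?n ?n _ ?n _ ?n])
  have [simp]: "col H 0 \<in> carrier_vec ?n" using w by (simp add: Hc)
  have "col B 0 = H *\<^sub>v (A *\<^sub>v col H 0)"
    unfolding B_def by (simp add: col_mult2[of _ ?n ?n _ ?n] assoc_mult_mat_vec[of _ ?n ?n _ ?n])
  also have "\<dots> = e \<cdot>\<^sub>v (H *\<^sub>v col H 0)" unfolding Hc Aw using mult_mat_vec[OF H w] by simp
  also have "H *\<^sub>v col H 0 = col (H * H) 0" by (simp add: col_mult2[of _ ?n ?n _ ?n])
  also have "\<dots> = unit_vec ?n 0" unfolding HH by simp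
  finally have cB: "col B 0 = e \<cdot>\<^sub>v unit_vec ?n 0" .
  have Bi0: "B $$ (i, 0) = (if i = 0 then e else 0)" if "i < ?n" for i
    using arg_cong[OF cB, of "\<lambda>x. x $ i"] that carrier_matD[OF B] by auto
  have Bs: "B $$ (i, j) = B $$ (j, i)" if "i < ?n" "j < ?n" for i j
    using Bt B that by (metis carrier_matD index_transpose_mat(1))
  define A' where "A' = mat n n (\<lambda>(i, j). B $$ (Suc i, Suc j))"
  have A'[simp]: "A' \<in> carrier_mat n n" by (simp add: A'_def)
  have "A' \<in> sym_mats n" unfolding sym_mats_def
    using Bs by (auto simp: A'_def intro!: eq_matI)
  then obtain V d where V[simp]: "V \<in> carrier_mat n n" and VV: "transpose_mat V * V = 1\<^sub>m n"
    and A'V: "A' = V * mat_diag n d * transpose_mat V"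
    using Suc.IH unfolding spectral_decomp_def by blast
  let ?blk = "\<lambda>x M. four_block_mat (mat 1 1 (\<lambda>_. x)) (0\<^sub>m 1 n) (0\<^sub>m n 1) M :: real mat"
  have blk_mult: "?blk x M * ?blk y N = ?blk (x * y) (M * N)"
    if "M \<in> carrier_mat n n" "N \<in> carrier_mat n n" for x y M N
    using that by (subst mult_four_block_mat[of _ 1 1 _ n _ n _ _ 1 _ n])
      (auto intro!: cong_four_block_mat eq_matI simp: scalar_prod_def)
  have blk_carrier: "?blk x M \<in> carrier_mat ?n ?n" if "M \<in> carrier_mat n n" for x M
    using four_block_carrier_mat[of "mat 1 1 (\<lambda>_. x)" 1 1 M n n "0\<^sub>m 1 n" "0\<^sub>m n 1"] that by simp
  have blk_t: "transpose_mat (?blk x M) = ?blk x (transpose_mat M)" if "M \<in> carrier_mat n n" for x M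
    using that by (subst transpose_four_block_mat[of _ 1 1 _ n _ n])
      (auto intro!: cong_four_block_mat eq_matI)
  define U' where "U' = ?blk 1 V"
  have U'[simp]: "U' \<in> carrier_mat ?n ?n" unfolding U'_def by (rule blk_carrier) simp
  have blk1: "?blk 1 (1\<^sub>m n) = 1\<^sub>m ?n"
    by (rule eq_matI) (auto simp: four_block_mat_def)
  have UU': "transpose_mat U' * U' = 1\<^sub>m ?n"
    unfolding U'_def blk_t[OF V]
    by (subst blk_mult) (use V in simp, use V in simp, simp only: mult_1_right VV blk1)
  have "B = ?blk e A'"
    using Bi0 Bs[of 0] carrier_matD[OF B] carrier_matD[OF A']
    by (intro eq_matI) (auto simp: four_block_mat_def A'_def)
  also have "\<dots> = U' * ?blk e (mat_diag n d) * transpose_mat U'"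
    unfolding U'_def A'V by (simp add: blk_t blk_mult mult_carrier_mat[of _ n n _ n] del: One_nat_def)
  also have "?blk e (mat_diag n d) = mat_diag ?n (case_nat e d)"
    by (rule eq_matI) (auto simp: four_block_mat_def mat_diag_def split: nat.split)
  finally have BU: "B = U' * mat_diag ?n (case_nat e d) * transpose_mat U'" .
  define U where "U = H * U'"
  have U[simp]: "U \<in> carrier_mat ?n ?n" by (simp add: U_def)
  have Ut: "transpose_mat U = transpose_mat U' * H"
    by (simp add: U_def transpose_mult[of _ ?n ?n _ ?n] Ht)
  note assoc = assoc_mult_mat[of _ ?n ?n _ ?n _ ?n]
  have "transpose_mat U * U = transpose_mat U' * ((H * H) * U')"
    unfolding Ut unfolding U_def by (simp add: assoc)
  then have UU: "transpose_mat U * U = 1\<^sub>m ?n"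
    by (simp add: HH UU' left_mult_one_mat[of _ ?n ?n])
  have "A = (H * H) * A * (H * H)"
    by (simp add: HH left_mult_one_mat[of _ ?n ?n] right_mult_one_mat[of _ ?n ?n])
  also have "\<dots> = H * B * H" by (simp add: B_def assoc)
  also have "\<dots> = U * mat_diag ?n (case_nat e d) * transpose_mat U"
    unfolding BU Ut unfolding U_def by (simp add: assoc)
  finally have "A = U * mat_diag ?n (case_nat e d) * transpose_mat U" .
  moreover have "U * transpose_mat U = 1\<^sub>m ?n"
    using UU mat_mult_left_right_inverse[of "transpose_mat U" ?n U] by simp
  ultimately show ?case using UU unfolding spectral_decomp_def by (intro exI[of _ U] exI) auto
qed

lemma spectral_det:
  assumes "spectral_decomp n A U d"
  shows "Determinant.det A = (\<Prod>i<n. d i)"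
proof -
  have U: "U \<in> carrier_mat n n" "U * transpose_mat U = 1\<^sub>m n"
    "A = U * mat_diag n d * transpose_mat U" using assms by (auto simp: spectral_decomp_def)
  have "Determinant.det (mat_diag n d) = (\<Prod>i<n. d i)"
  proof (subst det_upper_triangular[of _ n])
    have "diag_mat (mat_diag n d) = map d [0..<n]" by (auto simp: mat_diag_def diag_mat_def)
    then show "prod_list (diag_mat (mat_diag n d)) = (\<Prod>i<n. d i)"
      using prod.distinct_set_conv_list[of "[0..<n]" d] by (simp add: lessThan_atLeast0)
  qed (auto simp: mat_diag_def)
  moreover have "Determinant.det A = Determinant.det U * Determinant.det (mat_diag n d) * Determinant.det (transpose_mat U)"
    using U(1) unfolding U(3) by (simp add: det_mult[of _ n])
  moreover have "Determinant.det U * Determinant.det (transpose_mat U) = 1"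
    using det_mult[of U n "transpose_mat U"] U by simp
  ultimately show ?thesis by (metis mult.assoc mult.commute mult.right_neutral)
qed

text \<open>The number of eigenvalues in \<open>S\<close> with multiplicity, in the form in which \<open>pos_index\<close> is
  defined: \<open>pos_index A\<close> unfolds to the same sum as \<open>eig_count A {0<..}\<close>.\<close>
definition eig_count :: "real mat \<Rightarrow> real set \<Rightarrow> nat" where
  "eig_count A S = (\<Sum>x | eigenvalue A x \<and> x \<in> S. Polynomial.order x (char_poly A))"

lemma eig_count_spectral:
  assumes "spectral_decomp n A U d"
  shows "eig_count A S = card {i. i < n \<and> d i \<in> S}"
proof -
  have U: "U \<in> carrier_mat n n" "transpose_mat U * U = 1\<^sub>m n" "U * transpose_mat U = 1\<^sub>m n"
    "A = U * mat_diag n d * transpose_mat U" using assms by (auto simp: spectral_decomp_def)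
  then have A: "A \<in> carrier_mat n n"
    by (metis mat_diag_dim mult_carrier_mat transpose_carrier_mat)
  have "similar_mat A (mat_diag n d)"
    unfolding similar_mat_def by (intro exI[of _ U] exI[of _ "transpose_mat U"] similar_mat_witI[of _ _ n])
      (use U A in \<open>auto simp: mat_diag_def\<close>)
  then have "char_poly A = char_poly (mat_diag n d)" by (rule char_poly_similar)
  also have "\<dots> = (\<Prod>a\<leftarrow>diag_mat (mat_diag n d). [:- a, 1:])"
    by (rule char_poly_upper_triangular[OF mat_diag_dim]) (auto simp: mat_diag_def)
  also have "diag_mat (mat_diag n d) = map d [0..<n]"
    by (auto simp: mat_diag_def diag_mat_def)
  finally have cp: "char_poly A = (\<Prod>i\<leftarrow>[0..<n]. [:- d i, 1:])" by (simp add: o_def)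
  have lin: "Polynomial.order x [:- a, 1:] = (if a = x then 1 else 0)" for x a :: real
    using order_power_n_n[of a 1] by (auto intro: order_0I)
  have ord: "Polynomial.order x (char_poly A) = card {i. i < n \<and> d i = x}" for x
  proof -
    have "Polynomial.order x (char_poly A) = (\<Sum>i\<leftarrow>[0..<n]. if d i = x then 1 else 0)"
      unfolding cp by (subst order_prod_list) (auto simp: o_def lin)
    also have "\<dots> = (\<Sum>i<n. if d i = x then 1 else 0)"
      by (simp add: interv_sum_list_conv_sum_set_nat lessThan_atLeast0)
    also have "\<dots> = card ({..<n} \<inter> {i. d i = x})" by (simp add: sum.If_cases)
    also have "{..<n} \<inter> {i. d i = x} = {i. i < n \<and> d i = x}" by auto
    finally show ?thesis .
  qed
  have ev: "eigenvalue A x \<longleftrightarrow> x \<in> d ` {..<n}" for x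
    unfolding eigenvalue_root_char_poly[OF A] cp poly_prod_list prod_list_zero_iff by auto
  have "eig_count A S = (\<Sum>x\<in>d ` {..<n} \<inter> S. card {i. i < n \<and> d i = x})"
    unfolding eig_count_def ord ev by (intro sum.cong) auto
  also have "\<dots> = card (\<Union>x\<in>d ` {..<n} \<inter> S. {i. i < n \<and> d i = x})"
    by (subst card_UN_disjoint) auto
  also have "(\<Union>x\<in>d ` {..<n} \<inter> S. {i. i < n \<and> d i = x}) = {i. i < n \<and> d i \<in> S}" by auto
  finally show ?thesis .
qed

definition fro_sq :: "nat \<Rightarrow> real mat \<Rightarrow> real" where
  "fro_sq n M = (\<Sum>i<n. \<Sum>j<n. (M $$ (i, j))\<^sup>2)"

lemma fro_sq_transpose: "M \<in> carrier_mat n n \<Longrightarrow> fro_sq n (transpose_mat M) = fro_sq n M"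
  unfolding fro_sq_def by (subst sum.swap) (auto intro!: sum.cong)

lemma fro_sq_trace: "M \<in> carrier_mat n n \<Longrightarrow> fro_sq n M = (\<Sum>j<n. (transpose_mat M * M) $$ (j, j))"
  unfolding fro_sq_def
  by (subst sum.swap) (auto intro!: sum.cong simp: scalar_prod_def power2_eq_square lessThan_atLeast0)

lemma fro_sq_orthogonal_left:
  assumes "U \<in> carrier_mat n n" "M \<in> carrier_mat n n" "transpose_mat U * U = 1\<^sub>m n"
  shows "fro_sq n (U * M) = fro_sq n M"
proof -
  have "transpose_mat (U * M) * (U * M) = transpose_mat M * (transpose_mat U * U) * M"
    using assms(1,2) by (simp add: transpose_mult[of _ n n _ n] assoc_mult_mat[of _ n n _ n _ n])
  then show ?thesis using assms by (simp add: fro_sq_trace)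
qed

lemma fro_sq_orthogonal_right:
  assumes "V \<in> carrier_mat n n" "M \<in> carrier_mat n n" "V * transpose_mat V = 1\<^sub>m n"
  shows "fro_sq n (M * V) = fro_sq n M"
proof -
  have "fro_sq n (M * V) = fro_sq n (transpose_mat V * transpose_mat M)"
    using assms fro_sq_transpose[of "M * V" n] by (simp add: transpose_mult[of _ n n _ n])
  also have "\<dots> = fro_sq n M"
    using assms by (subst fro_sq_orthogonal_left) (auto simp: fro_sq_transpose)
  finally show ?thesis .
qed

lemma spectral_fro_sq:
  assumes "spectral_decomp n A U d"
  shows "fro_sq n A = (\<Sum>i<n. (d i)\<^sup>2)"
proof -
  have U: "U \<in> carrier_mat n n" "transpose_mat U * U = 1\<^sub>m n" "U * transpose_mat U = 1\<^sub>m n"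
    "A = U * mat_diag n d * transpose_mat U" using assms by (auto simp: spectral_decomp_def)
  have "fro_sq n A = fro_sq n (mat_diag n d)"
    using U(1-3) unfolding U(4)
    by (subst fro_sq_orthogonal_right) (auto simp: fro_sq_orthogonal_left mat_diag_def)
  also have "\<dots> = (\<Sum>i<n. \<Sum>j<n. if j = i then (d i)\<^sup>2 else 0)"
    unfolding fro_sq_def by (intro sum.cong refl) (auto simp: mat_diag_def)
  finally show ?thesis by simp
qed

text \<open>In the two eigenbases \<open>A - B\<close> has entries \<open>(d i - e j) * W i j\<close>, where \<open>W\<close> is the orthogonal
  matrix of overlaps. The weights \<open>(W i j)\<^sup>2\<close> have row and column sums \<open>1\<close>; at most \<open>n - card J\<close> of
  the mass \<open>card I\<close> of the rows in \<open>I\<close> can lie outside the columns in \<open>J\<close>.\<close>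
lemma spectral_distance:
  assumes "spectral_decomp n A U d" "spectral_decomp n B V e"
    and IJ: "I \<subseteq> {..<n}" "J \<subseteq> {..<n}" and g: "0 \<le> g"
    and gap: "\<And>i j. i \<in> I \<Longrightarrow> j \<in> J \<Longrightarrow> g \<le> \<bar>d i - e j\<bar>"
  shows "(real (card I) + real (card J) - real n) * g\<^sup>2 \<le> fro_sq n (A - B)"
proof -
  have U: "U \<in> carrier_mat n n" "transpose_mat U * U = 1\<^sub>m n" "U * transpose_mat U = 1\<^sub>m n"
    "A = U * mat_diag n d * transpose_mat U" using assms(1) by (auto simp: spectral_decomp_def)
  have V: "V \<in> carrier_mat n n" "transpose_mat V * V = 1\<^sub>m n" "V * transpose_mat V = 1\<^sub>m n"
    "B = V * mat_diag n e * transpose_mat V" using assms(2) by (auto simp: spectral_decomp_def)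
  have [simp]: "mat_diag n x \<in> carrier_mat n n" for x :: "nat \<Rightarrow> real" by (simp add: mat_diag_def)
  have AB: "A \<in> carrier_mat n n" "B \<in> carrier_mat n n" using U V by auto
  note assoc = assoc_mult_mat[of _ n n _ n _ n]
  note [simp] = mult_carrier_mat[of _ n n _ n]
  define W where "W = transpose_mat U * V"
  have W: "W \<in> carrier_mat n n" using U V by (simp add: W_def)
  have "transpose_mat U * A = (transpose_mat U * U) * (mat_diag n d * transpose_mat U)"
    using U(1) unfolding U(4) by (simp add: assoc)
  then have "transpose_mat U * A * V = mat_diag n d * W" using U V by (simp add: assoc W_def left_mult_one_mat[of _ n n])
  moreover have "B * V = V * mat_diag n e * (transpose_mat V * V)"
    using V(1) unfolding V(4) by (simp add: assoc)
  then have "transpose_mat U * B * V = W * mat_diag n e" using U(1) V(1,2) AB by (simp add: assoc W_def right_mult_one_mat[of _ n n])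
  ultimately have "transpose_mat U * (A - B) * V = mat_diag n d * W - W * mat_diag n e"
    using U(1) V(1) AB by (simp add: mult_minus_distrib_mat[of _ n n _ n] minus_mult_distrib_mat[of _ n n _ _ n])
  moreover have "fro_sq n (transpose_mat U * (A - B) * V) = fro_sq n (A - B)"
    using U(1-3) V(1-3) AB fro_sq_orthogonal_left[of "transpose_mat U" n "A - B"]
      fro_sq_orthogonal_right[of V n "transpose_mat U * (A - B)"]
    by (simp add: minus_carrier_mat)
  moreover have "(mat_diag n d * W - W * mat_diag n e) $$ (i, j) = (d i - e j) * W $$ (i, j)"
    if "i < n" "j < n" for i j
    using that W by (simp add: mat_diag_mult_left[OF W] mat_diag_mult_right[OF W] algebra_simps)
  ultimately have dist: "fro_sq n (A - B) = (\<Sum>i<n. \<Sum>j<n. (d i - e j)\<^sup>2 * (W $$ (i, j))\<^sup>2)"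
    unfolding fro_sq_def by (simp add: power_mult_distrib)
  have row: "(\<Sum>j<n. (W $$ (i, j))\<^sup>2) = 1" if "i < n" for i
  proof -
    have "W * transpose_mat W = transpose_mat U * (V * transpose_mat V) * U"
      using U(1) V(1) by (simp add: W_def assoc transpose_mult[of _ n n _ n])
    then have "(W * transpose_mat W) $$ (i, i) = 1" using U V that by simp
    then show ?thesis using that W by (simp add: scalar_prod_def power2_eq_square lessThan_atLeast0)
  qed
  have col: "(\<Sum>i<n. (W $$ (i, j))\<^sup>2) = 1" if "j < n" for j
  proof -
    have "transpose_mat W * W = transpose_mat V * (U * transpose_mat U) * V"
      using U(1) V(1) by (simp add: W_def assoc transpose_mult[of _ n n _ n])
    then have "(transpose_mat W * W) $$ (j, j) = 1" using U V that by simp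
    then show ?thesis using that W by (simp add: scalar_prod_def power2_eq_square lessThan_atLeast0)
  qed
  have fin: "finite I" "finite J" using IJ finite_subset by auto
  have "real (card I) = (\<Sum>i\<in>I. \<Sum>j<n. (W $$ (i, j))\<^sup>2)"
    using row IJ by (subst sum.cong[OF refl row]) auto
  also have "\<dots> = (\<Sum>i\<in>I. \<Sum>j\<in>J. (W $$ (i, j))\<^sup>2) + (\<Sum>i\<in>I. \<Sum>j\<in>{..<n} - J. (W $$ (i, j))\<^sup>2)"
    using IJ by (subst sum.subset_diff[of J]) (auto simp: sum.distrib)
  also have "(\<Sum>i\<in>I. \<Sum>j\<in>{..<n} - J. (W $$ (i, j))\<^sup>2) \<le> (\<Sum>j\<in>{..<n} - J. \<Sum>i<n. (W $$ (i, j))\<^sup>2)"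
    by (subst sum.swap, intro sum_mono sum_mono2) (use IJ in auto)
  also have "\<dots> = real n - real (card J)"
    using col IJ card_mono[OF _ IJ(2)] fin by (simp add: card_Diff_subset of_nat_diff)
  finally have mass: "real (card I) + real (card J) - real n \<le> (\<Sum>i\<in>I. \<Sum>j\<in>J. (W $$ (i, j))\<^sup>2)" by simp
  have "(real (card I) + real (card J) - real n) * g\<^sup>2 \<le> (\<Sum>i\<in>I. \<Sum>j\<in>J. (W $$ (i, j))\<^sup>2) * g\<^sup>2"
    using mass by (rule mult_right_mono) simp
  also have "\<dots> = (\<Sum>i\<in>I. \<Sum>j\<in>J. g\<^sup>2 * (W $$ (i, j))\<^sup>2)"
    by (subst mult.commute) (simp add: sum_distrib_left)
  also have "\<dots> \<le> (\<Sum>i\<in>I. \<Sum>j\<in>J. (d i - e j)\<^sup>2 * (W $$ (i, j))\<^sup>2)"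
  proof (intro sum_mono mult_right_mono)
    fix i j assume "i \<in> I" "j \<in> J"
    then have "g \<le> \<bar>d i - e j\<bar>" by (rule gap)
    then show "g\<^sup>2 \<le> (d i - e j)\<^sup>2" using g by (metis power2_abs power_mono)
  qed simp
  also have "\<dots> \<le> (\<Sum>i<n. \<Sum>j<n. (d i - e j)\<^sup>2 * (W $$ (i, j))\<^sup>2)"
    using IJ by (intro sum_le_included[where i = id] order.trans[OF sum_mono sum_mono2] sum_mono2 sum_nonneg) auto
  finally show ?thesis using dist by simp
qed

section \<open>The Gaussian measure in coordinates\<close>

lemma PiM_gauss_component:
  "i \<in> I \<Longrightarrow> (\<lambda>x. x i) \<in> borel_measurable (Pi\<^sub>M I (\<lambda>_. gauss))"
  using measurable_component_singleton[of i I "\<lambda>_. gauss"]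
  unfolding measurable_cong_sets[OF refl sets_gauss] .

lemma distr_gauss_uminus: "distr gauss borel uminus = gauss"
proof -
  let ?f = "\<lambda>x. ennreal (normal_density 0 (1 / sqrt 2) x)"
  have "gauss = density (distr lborel borel uminus) ?f"
    by (simp add: gauss_def lborel_distr_uminus)
  also have "\<dots> = distr (density lborel (\<lambda>x. ?f (- x))) borel uminus"
    by (rule density_distr) auto
  also have "density lborel (\<lambda>x. ?f (- x)) = gauss"
    by (simp add: gauss_def normal_density_def)
  finally show ?thesis ..
qed

lemma distr_PiM_gauss_uminus:
  assumes "finite I"
  shows "distr (Pi\<^sub>M I (\<lambda>_. gauss)) (Pi\<^sub>M I (\<lambda>_. gauss)) (compose I uminus) = Pi\<^sub>M I (\<lambda>_. gauss)"
proof -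
  have u: "uminus \<in> gauss \<rightarrow>\<^sub>M gauss" by measurable
  have "distr gauss gauss uminus = distr gauss borel uminus"
    by (rule distr_cong) simp_all
  then show ?thesis
    using distr_PiM_finite_prob_space'[OF assms prob_space_gauss prob_space_gauss u]
    by (simp add: distr_gauss_uminus)
qed

lemma gauss_moments:
  "integrable gauss (\<lambda>x. x ^ k)" "integrable gauss (\<lambda>x. \<bar>x\<bar>)"
  "(\<integral>x. x \<partial>gauss) = 0" "(\<integral>x. x\<^sup>2 \<partial>gauss) = 1 / 2" "(\<integral>x. \<bar>x\<bar> \<partial>gauss) = 1 / sqrt pi"
proof -
  have pos: "0 < 1 / sqrt (2 :: real)" by simp
  have eq: "integral\<^sup>L gauss f = (\<integral>x. normal_density 0 (1 / sqrt 2) x * f x \<partial>lborel)"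
    "integrable gauss f = integrable lborel (\<lambda>x. normal_density 0 (1 / sqrt 2) x * f x)"
    if "f \<in> borel_measurable borel" for f :: "real \<Rightarrow> real"
    unfolding gauss_def using that
    by (subst integral_density integrable_density; auto)+
  show "integrable gauss (\<lambda>x. x ^ k)"
    by (subst eq) (use integrable_normal_moment[OF pos, of 0 k] in auto)
  show "integrable gauss (\<lambda>x. \<bar>x\<bar>)"
    by (subst eq) (use integrable_normal_moment_abs[OF pos, of 0 1] in auto)
  show "(\<integral>x. x \<partial>gauss) = 0"
    by (subst eq) (use integral_normal_moment_nz_1[OF pos, of 0] in auto)
  show "(\<integral>x. x\<^sup>2 \<partial>gauss) = 1 / 2"
    by (subst eq) (use integral_normal_moment_even[OF pos, of 0 1] in \<open>auto simp: power_divide\<close>)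
  show "(\<integral>x. \<bar>x\<bar> \<partial>gauss) = 1 / sqrt pi"
    by (subst eq) (use integral_normal_moment_abs_odd[OF pos, of 0 0] in \<open>auto simp: real_sqrt_divide\<close>)
qed

text \<open>Against the weight \<open>exp (x\<^sup>2 / 2)\<close> the density of variance \<open>1/2\<close> becomes \<open>sqrt 2\<close> times the
  standard normal density.\<close>
lemma nn_integral_gauss_exp_half_square: "(\<integral>\<^sup>+x. ennreal (exp (x\<^sup>2 / 2)) \<partial>gauss) = ennreal (sqrt 2)"
proof -
  have "(\<integral>\<^sup>+x. ennreal (exp (x\<^sup>2 / 2)) \<partial>gauss)
      = (\<integral>\<^sup>+x. ennreal (normal_density 0 (1 / sqrt 2) x) * ennreal (exp (x\<^sup>2 / 2)) \<partial>lborel)"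
    unfolding gauss_def by (subst nn_integral_density) auto
  also have "\<dots> = (\<integral>\<^sup>+x. ennreal (sqrt 2) * ennreal (normal_density 0 1 x) \<partial>lborel)"
  proof (rule nn_integral_cong)
    fix x :: real
    have "normal_density 0 (1 / sqrt 2) x * exp (x\<^sup>2 / 2) = exp (- x\<^sup>2 + x\<^sup>2 / 2) / sqrt pi"
      unfolding gauss_density exp_add by simp
    also have "- x\<^sup>2 + x\<^sup>2 / 2 = - x\<^sup>2 / 2" by simp
    also have "exp (- x\<^sup>2 / 2) / sqrt pi = sqrt 2 * normal_density 0 1 x"
      by (simp add: normal_density_def real_sqrt_mult)
    finally show "ennreal (normal_density 0 (1 / sqrt 2) x) * ennreal (exp (x\<^sup>2 / 2)) =
        ennreal (sqrt 2) * ennreal (normal_density 0 1 x)"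
      by (simp add: ennreal_mult[symmetric])
  qed
  also have "\<dots> = ennreal (sqrt 2) * emeasure (density lborel (\<lambda>x. ennreal (normal_density 0 1 x))) UNIV"
    by (subst nn_integral_cmult) (auto simp: emeasure_density)
  also have "emeasure (density lborel (\<lambda>x. ennreal (normal_density 0 1 x))) UNIV = 1"
    using prob_space.emeasure_space_1[OF prob_space_normal_density[of 1 0]] by simp
  finally show ?thesis by simp
qed

lemma PiM_gauss_density:
  assumes I: "finite I"
  shows "density (Pi\<^sub>M I (\<lambda>_. lborel)) (\<lambda>x. ennreal (\<Prod>i\<in>I. exp (- (x i)\<^sup>2) / sqrt pi)) = Pi\<^sub>M I (\<lambda>_. gauss)"
proof -
  interpret G: product_sigma_finite "\<lambda>_. gauss"
    by (intro product_sigma_finite.intro prob_space_imp_sigma_finite prob_space_gauss)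
  interpret L: product_sigma_finite "\<lambda>_. lborel :: real measure" ..
  let ?f = "\<lambda>x :: real. ennreal (exp (- x\<^sup>2) / sqrt pi)"
  have prod: "ennreal (\<Prod>i\<in>I. exp (- (x i)\<^sup>2) / sqrt pi) = (\<Prod>i\<in>I. ?f (x i))" for x
    by (rule prod_ennreal[symmetric]) simp
  show ?thesis
  proof (rule G.PiM_eqI[OF I])
    show "sets (density (Pi\<^sub>M I (\<lambda>_. lborel)) (\<lambda>x. ennreal (\<Prod>i\<in>I. exp (- (x i)\<^sup>2) / sqrt pi)))
        = sets (Pi\<^sub>M I (\<lambda>_. gauss))"
      by (simp cong: sets_PiM_cong)
  next
    fix A :: "'a \<Rightarrow> real set" assume A: "\<And>i. i \<in> I \<Longrightarrow> A i \<in> sets gauss"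
    have m: "Pi\<^sub>E I A \<in> sets (Pi\<^sub>M I (\<lambda>_. lborel))"
      using A I by (intro sets_PiM_I_finite) auto
    have "emeasure (density (Pi\<^sub>M I (\<lambda>_. lborel)) (\<lambda>x. ennreal (\<Prod>i\<in>I. exp (- (x i)\<^sup>2) / sqrt pi))) (Pi\<^sub>E I A)
      = (\<integral>\<^sup>+x. ennreal (\<Prod>i\<in>I. exp (- (x i)\<^sup>2) / sqrt pi) * indicator (Pi\<^sub>E I A) x \<partial>Pi\<^sub>M I (\<lambda>_. lborel))"
      by (rule emeasure_density[OF _ m]) measurable
    also have "\<dots> = (\<integral>\<^sup>+x. (\<Prod>i\<in>I. ?f (x i) * indicator (A i) (x i)) \<partial>Pi\<^sub>M I (\<lambda>_. lborel))"
    proof (rule nn_integral_cong)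
      fix x :: "'a \<Rightarrow> real" assume "x \<in> space (Pi\<^sub>M I (\<lambda>_. lborel))"
      then have "indicator (Pi\<^sub>E I A) x = (\<Prod>i\<in>I. indicator (A i) (x i) :: ennreal)"
        using I by (auto simp: space_PiM PiE_def Pi_def indicator_def prod_zero_iff)
      then show "ennreal (\<Prod>i\<in>I. exp (- (x i)\<^sup>2) / sqrt pi) * indicator (Pi\<^sub>E I A) x
          = (\<Prod>i\<in>I. ?f (x i) * indicator (A i) (x i))"
        unfolding prod by (simp add: prod.distrib)
    qed
    also have "\<dots> = (\<Prod>i\<in>I. \<integral>\<^sup>+x. ?f x * indicator (A i) x \<partial>lborel)"
      using A by (intro L.product_nn_integral_prod[OF I]) auto
    also have "\<dots> = (\<Prod>i\<in>I. emeasure gauss (A i))"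
      using A unfolding gauss_def gauss_density
      by (intro prod.cong refl) (subst emeasure_density, auto)
    finally show "emeasure (density (Pi\<^sub>M I (\<lambda>_. lborel)) (\<lambda>x. ennreal (\<Prod>i\<in>I. exp (- (x i)\<^sup>2) / sqrt pi))) (Pi\<^sub>E I A)
      = (\<Prod>i\<in>I. emeasure gauss (A i))" .
  qed
qed

text \<open>The Gaussian measure on symmetric matrices, read in the coordinates with respect to
  \<open>sym_basis\<close>, where it is a product measure.\<close>
definition goe :: "nat \<Rightarrow> (nat \<times> nat \<Rightarrow> real) measure" where
  "goe n = Pi\<^sub>M (sym_index n) (\<lambda>_. gauss)"

lemma sets_goe: "sets (goe n) = sets (Pi\<^sub>M (sym_index n) (\<lambda>_. lborel))"
  unfolding goe_def by (simp cong: sets_PiM_cong)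

lemma prob_space_goe: "prob_space (goe n)"
  unfolding goe_def by (rule prob_space_PiM_gauss)

lemma nn_integral_sym_gauss:
  assumes F: "(\<lambda>x. F (sym_of_coords n x)) \<in> borel_measurable (goe n)"
  shows "(\<integral>\<^sup>+A. F A \<partial>sym_gauss n) = (\<integral>\<^sup>+x. F (sym_of_coords n x) \<partial>goe n)"
proof -
  let ?P = "\<Pi>\<^sub>M p\<in>sym_index n. (lborel :: real measure)"
  let ?V = "vimage_algebra (sym_mats n) (sym_coords n) ?P"
  let ?k = "pi powr (- (real n * (real n + 1) / 4))"
  let ?w = "\<lambda>A. ennreal (?k * exp (- (sym_norm n A)\<^sup>2))"
  have FP: "(\<lambda>x. F (sym_of_coords n x)) \<in> borel_measurable ?P"
    using F sets_goe measurable_cong_sets by blast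
  have transport: "H \<in> borel_measurable ?V" if "(\<lambda>x. H (sym_of_coords n x)) \<in> borel_measurable ?P"
    for H :: "real mat \<Rightarrow> ennreal"
  proof -
    have "(\<lambda>A. H (sym_of_coords n (sym_coords n A))) \<in> borel_measurable ?V"
      by (rule measurable_compose[OF sym_coords_measurable that])
    then show ?thesis
      by (rule measurable_cong[THEN iffD1, rotated]) (simp add: sym_basis_expansion)
  qed
  have wx: "?w (sym_of_coords n x) = ennreal (\<Prod>p\<in>sym_index n. exp (- (x p)\<^sup>2) / sqrt pi)" for x
  proof -
    have "(sym_norm n (sym_of_coords n x))\<^sup>2 = (\<Sum>p\<in>sym_index n. (x p)\<^sup>2)"
      unfolding sym_norm_coords sym_coords_of_coords by simp
    moreover have "?k = (1 / sqrt pi) ^ card (sym_index n)"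
    proof -
      have "real (card (sym_index n)) = real n * (real n + 1) / 2"
        unfolding card_sym_index by (subst real_of_nat_div) (auto simp: algebra_simps)
      then have "- (real n * (real n + 1) / 4) = (- (1 / 2)) * real (card (sym_index n))"
        by simp
      then have "?k = pi powr ((- (1 / 2)) * real (card (sym_index n)))"
        by (rule arg_cong)
      also have "\<dots> = (pi powr (- (1 / 2))) powr real (card (sym_index n))"
        by (rule powr_powr[symmetric])
      also have "pi powr (- (1 / 2)) = 1 / sqrt pi"
        unfolding powr_minus_divide by (simp add: powr_half_sqrt)
      also have "(1 / sqrt pi) powr real (card (sym_index n)) = (1 / sqrt pi) ^ card (sym_index n)"
        by (rule powr_realpow) simp
      finally show ?thesis .
    qed
    moreover have "(\<Prod>p\<in>sym_index n. exp (- (x p)\<^sup>2) / sqrt pi)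
        = (1 / sqrt pi) ^ card (sym_index n) * exp (- (\<Sum>p\<in>sym_index n. (x p)\<^sup>2))"
    proof -
      have "exp (- (\<Sum>p\<in>sym_index n. (x p)\<^sup>2)) = (\<Prod>p\<in>sym_index n. exp (- (x p)\<^sup>2))"
        unfolding sum_negf[symmetric] by (rule exp_sum) simp
      then show ?thesis by (simp add: prod_dividef power_divide)
    qed
    ultimately show ?thesis by simp
  qed
  have mw: "?w \<in> borel_measurable ?V"
    by (rule transport) (unfold wx, measurable)
  have FV: "F \<in> borel_measurable ?V" by (rule transport[OF FP])
  have L: "f \<in> borel_measurable (sym_lebesgue n)" if "f \<in> borel_measurable ?V" for f :: "real mat \<Rightarrow> ennreal"
    using that unfolding sym_lebesgue_def by simp
  have "(\<integral>\<^sup>+A. F A \<partial>sym_gauss n) = (\<integral>\<^sup>+A. ?w A * F A \<partial>sym_lebesgue n)"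
    unfolding sym_gauss_def by (rule nn_integral_density[OF L[OF mw] L[OF FV]])
  also have "\<dots> = (\<integral>\<^sup>+x. ?w (sym_of_coords n x) * F (sym_of_coords n x) \<partial>?P)"
  proof -
    have "(\<lambda>A. ?w A * F A) \<in> borel_measurable (sym_lebesgue n)"
      using L[OF mw] L[OF FV] by (rule borel_measurable_times_ennreal)
    then show ?thesis
      unfolding sym_lebesgue_def
      using nn_integral_distr[OF sym_of_coords_measurable, of "\<lambda>A. ?w A * F A"] by blast
  qed
  also have "\<dots> = (\<integral>\<^sup>+x. ennreal (\<Prod>p\<in>sym_index n. exp (- (x p)\<^sup>2) / sqrt pi) * F (sym_of_coords n x) \<partial>?P)"
    unfolding wx ..
  also have "\<dots> = (\<integral>\<^sup>+x. F (sym_of_coords n x) \<partial>goe n)"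
  proof -
    have "(\<lambda>x. ennreal (\<Prod>p\<in>sym_index n. exp (- (x p)\<^sup>2) / sqrt pi)) \<in> borel_measurable ?P"
      by measurable
    from nn_integral_density[OF this FP] show ?thesis
      unfolding goe_def PiM_gauss_density[OF finite_sym_index] by (rule sym)
  qed
  finally show ?thesis .
qed

text \<open>Sets that are open in finitely many real coordinates are measurable for the product
  \<open>\<sigma>\<close>-algebra. The coordinates are embedded into the space of all functions on the countable index
  type, whose Borel sets are those of the product \<open>\<sigma>\<close>-algebra; this covers arbitrary unions of boxes.\<close>
lemma open_measurable_PiM:
  fixes U :: "('a :: countable \<Rightarrow> real) set"
  assumes I: "finite I" and U: "U \<subseteq> space (Pi\<^sub>M I (\<lambda>_. gauss))"
    and op: "\<And>x. x \<in> U \<Longrightarrow> \<exists>e>0. \<forall>y\<in>space (Pi\<^sub>M I (\<lambda>_. gauss)). (\<forall>i\<in>I. \<bar>x i - y i\<bar> < e) \<longrightarrow> y \<in> U"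
  shows "U \<in> sets (Pi\<^sub>M I (\<lambda>_. gauss))"
proof -
  let ?P = "Pi\<^sub>M I (\<lambda>_. gauss)"
  define V where "V = {y :: 'a \<Rightarrow> real. restrict y I \<in> U}"
  have "open V"
  proof (subst open_subopen, intro ballI)
    fix x assume "x \<in> V"
    then obtain e where e: "e > 0" "\<And>y. y \<in> space ?P \<Longrightarrow> (\<forall>i\<in>I. \<bar>restrict x I i - y i\<bar> < e) \<Longrightarrow> y \<in> U"
      using op unfolding V_def by blast
    let ?T = "\<Inter>i\<in>I. {y :: 'a \<Rightarrow> real. \<bar>x i - y i\<bar> < e}"
    have "open ?T"
      using I by (intro open_INT ballI open_Collect_less continuous_intros) auto
    moreover have "x \<in> ?T" using e(1) by auto
    moreover have "?T \<subseteq> V" unfolding V_def by (auto intro!: e(2) simp: space_PiM)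
    ultimately show "\<exists>T. open T \<and> x \<in> T \<and> T \<subseteq> V" by blast
  qed
  then have V: "V \<in> sets (Pi\<^sub>M UNIV (\<lambda>_. borel))"
    unfolding sets_PiM_equal_borel by simp
  define h where "h x = (\<lambda>i. if i \<in> I then x i else 0 :: real)" for x :: "'a \<Rightarrow> real"
  have "(\<lambda>x. if i \<in> I then x i else 0) \<in> borel_measurable ?P" for i
    by (cases "i \<in> I") (auto intro: PiM_gauss_component)
  then have "h \<in> ?P \<rightarrow>\<^sub>M Pi\<^sub>M UNIV (\<lambda>_. borel)"
    unfolding h_def by (intro measurable_PiM_single') auto
  then have "h -` V \<inter> space ?P \<in> sets ?P" using V by (rule measurable_sets)
  also have "h -` V \<inter> space ?P = U"
  proof -
    have "restrict (h x) I = x" if "x \<in> space ?P" for x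
      using that by (auto simp: h_def space_PiM PiE_def extensional_def restrict_def)
    then show ?thesis using U by (auto simp: V_def)
  qed
  finally show ?thesis .
qed

lemma sum_square_sym_index:
  fixes f :: "nat \<Rightarrow> nat \<Rightarrow> real"
  shows "(\<Sum>i<n. \<Sum>j<n. f i j) = (\<Sum>(i, j)\<in>sym_index n. if i = j then f i i else f i j + f j i)"
proof -
  let ?S = "{(i, j). i < j \<and> j < n}" and ?D = "(\<lambda>i. (i, i)) ` {..<n}"
  have fin: "finite ?S" by (rule finite_subset[of _ "{..<n} \<times> {..<n}"]) auto
  have "(\<Sum>i<n. \<Sum>j<n. f i j) = (\<Sum>(i, j)\<in>{..<n} \<times> {..<n}. f i j)"
    by (simp add: sum.cartesian_product)
  also have "{..<n} \<times> {..<n} = ?D \<union> (?S \<union> prod.swap ` ?S)"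
    by (auto simp: image_iff)
  also have "(\<Sum>(i, j)\<in>\<dots>. f i j) = (\<Sum>(i, j)\<in>?D. f i j) + ((\<Sum>(i, j)\<in>?S. f i j) + (\<Sum>(i, j)\<in>prod.swap ` ?S. f i j))"
  proof -
    have "?S \<inter> prod.swap ` ?S = {}" "?D \<inter> (?S \<union> prod.swap ` ?S) = {}" by auto
    then show ?thesis using fin by (simp add: sum.union_disjoint)
  qed
  also have "(\<Sum>(i, j)\<in>prod.swap ` ?S. f i j) = (\<Sum>(i, j)\<in>?S. f j i)"
    by (subst sum.reindex) (auto simp: split_beta' inj_on_def)
  also have "(\<Sum>(i, j)\<in>?S. f i j) + (\<Sum>(i, j)\<in>?S. f j i) = (\<Sum>(i, j)\<in>?S. if i = j then f i i else f i j + f j i)"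
    unfolding split_beta' by (subst sum.distrib[symmetric]) (auto intro!: sum.cong)
  also have "(\<Sum>(i, j)\<in>?D. f i j) = (\<Sum>(i, j)\<in>?D. if i = j then f i i else f i j + f j i)"
    by (auto intro!: sum.cong)
  also have "(\<Sum>(i, j)\<in>?D. if i = j then f i i else f i j + f j i) + (\<Sum>(i, j)\<in>?S. if i = j then f i i else f i j + f j i)
     = (\<Sum>(i, j)\<in>?D \<union> ?S. if i = j then f i i else f i j + f j i)"
    using fin by (subst sum.union_disjoint) auto
  also have "?D \<union> ?S = sym_index n" by (auto simp: sym_index_def)
  finally show ?thesis .
qed

lemma fro_sq_sym_of_coords_diff:
  "fro_sq n (sym_of_coords n x - sym_of_coords n y) = 2 * (\<Sum>p\<in>sym_index n. (x p - y p)\<^sup>2)"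
proof -
  have car: "sym_of_coords n z \<in> carrier_mat n n" for z by (simp add: sym_of_coords_def)
  have e: "(sym_of_coords n x - sym_of_coords n y) $$ (i, j) = sym_of_coords n x $$ (i, j) - sym_of_coords n y $$ (i, j)"
    if "i < n" "j < n" for i j using that car by (metis carrier_matD index_minus_mat(1))
  have sq: "(sqrt 2 * a - sqrt 2 * b)\<^sup>2 = 2 * (a - b)\<^sup>2" for a b :: real
    unfolding right_diff_distrib[symmetric] power_mult_distrib by simp
  show ?thesis
    unfolding fro_sq_def sum_square_sym_index sum_distrib_left
    by (intro sum.cong refl) (auto simp: sym_index_def e sym_of_coords_entry sq)
qed

lemma fro_sq_sym_of_coords: "fro_sq n (sym_of_coords n x) = 2 * (\<Sum>p\<in>sym_index n. (x p)\<^sup>2)"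
  unfolding fro_sq_def sum_square_sym_index sum_distrib_left
  by (intro sum.cong refl) (auto simp: sym_index_def sym_of_coords_entry power_mult_distrib)

lemma permutes_less:
  assumes "p permutes {0..<n}" "i < n"
  shows "p i < (n :: nat)"
  using assms permutes_in_image[of p "{0..<n}" i] by auto

lemma det_sym_of_coords_measurable [measurable]:
  "(\<lambda>x. Determinant.det (sym_of_coords n x)) \<in> borel_measurable (goe n)"
proof -
  have c: "(\<lambda>x. x p) \<in> borel_measurable (goe n)" if "p \<in> sym_index n" for p
    unfolding goe_def using that by (rule PiM_gauss_component)
  have "(\<lambda>x. sym_of_coords n x $$ (i, j)) \<in> borel_measurable (goe n)" if "i < n" "j < n" for i j
    unfolding sym_of_coords_def using that
    by (simp, intro borel_measurable_sum borel_measurable_times c) auto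
  then have "(\<lambda>x. \<Sum>p | p permutes {0..<n}. signof p * (\<Prod>i = 0..<n. sym_of_coords n x $$ (i, p i))) \<in> borel_measurable (goe n)"
    by (intro borel_measurable_sum borel_measurable_times borel_measurable_prod)
       (auto simp: permutes_less)
  moreover have "sym_of_coords n x \<in> carrier_mat n n" for x by (simp add: sym_of_coords_def)
  ultimately show ?thesis by (subst det_def')
qed

section \<open>A lower bound for the mean absolute determinant\<close>

text \<open>An involution is a product of disjoint transpositions, one for each pair of points that it
  exchanges; the induction removes one pair at a time.\<close>
lemma sign_involution:
  assumes "finite S" "\<sigma> permutes S" "\<And>i. \<sigma> (\<sigma> i) = i"
  shows "sign \<sigma> = (- 1) ^ (card {i \<in> S. \<sigma> i \<noteq> i} div 2) \<and> even (card {i \<in> S. \<sigma> i \<noteq> i})"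
  using assms
proof (induction "card {i \<in> S. \<sigma> i \<noteq> i}" arbitrary: \<sigma> rule: less_induct)
  case less
  show ?case
  proof (cases "\<exists>i\<in>S. \<sigma> i \<noteq> i")
    case False
    then have "\<sigma> = id" using less.prems(2) by (auto simp: permutes_def fun_eq_iff)
    then show ?thesis by simp
  next
    case True
    then obtain i where i: "i \<in> S" "\<sigma> i \<noteq> i" by blast
    define j where "j = \<sigma> i"
    have j: "j \<in> S" "\<sigma> j = i" "j \<noteq> i"
      using i less.prems(2,3) by (auto simp: j_def permutes_in_image)
    define \<tau> where "\<tau> = Transposition.transpose i j \<circ> \<sigma>"
    have \<tau>p: "\<tau> permutes S"
      unfolding \<tau>_def by (intro permutes_compose less.prems permutes_swap_id i j)
    have inj: "\<sigma> x = \<sigma> y \<longleftrightarrow> x = y" for x y using less.prems(3) by metis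
    have \<tau>x: "\<tau> x = (if x = i then i else if x = j then j else \<sigma> x)" for x
      using j inj[of x i] inj[of x j] by (auto simp: \<tau>_def transpose_def j_def)
    have \<tau>\<tau>: "\<tau> (\<tau> x) = x" for x
      using inj[of x i] inj[of x j] j less.prems(3)[of x] by (auto simp: \<tau>x j_def)
    have moved: "{x \<in> S. \<sigma> x \<noteq> x} = insert i (insert j {x \<in> S. \<tau> x \<noteq> x})"
      using i j by (auto simp: \<tau>x)
    have card: "card {x \<in> S. \<sigma> x \<noteq> x} = Suc (Suc (card {x \<in> S. \<tau> x \<noteq> x}))"
      unfolding moved using less.prems(1) j by (auto simp: \<tau>x)
    have IH: "sign \<tau> = (- 1) ^ (card {i \<in> S. \<tau> i \<noteq> i} div 2) \<and> even (card {i \<in> S. \<tau> i \<noteq> i})"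
      by (rule less.hyps[OF _ less.prems(1) \<tau>p \<tau>\<tau>]) (simp add: card)
    have "\<sigma> = Transposition.transpose i j \<circ> \<tau>" by (simp add: \<tau>_def o_assoc)
    then have "sign \<sigma> = sign (Transposition.transpose i j) * sign \<tau>"
      using sign_compose[OF permutation_swap_id permutes_imp_permutation[OF less.prems(1) \<tau>p]] by simp
    then have "sign \<sigma> = - sign \<tau>" using j by (simp add: sign_swap_id)
    then show ?thesis using IH by (simp add: card)
  qed
qed

text \<open>The involution that fixes the first \<open>r\<close> points and matches the next \<open>m\<close> points with the \<open>m\<close>
  points after them according to \<open>\<pi>\<close>. These are \<open>m!\<close> different involutions without further fixed
  points, enough for the lower bound on the mean determinant.\<close>
definition block_involution :: "nat \<Rightarrow> nat \<Rightarrow> (nat \<Rightarrow> nat) \<Rightarrow> nat \<Rightarrow> nat" where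
  "block_involution r m \<pi> i = (if i < r then i else if i < r + m then r + m + \<pi> (i - r)
     else if i < r + m + m then r + inv_into UNIV \<pi> (i - r - m) else i)"

lemma block_involution:
  assumes \<pi>: "\<pi> permutes {0..<m}"
  shows "block_involution r m \<pi> (block_involution r m \<pi> i) = i"
    and "block_involution r m \<pi> permutes {0..<r + 2 * m}"
    and "i < r + 2 * m \<Longrightarrow> block_involution r m \<pi> i = i \<longleftrightarrow> i < r"
proof -
  have lt: "\<pi> k < m" "inv_into UNIV \<pi> k < m" if "k < m" for k
    using that permutes_less[OF \<pi>] permutes_less[OF permutes_inv[OF \<pi>]] by auto
  have inv: "inv_into UNIV \<pi> (\<pi> k) = k" "\<pi> (inv_into UNIV \<pi> k) = k" for k
    using permutes_inverses[OF \<pi>] by auto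
  have 1: "block_involution r m \<pi> (block_involution r m \<pi> i) = i" for i
  proof -
    consider "i < r" | "r \<le> i" "i < r + m" | "r + m \<le> i" "i < r + m + m" | "r + m + m \<le> i" by linarith
    then show ?thesis
    proof cases
      case 2
      then have "block_involution r m \<pi> i = r + m + \<pi> (i - r)" "\<pi> (i - r) < m"
        using lt(1)[of "i - r"] by (auto simp: block_involution_def)
      then show ?thesis using 2 inv(1)[of "i - r"] by (simp add: block_involution_def)
    next
      case 3
      then have "block_involution r m \<pi> i = r + inv_into UNIV \<pi> (i - r - m)" "inv_into UNIV \<pi> (i - r - m) < m"
        using lt(2)[of "i - r - m"] by (auto simp: block_involution_def)
      then show ?thesis using 3 inv(2)[of "i - r - m"] by (simp add: block_involution_def)
    qed (auto simp: block_involution_def)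
  qed
  show "block_involution r m \<pi> (block_involution r m \<pi> i) = i" by (rule 1)
  show "block_involution r m \<pi> permutes {0..<r + 2 * m}"
    unfolding permutes_def
  proof (intro conjI allI impI)
    show "block_involution r m \<pi> x = x" if "x \<notin> {0..<r + 2 * m}" for x
      using that by (auto simp: block_involution_def)
    show "\<exists>!x. block_involution r m \<pi> x = y" for y by (metis 1)
  qed
  show "block_involution r m \<pi> i = i \<longleftrightarrow> i < r" if i: "i < r + 2 * m"
  proof (cases "r + m \<le> i")
    case True
    then have "inv_into UNIV \<pi> (i - r - m) < m" using i by (intro lt(2)) simp
    then show ?thesis using True i by (simp add: block_involution_def)
  qed (simp add: block_involution_def)
qed

lemma inj_on_block_involution: "inj_on (block_involution r m) {\<pi>. \<pi> permutes {0..<m}}"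
proof (rule inj_onI, clarsimp)
  fix \<pi> \<rho> assume p: "\<pi> permutes {0..<m}" "\<rho> permutes {0..<m}"
    and eq: "block_involution r m \<pi> = block_involution r m \<rho>"
  show "\<pi> = \<rho>"
  proof
    fix k show "\<pi> k = \<rho> k"
    proof (cases "k < m")
      case True
      then show ?thesis using fun_cong[OF eq, of "r + k"] by (simp add: block_involution_def)
    next
      case False
      then show ?thesis using p by (simp add: permutes_def)
    qed
  qed
qed

lemma integral_gauss_odd:
  fixes f :: "real \<Rightarrow> real"
  assumes [measurable]: "f \<in> borel_measurable borel" and odd: "\<And>x. f (- x) = - f x"
  shows "(\<integral>x. f x \<partial>gauss) = 0"
proof -
  have "(\<integral>x. f x \<partial>gauss) = (\<integral>x. f x \<partial>distr gauss borel uminus)" by (simp add: distr_gauss_uminus)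
  also have "\<dots> = (\<integral>x. f (- x) \<partial>gauss)" by (rule integral_distr) measurable
  also have "\<dots> = - (\<integral>x. f x \<partial>gauss)" by (simp add: odd)
  finally show ?thesis by simp
qed

text \<open>The index in \<open>sym_index\<close> of the coordinate that determines the entry \<open>(i, j)\<close>.\<close>
definition entry_index :: "nat \<Rightarrow> nat \<Rightarrow> nat \<times> nat" where
  "entry_index i j = (min i j, max i j)"

text \<open>The exponent of the coordinate \<open>p\<close> in the monomial that \<open>\<sigma>\<close> contributes to the Leibniz formula.\<close>
definition entry_mult :: "nat \<Rightarrow> (nat \<Rightarrow> nat) \<Rightarrow> nat \<times> nat \<Rightarrow> nat" where
  "entry_mult n \<sigma> p = card {i \<in> {..<n}. entry_index i (\<sigma> i) = p}"

definition entry_scale :: "nat \<times> nat \<Rightarrow> real" where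
  "entry_scale p = (if fst p = snd p then sqrt 2 else 1)"

lemma entry_index_in_sym_index: "i < n \<Longrightarrow> j < n \<Longrightarrow> entry_index i j \<in> sym_index n"
  by (auto simp: entry_index_def sym_index_def)

lemma sym_of_coords_entry_index:
  assumes "i < n" "j < n"
  shows "sym_of_coords n x $$ (i, j) = entry_scale (entry_index i j) * x (entry_index i j)"
  using assms sym_of_coords_entry[of i j n x] sym_of_coords_entry[of j i n x]
  by (cases "i \<le> j") (auto simp: entry_index_def entry_scale_def min_def max_def)

lemma prod_entries_eq:
  assumes "\<sigma> permutes {0..<n}"
  shows "(\<Prod>i = 0..<n. sym_of_coords n x $$ (i, \<sigma> i)) =
    (\<Prod>p\<in>sym_index n. (entry_scale p * x p) ^ entry_mult n \<sigma> p)"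
proof -
  have "(\<Prod>i = 0..<n. sym_of_coords n x $$ (i, \<sigma> i)) = (\<Prod>i\<in>{..<n}. entry_scale (entry_index i (\<sigma> i)) * x (entry_index i (\<sigma> i)))"
    using permutes_less[OF assms] by (intro prod.cong) (auto simp: sym_of_coords_entry_index)
  also have "\<dots> = (\<Prod>p\<in>sym_index n. \<Prod>i\<in>{i \<in> {..<n}. entry_index i (\<sigma> i) = p}. entry_scale (entry_index i (\<sigma> i)) * x (entry_index i (\<sigma> i)))"
    using permutes_less[OF assms] by (intro prod.group[symmetric]) (simp_all add: image_subset_iff entry_index_in_sym_index)
  also have "\<dots> = (\<Prod>p\<in>sym_index n. (entry_scale p * x p) ^ entry_mult n \<sigma> p)"
    unfolding entry_mult_def by (intro prod.cong refl) simp
  finally show ?thesis .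
qed

lemma sum_entry_mult:
  assumes "\<sigma> permutes {0..<n}"
  shows "(\<Sum>p\<in>sym_index n. entry_mult n \<sigma> p) = n"
proof -
  have "(\<Sum>p\<in>sym_index n. entry_mult n \<sigma> p) = (\<Sum>p\<in>sym_index n. \<Sum>i\<in>{i \<in> {..<n}. entry_index i (\<sigma> i) = p}. 1)"
    unfolding entry_mult_def by simp
  also have "\<dots> = (\<Sum>i\<in>{..<n}. 1)"
    using permutes_less[OF assms] by (intro sum.group) (simp_all add: image_subset_iff entry_index_in_sym_index)
  finally show ?thesis by simp
qed

lemma entry_mult_diag:
  assumes "i < n" shows "entry_mult n \<sigma> (i, i) = (if \<sigma> i = i then 1 else 0)"
proof -
  have "{k \<in> {..<n}. entry_index k (\<sigma> k) = (i, i)} = (if \<sigma> i = i then {i} else {})"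
    using assms by (auto simp: entry_index_def min_def max_def split: if_splits)
  then show ?thesis by (simp add: entry_mult_def)
qed

lemma entry_mult_offdiag:
  assumes "i < n" "j < n" "i \<noteq> j"
  shows "entry_mult n \<sigma> (entry_index i j) = (if \<sigma> i = j then 1 else 0) + (if \<sigma> j = i then 1 else 0)"
proof -
  have "{k \<in> {..<n}. entry_index k (\<sigma> k) = entry_index i j} = (if \<sigma> i = j then {i} else {}) \<union> (if \<sigma> j = i then {j} else {})"
    using assms by (auto simp: entry_index_def min_def max_def split: if_splits)
  then show ?thesis using assms by (auto simp: entry_mult_def)
qed

text \<open>For odd \<open>n\<close> the mean of the determinant vanishes, since \<open>det (- A) = - det A\<close>. Multiplying by the
  sign of the coordinate \<open>(0, 0)\<close> repairs this: exactly those permutations contribute that fix \<open>0\<close> and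
  pair off the remaining points. As the weight is bounded by \<open>1\<close>, the weighted mean is still a lower
  bound for the mean of \<open>\<bar>det A\<bar>\<close>. For even \<open>n\<close> the weight is constantly \<open>1\<close>.\<close>
definition weight :: "nat \<Rightarrow> nat \<times> nat \<Rightarrow> real \<Rightarrow> real" where
  "weight n p t = (if odd n \<and> p = (0, 0) then sgn t else 1)"

definition moment_at :: "nat \<Rightarrow> (nat \<Rightarrow> nat) \<Rightarrow> nat \<times> nat \<Rightarrow> real" where
  "moment_at n \<sigma> p = (\<integral>t. weight n p t * (entry_scale p * t) ^ entry_mult n \<sigma> p \<partial>gauss)"

lemma weight_measurable [measurable]: "weight n p \<in> borel_measurable borel"
  unfolding weight_def by measurable

lemma abs_weight_le: "\<bar>weight n p t\<bar> \<le> 1"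
  by (simp add: weight_def sgn_real_def)

lemma integrable_weighted_power: "integrable gauss (\<lambda>t. weight n p t * (c * t) ^ k)"
proof (rule Bochner_Integration.integrable_bound)
  show "integrable gauss (\<lambda>t. c ^ k * t ^ k)" by (intro integrable_mult_right gauss_moments)
  show "AE t in gauss. norm (weight n p t * (c * t) ^ k) \<le> norm (c ^ k * t ^ k)"
    by (rule AE_I2) (simp add: abs_mult power_mult_distrib mult_left_le_one_le abs_weight_le)
qed measurable

lemma entry_mult_le_2:
  assumes "p \<in> sym_index n" shows "entry_mult n \<sigma> p \<le> 2" "fst p = snd p \<Longrightarrow> entry_mult n \<sigma> p \<le> 1"
proof -
  obtain i j where p: "p = (i, j)" "i \<le> j" "j < n" using assms by (auto simp: sym_index_def)
  then have "i = j \<or> p = entry_index i j \<and> i \<noteq> j" by (auto simp: entry_index_def)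
  then show "entry_mult n \<sigma> p \<le> 2" using p entry_mult_offdiag[of i n j \<sigma>] by (auto simp: entry_mult_diag)
  show "fst p = snd p \<Longrightarrow> entry_mult n \<sigma> p \<le> 1" using p by (auto simp: entry_mult_diag)
qed

lemma moment_at_regular:
  assumes p: "p \<in> sym_index n" and reg: "\<not> (odd n \<and> p = (0, 0))"
  shows "moment_at n \<sigma> p = (if entry_mult n \<sigma> p = 1 then 0 else (1 / 2) ^ (entry_mult n \<sigma> p div 2))"
proof -
  have w: "weight n p t = 1" for t using reg by (auto simp: weight_def)
  consider "entry_mult n \<sigma> p = 0" | "entry_mult n \<sigma> p = 1" | "entry_mult n \<sigma> p = 2" "fst p \<noteq> snd p"
    using entry_mult_le_2[OF p, of \<sigma>] by linarith
  then show ?thesis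
  proof cases
    case 1
    then show ?thesis using prob_space.prob_space[OF prob_space_gauss] by (simp add: moment_at_def w)
  next
    case 2
    then show ?thesis by (simp add: moment_at_def w gauss_moments)
  next
    case 3
    then show ?thesis by (simp add: moment_at_def w gauss_moments entry_scale_def)
  qed
qed

text \<open>The weighted coordinate behaves with parity reversed: it contributes the first absolute
  moment if \<open>0\<close> is a fixed point, and the vanishing mean of the sign otherwise.\<close>
lemma moment_at_special:
  assumes "odd n"
  shows "moment_at n \<sigma> (0, 0) = (if \<sigma> 0 = 0 then sqrt 2 / sqrt pi else 0)"
proof -
  have n: "0 < n" using assms by (rule odd_pos)
  have w: "weight n (0, 0) t = sgn t" for t using assms by (simp add: weight_def)
  have s: "sgn t * (sqrt 2 * t) = sqrt 2 * \<bar>t\<bar>" for t :: real by (simp add: sgn_real_def)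
  have "(\<integral>t. sgn t \<partial>gauss) = (0 :: real)" by (rule integral_gauss_odd) (auto simp: sgn_minus)
  then show ?thesis
    using n by (simp add: moment_at_def w entry_mult_diag entry_scale_def s gauss_moments)
qed

definition term_mean :: "nat \<Rightarrow> (nat \<Rightarrow> nat) \<Rightarrow> real" where
  "term_mean n \<sigma> = (\<Prod>p\<in>sym_index n. moment_at n \<sigma> p)"

lemma moment_at_nonneg: "p \<in> sym_index n \<Longrightarrow> 0 \<le> moment_at n \<sigma> p"
  by (cases "odd n \<and> p = (0, 0)") (auto simp: moment_at_regular moment_at_special)

lemma term_mean_nonneg: "0 \<le> term_mean n \<sigma>"
  unfolding term_mean_def by (intro prod_nonneg moment_at_nonneg)

text \<open>A coordinate that occurs exactly once kills the mean, unless it carries the sign weight, in which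
  case it has to occur. An off-diagonal coordinate occurs twice only if \<open>\<sigma>\<close> exchanges the two
  indices, and a diagonal one never does.\<close>
lemma term_mean_nonzero:
  assumes \<sigma>: "\<sigma> permutes {0..<n}" and nz: "term_mean n \<sigma> \<noteq> 0"
  shows "\<sigma> (\<sigma> i) = i" and "i < n \<Longrightarrow> \<sigma> i = i \<longleftrightarrow> odd n \<and> i = 0"
proof -
  have nz': "moment_at n \<sigma> p \<noteq> 0" if "p \<in> sym_index n" for p
    using nz that unfolding term_mean_def by auto
  have fix_iff: "\<sigma> i = i \<longleftrightarrow> odd n \<and> i = 0" if i: "i < n" for i
  proof (cases "odd n \<and> i = 0")
    case True
    then show ?thesis using nz'[of "(0, 0)"] i
      by (auto simp: moment_at_special sym_index_def split: if_splits)
  next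
    case False
    then show ?thesis using nz'[of "(i, i)"] i
      by (auto simp: moment_at_regular sym_index_def entry_mult_diag split: if_splits)
  qed
  then show "i < n \<Longrightarrow> \<sigma> i = i \<longleftrightarrow> odd n \<and> i = 0" .
  show "\<sigma> (\<sigma> i) = i"
  proof (cases "i < n \<and> \<sigma> i \<noteq> i")
    case True
    let ?p = "entry_index i (\<sigma> i)"
    have p: "?p \<in> sym_index n" "\<sigma> i < n" using True permutes_less[OF \<sigma>] by (auto intro: entry_index_in_sym_index)
    moreover have "?p \<noteq> (0, 0)" using True by (auto simp: entry_index_def min_def max_def split: if_splits)
    ultimately show ?thesis
      using nz'[of ?p] True by (auto simp: moment_at_regular entry_mult_offdiag split: if_splits)
  next
    case False
    then show ?thesis using \<sigma> by (cases "i < n") (auto simp: permutes_def)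
  qed
qed

text \<open>The contributing involutions all have \<open>n div 2\<close> transpositions, hence the same sign. This rules
  out cancellation in the Leibniz sum.\<close>
lemma signed_term_mean_nonneg:
  assumes \<sigma>: "\<sigma> permutes {0..<n}"
  shows "0 \<le> (- 1) ^ (n div 2) * (of_int (sign \<sigma>) * term_mean n \<sigma>)"
proof (cases "term_mean n \<sigma> = 0")
  case False
  note inv = term_mean_nonzero[OF \<sigma> False]
  have moved: "{i \<in> {0..<n}. \<sigma> i \<noteq> i} = {i \<in> {0..<n}. \<not> (odd n \<and> i = 0)}"
    by (intro Collect_cong conj_cong refl) (simp add: inv(2))
  have "card {i \<in> {0..<n}. \<sigma> i \<noteq> i} div 2 = n div 2"
  proof (cases "odd n")
    case True
    have "{i \<in> {0..<n}. \<not> (odd n \<and> i = 0)} = {1..<n}" using True by auto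
    then show ?thesis unfolding moved using odd_two_times_div_two_succ[OF True] by simp
  next
    case False
    then show ?thesis unfolding moved by simp
  qed
  then have "sign \<sigma> = (- 1) ^ (n div 2)"
    using sign_involution[OF _ \<sigma> inv(1)] by simp
  then have "(- 1) ^ (n div 2) * (of_int (sign \<sigma>) * term_mean n \<sigma>) = term_mean n \<sigma>"
    by (simp add: mult.assoc[symmetric] power_mult_distrib[symmetric])
  then show ?thesis by (simp only: term_mean_nonneg)
qed simp

text \<open>Each of the \<open>n div 2\<close> pairs contributes the second moment \<open>1/2\<close>. For odd \<open>n\<close> there is one more
  factor \<open>sqrt (2 / pi)\<close>, the mean of the absolute value of the entry \<open>(0, 0)\<close>, which exceeds \<open>1/2\<close>.\<close>
lemma term_mean_block_involution:
  assumes \<pi>: "\<pi> permutes {0..<n div 2}"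
  defines "\<sigma> \<equiv> block_involution (n mod 2) (n div 2) \<pi>"
  shows "\<sigma> permutes {0..<n}"
    and "(1 / 2) ^ (n div 2 + 1) \<le> (- 1) ^ (n div 2) * (of_int (sign \<sigma>) * term_mean n \<sigma>)"
proof -
  have n: "n mod 2 + 2 * (n div 2) = n" by simp
  note bi = block_involution[OF \<pi>, where r = "n mod 2", folded \<sigma>_def, unfolded n]
  show \<sigma>: "\<sigma> permutes {0..<n}" by (rule bi(2))
  have fix_iff: "\<sigma> i = i \<longleftrightarrow> odd n \<and> i = 0" if "i < n" for i
    using bi(3)[OF that] by (auto simp: odd_iff_mod_2_eq_one)
  define e where "e = entry_mult n \<sigma>"
  have half: "(1 / 2) ^ (e p div 2) \<le> (if p = (0, 0) \<and> odd n then 2 else 1) * moment_at n \<sigma> p"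
    if p: "p \<in> sym_index n" for p
  proof (cases "p = (0, 0) \<and> odd n")
    case True
    have "sqrt pi \<le> sqrt (8 :: real)" using pi_less_4 by (intro real_sqrt_le_mono) linarith
    also have "sqrt (8 :: real) = 2 * sqrt 2" by (rule real_sqrt_unique) (auto simp: power_mult_distrib)
    finally have "1 \<le> 2 * (sqrt 2 / sqrt pi)" by (simp add: field_simps)
    moreover have "0 < n" using True odd_pos by auto
    ultimately show ?thesis
      using True fix_iff[of 0] by (simp add: moment_at_special e_def entry_mult_diag)
  next
    case False
    obtain i j where ij: "p = (i, j)" "i \<le> j" "j < n" using p by (auto simp: sym_index_def)
    have "e p \<noteq> 1"
    proof (cases "i = j")
      case True
      then show ?thesis using ij False fix_iff[of i] by (auto simp: e_def entry_mult_diag)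
    next
      case ne: False
      then have "p = entry_index i j" using ij by (auto simp: entry_index_def)
      then show ?thesis using ij ne entry_mult_offdiag[of i n j \<sigma>] bi(1) by (auto simp: e_def)
    qed
    then show ?thesis using False p by (auto simp: moment_at_regular e_def)
  qed
  have "(1 / 2 :: real) ^ (n div 2) \<le> (1 / 2) ^ (\<Sum>p\<in>sym_index n. e p div 2)"
  proof (rule power_decreasing)
    have "2 * (\<Sum>p\<in>sym_index n. e p div 2) \<le> (\<Sum>p\<in>sym_index n. e p)"
      unfolding sum_distrib_left by (intro sum_mono) simp
    then show "(\<Sum>p\<in>sym_index n. e p div 2) \<le> n div 2"
      using sum_entry_mult[OF \<sigma>] by (simp add: e_def)
  qed auto
  also have "\<dots> = (\<Prod>p\<in>sym_index n. (1 / 2) ^ (e p div 2))" by (simp add: power_sum)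
  also have "\<dots> \<le> (\<Prod>p\<in>sym_index n. (if p = (0, 0) \<and> odd n then 2 else 1) * moment_at n \<sigma> p)"
    by (intro prod_mono conjI half) auto
  also have "\<dots> = (\<Prod>p\<in>sym_index n. if p = (0, 0) \<and> odd n then 2 else 1) * term_mean n \<sigma>"
    by (simp add: prod.distrib term_mean_def)
  also have "\<dots> \<le> 2 * term_mean n \<sigma>"
  proof (rule mult_right_mono[OF _ term_mean_nonneg])
    have "(\<Prod>p\<in>sym_index n. if p = (0, 0) \<and> odd n then 2 else 1 :: real) \<le> (\<Prod>p\<in>sym_index n. if p = (0, 0) then 2 else 1)"
      by (intro prod_mono) auto
    also have "\<dots> \<le> 2" by (subst prod.delta) auto
    finally show "(\<Prod>p\<in>sym_index n. if p = (0, 0) \<and> odd n then 2 else 1 :: real) \<le> 2" .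
  qed
  finally have le: "(1 / 2) ^ (n div 2 + 1) \<le> term_mean n \<sigma>" by simp
  have "\<bar>(- 1) ^ (n div 2) * (of_int (sign \<sigma>) * term_mean n \<sigma>)\<bar> = term_mean n \<sigma>"
    using term_mean_nonneg by (simp add: abs_mult sign_def)
  then show "(1 / 2) ^ (n div 2 + 1) \<le> (- 1) ^ (n div 2) * (of_int (sign \<sigma>) * term_mean n \<sigma>)"
    using le signed_term_mean_nonneg[OF \<sigma>] by linarith
qed

lemma integral_weighted_det:
  defines "w \<equiv> \<lambda>n x. \<Prod>p\<in>sym_index n. weight n p (x p)"
  shows "integrable (goe n) (\<lambda>x. w n x * Determinant.det (sym_of_coords n x))"
    and "(\<integral>x. w n x * Determinant.det (sym_of_coords n x) \<partial>goe n)
      = (\<Sum>\<sigma> | \<sigma> permutes {0..<n}. of_int (sign \<sigma>) * term_mean n \<sigma>)"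
proof -
  interpret G: product_sigma_finite "\<lambda>_ :: nat \<times> nat. gauss"
    by (intro product_sigma_finite.intro prob_space_imp_sigma_finite prob_space_gauss)
  let ?f = "\<lambda>\<sigma> p t. weight n p t * (entry_scale p * t) ^ entry_mult n \<sigma> p"
  have car: "sym_of_coords n x \<in> carrier_mat n n" for x by (simp add: sym_of_coords_def)
  have eq: "w n x * Determinant.det (sym_of_coords n x)
      = (\<Sum>\<sigma> | \<sigma> permutes {0..<n}. of_int (sign \<sigma>) * (\<Prod>p\<in>sym_index n. ?f \<sigma> p (x p)))" for x
    unfolding det_def'[OF car] sum_distrib_left w_def
    by (intro sum.cong refl) (simp add: prod_entries_eq prod.distrib)
  have I: "integrable (goe n) (\<lambda>x. \<Prod>p\<in>sym_index n. ?f \<sigma> p (x p))" for \<sigma>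
    unfolding goe_def by (rule G.product_integrable_prod) (auto intro: integrable_weighted_power)
  have E: "(\<integral>x. (\<Prod>p\<in>sym_index n. ?f \<sigma> p (x p)) \<partial>goe n) = term_mean n \<sigma>" for \<sigma>
    unfolding goe_def term_mean_def moment_at_def
    by (rule G.product_integral_prod) (auto intro: integrable_weighted_power)
  show "integrable (goe n) (\<lambda>x. w n x * Determinant.det (sym_of_coords n x))"
    unfolding eq by (intro Bochner_Integration.integrable_sum integrable_mult_right I)
  show "(\<integral>x. w n x * Determinant.det (sym_of_coords n x) \<partial>goe n)
      = (\<Sum>\<sigma> | \<sigma> permutes {0..<n}. of_int (sign \<sigma>) * term_mean n \<sigma>)"
    unfolding eq by (subst Bochner_Integration.integral_sum) (auto intro: I simp: E)
qed

text \<open>All terms of the Leibniz sum for the weighted mean have the same sign, so the sum is at least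
  the part coming from the block involutions.\<close>
theorem mean_abs_det_ge:
  "ennreal (fact (n div 2) * (1 / 2) ^ (n div 2 + 1)) \<le> (\<integral>\<^sup>+x. ennreal \<bar>Determinant.det (sym_of_coords n x)\<bar> \<partial>goe n)"
proof -
  let ?D = "\<lambda>x. Determinant.det (sym_of_coords n x)" and ?m = "n div 2"
  let ?w = "\<lambda>x. \<Prod>p\<in>sym_index n. weight n p (x p)"
  let ?t = "\<lambda>\<sigma>. (- 1) ^ ?m * (of_int (sign \<sigma>) * term_mean n \<sigma>)"
  let ?B = "block_involution (n mod 2) ?m ` {\<pi>. \<pi> permutes {0..<?m}}"
  have "fact ?m * (1 / 2) ^ (?m + 1) = real (card ?B) * (1 / 2) ^ (?m + 1)"
    using card_permutations[of "{0..<?m}" ?m] by (subst card_image[OF inj_on_block_involution]) auto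
  also have "\<dots> = (\<Sum>\<sigma>\<in>?B. (1 / 2) ^ (?m + 1))" by simp
  also have "\<dots> \<le> (\<Sum>\<sigma>\<in>?B. ?t \<sigma>)"
    by (intro sum_mono) (use term_mean_block_involution(2) in blast)
  also have "\<dots> \<le> (\<Sum>\<sigma> | \<sigma> permutes {0..<n}. ?t \<sigma>)"
    by (intro sum_mono2) (use term_mean_block_involution(1) signed_term_mean_nonneg in \<open>auto simp: finite_permutations\<close>)
  also have "\<dots> = (- 1) ^ ?m * (\<integral>x. ?w x * ?D x \<partial>goe n)"
    unfolding integral_weighted_det(2) sum_distrib_left ..
  also have "\<dots> \<le> \<bar>\<integral>x. ?w x * ?D x \<partial>goe n\<bar>"
    by (cases "even ?m") auto
  also have "\<dots> \<le> (\<integral>x. \<bar>?w x * ?D x\<bar> \<partial>goe n)" by (rule integral_abs_bound)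
  finally have "ennreal (fact ?m * (1 / 2) ^ (?m + 1)) \<le> ennreal (\<integral>x. \<bar>?w x * ?D x\<bar> \<partial>goe n)"
    by (rule ennreal_leI)
  also have "\<dots> = (\<integral>\<^sup>+x. ennreal \<bar>?w x * ?D x\<bar> \<partial>goe n)"
    using integral_weighted_det(1) by (intro nn_integral_eq_integral[symmetric] integrable_abs) auto
  also have "\<dots> \<le> (\<integral>\<^sup>+x. ennreal \<bar>?D x\<bar> \<partial>goe n)"
  proof (intro nn_integral_mono ennreal_leI)
    fix x
    have "\<bar>?w x\<bar> \<le> 1" unfolding abs_prod by (intro prod_le_1) (auto simp: abs_weight_le)
    then show "\<bar>?w x * ?D x\<bar> \<le> \<bar>?D x\<bar>" by (simp add: abs_mult mult_left_le_one_le)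
  qed
  finally show ?thesis .
qed

section \<open>Determinant bounds and small eigenvalues\<close>

text \<open>From \<open>y \<le> exp y\<close> applied to \<open>y = d\<^sup>2 / s\<close> for each eigenvalue \<open>d\<close>. The free parameter \<open>s\<close> makes
  this serve both for bounded and for large norm.\<close>
lemma det_sq_le_fro_sq:
  assumes "A \<in> sym_mats n" and s: "0 < s"
  shows "(Determinant.det A)\<^sup>2 \<le> s ^ n * exp (fro_sq n A / s)"
proof -
  obtain U d where sd: "spectral_decomp n A U d" using spectral_theorem[OF assms(1)] by blast
  have "(Determinant.det A)\<^sup>2 = (\<Prod>i<n. (d i)\<^sup>2)"
    unfolding spectral_det[OF sd] by (simp add: prod_power_distrib)
  also have "\<dots> \<le> (\<Prod>i<n. s * exp ((d i)\<^sup>2 / s))"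
  proof (intro prod_mono conjI)
    fix i
    have "(d i)\<^sup>2 / s \<le> exp ((d i)\<^sup>2 / s)" using exp_ge_add_one_self[of "(d i)\<^sup>2 / s"] by linarith
    then show "(d i)\<^sup>2 \<le> s * exp ((d i)\<^sup>2 / s)" using s by (simp add: pos_divide_le_eq mult.commute)
  qed simp
  also have "\<dots> = s ^ n * exp (fro_sq n A / s)"
    unfolding spectral_fro_sq[OF sd] by (simp add: prod.distrib exp_sum sum_divide_distrib)
  finally show ?thesis .
qed

text \<open>The same estimate with \<open>s = n\<close>, where each eigenvalue that is at most \<open>\<eta> * sqrt n\<close> in absolute
  value gains a factor \<open>\<eta>\<^sup>2\<close>.\<close>
lemma det_sq_le_small_eigenvalues:
  assumes sd: "spectral_decomp n A U d" and \<eta>: "0 < \<eta>" "\<eta> \<le> 1" and n: "0 < n"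
    and k: "k \<le> card {i. i < n \<and> \<bar>d i\<bar> \<le> \<eta> * sqrt n}"
  shows "(Determinant.det A)\<^sup>2 \<le> n ^ n * \<eta> ^ (2 * k) * exp (fro_sq n A / n)"
proof -
  let ?S = "{i. i < n \<and> \<bar>d i\<bar> \<le> \<eta> * sqrt n}"
  define g where "g i = (if i \<in> ?S then \<eta>\<^sup>2 else 1)" for i
  have "(Determinant.det A)\<^sup>2 = (\<Prod>i<n. (d i)\<^sup>2)"
    unfolding spectral_det[OF sd] by (simp add: prod_power_distrib)
  also have "\<dots> \<le> (\<Prod>i<n. g i * (n * exp ((d i)\<^sup>2 / n)))"
  proof (intro prod_mono conjI)
    fix i assume i: "i \<in> {..<n}"
    show "(d i)\<^sup>2 \<le> g i * (n * exp ((d i)\<^sup>2 / n))"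
    proof (cases "i \<in> ?S")
      case True
      then have "\<bar>d i\<bar>\<^sup>2 \<le> (\<eta> * sqrt n)\<^sup>2" by (intro power_mono) auto
      then have "(d i)\<^sup>2 \<le> \<eta>\<^sup>2 * n" by (simp add: power_mult_distrib)
      also have "\<dots> \<le> \<eta>\<^sup>2 * (n * exp ((d i)\<^sup>2 / n))"
        by (intro mult_left_mono) (auto simp: mult_le_cancel_left1)
      finally show ?thesis using True by (simp add: g_def)
    next
      case False
      have "(d i)\<^sup>2 / n \<le> exp ((d i)\<^sup>2 / n)" using exp_ge_add_one_self[of "(d i)\<^sup>2 / n"] by linarith
      then have "(d i)\<^sup>2 \<le> n * exp ((d i)\<^sup>2 / n)" using n by (simp add: pos_divide_le_eq mult.commute)
      then show ?thesis using False by (auto simp: g_def)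
    qed
  qed simp
  also have "\<dots> = (\<Prod>i<n. g i) * (n ^ n * exp (fro_sq n A / n))"
    unfolding spectral_fro_sq[OF sd] by (simp add: prod.distrib exp_sum sum_divide_distrib)
  also have "(\<Prod>i<n. g i) = (\<eta>\<^sup>2) ^ card ?S"
  proof -
    have "(\<Prod>i<n. g i) = (\<Prod>i\<in>?S. \<eta>\<^sup>2)"
      unfolding g_def by (subst prod.inter_filter[symmetric]) (auto intro!: prod.cong)
    then show ?thesis by simp
  qed
  also have "(\<eta>\<^sup>2) ^ card ?S \<le> (\<eta>\<^sup>2) ^ k"
    using \<eta> k by (intro power_decreasing) (auto simp: power_le_one)
  finally show ?thesis by (simp add: power_mult[symmetric] power_even_eq mult_ac mult_right_mono)
qed

lemma spectral_uminus:
  assumes "spectral_decomp n A U d"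
  shows "spectral_decomp n (- A) U (\<lambda>i. - d i)"
proof -
  have U: "U \<in> carrier_mat n n" "A = U * mat_diag n d * transpose_mat U"
    using assms by (auto simp: spectral_decomp_def)
  have m: "mat_diag n (\<lambda>i. - d i) = - mat_diag n d"
    by (rule eq_matI) (auto simp: mat_diag_def)
  have c: "U * mat_diag n d \<in> carrier_mat n n" using U(1) by (simp add: mult_carrier_mat[of _ n n _ n])
  have "U * mat_diag n (\<lambda>i. - d i) * transpose_mat U = - A"
    unfolding m U(2)
    using carrier_matD[OF U(1)] carrier_matD[OF mat_diag_dim[of n d]] carrier_matD[OF c] by simp
  then show ?thesis using assms by (simp add: spectral_decomp_def)
qed

definition radius_sq :: "nat \<Rightarrow> (nat \<times> nat \<Rightarrow> real) \<Rightarrow> real" where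
  "radius_sq n x = (\<Sum>p\<in>sym_index n. (x p)\<^sup>2)"

lemma radius_sq_measurable [measurable]: "radius_sq n \<in> borel_measurable (goe n)"
  unfolding radius_sq_def goe_def by (intro borel_measurable_sum borel_measurable_power PiM_gauss_component)

lemma abs_det_le:
  assumes "0 < s"
  shows "\<bar>Determinant.det (sym_of_coords n x)\<bar> \<le> 1 + s ^ n * exp (2 * radius_sq n x / s)"
proof -
  let ?D = "Determinant.det (sym_of_coords n x)"
  have "0 \<le> (\<bar>?D\<bar> - 1)\<^sup>2" by simp
  then have "\<bar>?D\<bar> \<le> 1 + ?D\<^sup>2" by (simp add: power2_diff)
  also have "?D\<^sup>2 \<le> s ^ n * exp (2 * radius_sq n x / s)"
    using det_sq_le_fro_sq[OF sym_of_coords_in assms]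
    unfolding fro_sq_sym_of_coords radius_sq_def .
  finally show ?thesis by simp
qed

text \<open>A bound for \<open>\<bar>det A\<bar>\<close> on \<open>\<parallel>A\<parallel>\<^sup>2 \<le> 4 n\<^sup>2\<close>; only its growth \<open>exp (O (n * ln n))\<close> matters.\<close>
definition bulk_bound :: "nat \<Rightarrow> real" where
  "bulk_bound n = 2 * (8 * real n) ^ n * exp (real n)"

lemma abs_det_le_bulk:
  assumes n: "0 < n" and r: "radius_sq n x \<le> 4 * (real n)\<^sup>2"
  shows "\<bar>Determinant.det (sym_of_coords n x)\<bar> \<le> bulk_bound n"
proof -
  have "\<bar>Determinant.det (sym_of_coords n x)\<bar> \<le> 1 + (8 * real n) ^ n * exp (2 * radius_sq n x / (8 * real n))"
    by (rule abs_det_le) (use n in simp)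
  also have "\<dots> \<le> 1 + (8 * real n) ^ n * exp (real n)"
  proof -
    have "2 * radius_sq n x / (8 * real n) \<le> real n"
      using n r by (simp add: pos_divide_le_eq power2_eq_square)
    then show ?thesis by (simp add: mult_left_mono)
  qed
  also have "1 \<le> (8 * real n) ^ n * exp (real n)"
  proof -
    have "1 \<le> (8 * real n) ^ n" using n by (intro one_le_power) simp
    moreover have "1 \<le> exp (real n)" by simp
    ultimately show ?thesis using mult_mono[of 1 "(8 * real n) ^ n" 1 "exp (real n)"] by simp
  qed
  finally show ?thesis by (simp add: bulk_bound_def mult_ac power_mult_distrib)
qed

text \<open>The coordinates are independent, and each contributes \<open>sqrt 2 \<le> exp (1 / 2)\<close>; there are at
  most \<open>n\<^sup>2\<close> of them.\<close>
lemma nn_integral_exp_radius: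
  "(\<integral>\<^sup>+x. ennreal (exp (radius_sq n x / 2)) \<partial>goe n) \<le> ennreal (exp ((real n)\<^sup>2 / 2))"
proof -
  interpret G: product_sigma_finite "\<lambda>_ :: nat \<times> nat. gauss"
    by (intro product_sigma_finite.intro prob_space_imp_sigma_finite prob_space_gauss)
  have "(\<integral>\<^sup>+x. ennreal (exp (radius_sq n x / 2)) \<partial>goe n)
    = (\<integral>\<^sup>+x. (\<Prod>p\<in>sym_index n. ennreal (exp ((x p)\<^sup>2 / 2))) \<partial>goe n)"
    by (simp add: radius_sq_def prod_ennreal exp_sum[symmetric] sum_divide_distrib)
  also have "\<dots> = (\<Prod>p\<in>sym_index n. \<integral>\<^sup>+t. ennreal (exp (t\<^sup>2 / 2)) \<partial>gauss)"
    unfolding goe_def by (rule G.product_nn_integral_prod) auto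
  also have "\<dots> = ennreal (sqrt 2 ^ card (sym_index n))"
    by (simp add: nn_integral_gauss_exp_half_square ennreal_power)
  also have "\<dots> \<le> ennreal (exp ((real n)\<^sup>2 / 2))"
  proof (rule ennreal_leI)
    have "(2 :: real) \<le> exp 1" using exp_ge_add_one_self[of 1] by simp
    then have "sqrt 2 \<le> sqrt (exp 1)" by simp
    also have "sqrt (exp 1) = exp (1 / 2 :: real)"
      by (rule real_sqrt_unique) (simp_all add: exp_double[symmetric])
    finally have "sqrt 2 ^ card (sym_index n) \<le> exp (1 / 2) ^ card (sym_index n)"
      by (rule power_mono) simp
    also have "\<dots> \<le> exp (1 / 2) ^ (n\<^sup>2)"
    proof (rule power_increasing)
      have "n * (n + 1) div 2 \<le> 2 * (n * n) div 2" by (rule div_le_mono) (simp add: algebra_simps)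
      then show "card (sym_index n) \<le> n\<^sup>2" by (simp add: card_sym_index power2_eq_square)
    qed simp
    also have "\<dots> = exp ((real n)\<^sup>2 / 2)" by (simp add: exp_of_nat_mult[symmetric])
    finally show "sqrt 2 ^ card (sym_index n) \<le> exp ((real n)\<^sup>2 / 2)" .
  qed
  finally show ?thesis .
qed

definition tail_bound :: "nat \<Rightarrow> real" where
  "tail_bound n = 2 * 8 ^ n * exp (- (real n)\<^sup>2 / 2)"

text \<open>Beyond radius \<open>2 n\<close>, the factor \<open>exp (\<parallel>A\<parallel>\<^sup>2 / 4)\<close> from the determinant bound with \<open>s = 8\<close> is at
  most \<open>exp (\<parallel>A\<parallel>\<^sup>2 / 2 - n\<^sup>2)\<close>, whose mean is at most \<open>exp (- n\<^sup>2 / 2)\<close>.\<close>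
lemma det_tail:
  "(\<integral>\<^sup>+x. ennreal \<bar>Determinant.det (sym_of_coords n x)\<bar> * indicator {x. 4 * (real n)\<^sup>2 < radius_sq n x} x \<partial>goe n)
    \<le> ennreal (tail_bound n)"
proof -
  have "(\<integral>\<^sup>+x. ennreal \<bar>Determinant.det (sym_of_coords n x)\<bar> * indicator {x. 4 * (real n)\<^sup>2 < radius_sq n x} x \<partial>goe n)
    \<le> (\<integral>\<^sup>+x. ennreal (2 * 8 ^ n * exp (- (real n)\<^sup>2)) * ennreal (exp (radius_sq n x / 2)) \<partial>goe n)"
  proof (rule nn_integral_mono)
    fix x
    let ?r = "radius_sq n x"
    show "ennreal \<bar>Determinant.det (sym_of_coords n x)\<bar> * indicator {x. 4 * (real n)\<^sup>2 < radius_sq n x} x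
        \<le> ennreal (2 * 8 ^ n * exp (- (real n)\<^sup>2)) * ennreal (exp (?r / 2))"
    proof (cases "4 * (real n)\<^sup>2 < ?r")
      case True
      have r0: "0 \<le> ?r" by (simp add: radius_sq_def sum_nonneg)
      have "\<bar>Determinant.det (sym_of_coords n x)\<bar> \<le> 1 + 8 ^ n * exp (2 * ?r / 8)"
        by (rule abs_det_le) simp
      also have "1 \<le> 8 ^ n * exp (2 * ?r / 8)"
        using mult_mono[of 1 "8 ^ n" 1 "exp (2 * ?r / 8)"] r0 by simp
      finally have "\<bar>Determinant.det (sym_of_coords n x)\<bar> \<le> 2 * 8 ^ n * exp (2 * ?r / 8)" by simp
      also have "\<dots> \<le> 2 * 8 ^ n * exp (- (real n)\<^sup>2 + ?r / 2)"
        using True by (intro mult_left_mono) auto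
      also have "\<dots> = 2 * 8 ^ n * exp (- (real n)\<^sup>2) * exp (?r / 2)" by (simp only: exp_add mult.assoc)
      finally show ?thesis using True by (simp add: ennreal_mult[symmetric] ennreal_leI)
    qed simp
  qed
  also have "\<dots> = ennreal (2 * 8 ^ n * exp (- (real n)\<^sup>2)) * (\<integral>\<^sup>+x. ennreal (exp (radius_sq n x / 2)) \<partial>goe n)"
    by (rule nn_integral_cmult) measurable
  also have "\<dots> \<le> ennreal (2 * 8 ^ n * exp (- (real n)\<^sup>2)) * ennreal (exp ((real n)\<^sup>2 / 2))"
    by (intro mult_left_mono nn_integral_exp_radius) simp
  also have "\<dots> = ennreal (2 * 8 ^ n * (exp (- (real n)\<^sup>2) * exp ((real n)\<^sup>2 / 2)))"
    by (simp add: ennreal_mult[symmetric] mult.assoc)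
  also have "exp (- (real n)\<^sup>2) * exp ((real n)\<^sup>2 / 2) = exp (- (real n)\<^sup>2 / 2)"
    by (simp add: exp_add[symmetric])
  finally show ?thesis by (simp add: tail_bound_def)
qed

text \<open>Lower semicontinuity of the number of eigenvalues above \<open>t\<close>: if \<open>B\<close> had fewer of them than
  \<open>A\<close>, the eigenvalues of \<open>A\<close> above \<open>t\<close> and those of \<open>B\<close> not above \<open>t\<close> would be more than \<open>n\<close>
  together, and \<open>spectral_distance\<close> would give a distance of at least the spectral gap \<open>g\<close>.\<close>
lemma spectral_count_perturb:
  assumes A: "spectral_decomp n A U d" and B: "spectral_decomp n B V e"
    and k: "k \<le> eig_count A {t<..}" and g: "0 < g" "\<And>i. i < n \<Longrightarrow> t < d i \<Longrightarrow> t + g \<le> d i"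
    and close: "fro_sq n (A - B) < g\<^sup>2"
  shows "k \<le> eig_count B {t<..}"
proof (rule ccontr)
  let ?I = "{i. i < n \<and> t < d i}" and ?J = "{j. j < n \<and> e j \<le> t}"
  assume "\<not> ?thesis"
  moreover have "card ?J + card {j. j < n \<and> t < e j} = n"
  proof -
    have "?J \<union> {j. j < n \<and> t < e j} = {..<n}" "?J \<inter> {j. j < n \<and> t < e j} = {}" by auto
    then show ?thesis by (metis card_Un_disjoint card_lessThan finite_Un finite_lessThan)
  qed
  ultimately have "n < card ?I + card ?J"
    using k unfolding eig_count_spectral[OF A] eig_count_spectral[OF B] by simp
  then have c: "1 \<le> real (card ?I) + real (card ?J) - real n" by linarith
  have "(real (card ?I) + real (card ?J) - real n) * g\<^sup>2 \<le> fro_sq n (A - B)"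
    by (rule spectral_distance[OF A B]) (use g in force)+
  moreover have "1 * g\<^sup>2 \<le> (real (card ?I) + real (card ?J) - real n) * g\<^sup>2"
    using c by (rule mult_right_mono) simp
  ultimately show False using close by linarith
qed

lemma eig_count_ge_measurable:
  "{x \<in> space (goe n). k \<le> eig_count (sym_of_coords n x) {t<..}} \<in> sets (goe n)"
  unfolding goe_def
proof (rule open_measurable_PiM)
  fix x assume "x \<in> {x \<in> space (Pi\<^sub>M (sym_index n) (\<lambda>_. gauss)). k \<le> eig_count (sym_of_coords n x) {t<..}}"
  then have k: "k \<le> eig_count (sym_of_coords n x) {t<..}" by simp
  obtain U d where A: "spectral_decomp n (sym_of_coords n x) U d"
    using spectral_theorem[OF sym_of_coords_in] by blast
  define g where "g = Min (insert 1 ((\<lambda>i. d i - t) ` {i. i < n \<and> t < d i}))"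
  have g: "0 < g" unfolding g_def by (subst Min_gr_iff) auto
  have gd: "t + g \<le> d i" if "i < n" "t < d i" for i
  proof -
    have "g \<le> d i - t" unfolding g_def using that by (intro Min_le) auto
    then show ?thesis by simp
  qed
  define N where "N = real (card (sym_index n))"
  define e where "e = g / sqrt (2 * (N + 1))"
  have N: "0 \<le> N" by (simp add: N_def)
  have e: "0 < e" using g N by (simp add: e_def)
  show "\<exists>e>0. \<forall>y\<in>space (Pi\<^sub>M (sym_index n) (\<lambda>_. gauss)). (\<forall>i\<in>sym_index n. \<bar>x i - y i\<bar> < e) \<longrightarrow>
      y \<in> {x \<in> space (Pi\<^sub>M (sym_index n) (\<lambda>_. gauss)). k \<le> eig_count (sym_of_coords n x) {t<..}}"
  proof (intro exI[of _ e] conjI e ballI impI)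
    fix y assume y: "y \<in> space (Pi\<^sub>M (sym_index n) (\<lambda>_. gauss))" and xy: "\<forall>i\<in>sym_index n. \<bar>x i - y i\<bar> < e"
    obtain V f where B: "spectral_decomp n (sym_of_coords n y) V f"
      using spectral_theorem[OF sym_of_coords_in] by blast
    have "(\<Sum>p\<in>sym_index n. (x p - y p)\<^sup>2) \<le> (\<Sum>p\<in>sym_index n. e\<^sup>2)"
    proof (rule sum_mono)
      fix p assume "p \<in> sym_index n"
      then have "\<bar>x p - y p\<bar> \<le> \<bar>e\<bar>" using xy e by fastforce
      then show "(x p - y p)\<^sup>2 \<le> e\<^sup>2" by (simp add: abs_le_square_iff)
    qed
    then have "fro_sq n (sym_of_coords n x - sym_of_coords n y) \<le> 2 * (N * e\<^sup>2)"
      unfolding fro_sq_sym_of_coords_diff by (simp add: N_def)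
    also have "\<dots> < 2 * ((N + 1) * e\<^sup>2)" using e by simp
    also have "\<dots> = g\<^sup>2"
    proof -
      have "0 < 2 * (N + 1)" by (intro mult_pos_pos add_nonneg_pos N) simp_all
      then have "2 * (N + 1) \<noteq> 0" by (rule less_imp_neq[THEN not_sym])
      moreover have "e\<^sup>2 = g\<^sup>2 / (2 * (N + 1))" unfolding e_def power_divide using N by simp
      ultimately have "e\<^sup>2 * (2 * (N + 1)) = g\<^sup>2" by (rule nonzero_eq_divide_eq[THEN iffD1])
      then show ?thesis by (simp only: mult_ac)
    qed
    finally have "k \<le> eig_count (sym_of_coords n y) {t<..}"
      by (intro spectral_count_perturb[OF A B k g gd])
    then show "y \<in> {x \<in> space (Pi\<^sub>M (sym_index n) (\<lambda>_. gauss)). k \<le> eig_count (sym_of_coords n x) {t<..}}"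
      using y by simp
  qed
qed auto

text \<open>One term of the exponential series.\<close>
lemma power_self_le_fact_exp: "real m ^ m \<le> fact m * exp (real m)"
proof -
  have "(\<Sum>k\<in>{m}. inverse (fact k) *\<^sub>R real m ^ k) \<le> (\<Sum>k. inverse (fact k) *\<^sub>R real m ^ k)"
    by (rule sum_le_suminf[OF summable_exp_generic]) auto
  then have "real m ^ m / fact m \<le> exp (real m)" by (simp add: exp_def divide_inverse mult.commute)
  then show ?thesis by (simp add: field_simps)
qed

text \<open>Half of the lower bound for the mean of \<open>\<bar>det A\<bar>\<close>: values below it account for at most half of
  the mean.\<close>
definition det_floor :: "nat \<Rightarrow> real" where
  "det_floor n = fact (n div 2) * (1 / 2) ^ (n div 2 + 2)"

text \<open>The lower bound for the determinant has the order \<open>n\<^sup>n\<close> of \<open>(det A)\<^sup>2\<close> for a matrix with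
  eigenvalues of size \<open>sqrt n\<close>, up to a factor exponential in \<open>n\<close>. The constant is
  \<open>576 = 6 * 3 * 32\<close>: a factor \<open>6\<close> from \<open>n \<le> 3 * (n div 2)\<close> and the parity of \<open>n\<close>, a factor \<open>3\<close> from
  \<open>exp 1 \<le> 3\<close>, and a factor \<open>32\<close> from the powers of \<open>1/2\<close>.\<close>
lemma det_floor_sq_ge:
  assumes "2 \<le> n"
  shows "real n ^ n \<le> 576 ^ n * (det_floor n)\<^sup>2"
proof -
  define m where "m = n div 2"
  define r where "r = n mod 2"
  have n: "n = 2 * m + r" "r \<le> 1" "1 \<le> m" using assms by (auto simp: m_def r_def)
  have "real n ^ n \<le> (3 * real m) ^ n" using n by (intro power_mono) auto
  also have "\<dots> = 3 ^ n * ((real m ^ m)\<^sup>2 * real m ^ r)"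
    unfolding power_mult_distrib by (subst (2) n(1)) (simp add: power_add power_mult[symmetric] mult.commute)
  also have "\<dots> \<le> 3 ^ n * ((fact m * exp (real m))\<^sup>2 * 2 ^ n)"
  proof (intro mult_left_mono mult_mono power_mono power_self_le_fact_exp)
    have "real m ^ r \<le> real m ^ 1" using n by (intro power_increasing) auto
    also have "real m ^ 1 \<le> 2 ^ m" using of_nat_less_two_power[of m] by (simp add: less_imp_le)
    also have "(2 :: real) ^ m \<le> 2 ^ n" using n by (intro power_increasing) auto
    finally show "real m ^ r \<le> 2 ^ n" .
  qed auto
  also have "\<dots> = 6 ^ n * ((fact m)\<^sup>2 * exp (2 * real m))"
  proof -
    have "(6 :: real) ^ n = 3 ^ n * 2 ^ n" by (simp add: power_mult_distrib[symmetric])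
    then show ?thesis by (simp add: power_mult_distrib exp_double[symmetric] mult_ac)
  qed
  also have "\<dots> \<le> 6 ^ n * ((fact m)\<^sup>2 * 3 ^ n)"
  proof (intro mult_left_mono)
    have "exp (2 * real m) \<le> exp (real n)" using n by simp
    also have "\<dots> = exp 1 ^ n" by (simp add: exp_of_nat_mult[symmetric])
    also have "\<dots> \<le> 3 ^ n" by (intro power_mono exp_le) simp
    finally show "exp (2 * real m) \<le> 3 ^ n" .
  qed auto
  also have "\<dots> = 18 ^ n * (2 ^ (m + 2))\<^sup>2 * (det_floor n)\<^sup>2"
  proof -
    have "(18 :: real) ^ n = 6 ^ n * 3 ^ n" by (simp add: power_mult_distrib[symmetric])
    moreover have "(2 ^ (m + 2))\<^sup>2 * (det_floor n)\<^sup>2 = (fact m)\<^sup>2"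
      unfolding det_floor_def m_def[symmetric] power_mult_distrib[symmetric]
      by (simp add: power_one_over)
    ultimately show ?thesis by (simp add: mult_ac)
  qed
  also have "\<dots> \<le> 18 ^ n * 32 ^ n * (det_floor n)\<^sup>2"
  proof (intro mult_left_mono mult_right_mono)
    have "(2 ^ (m + 2) :: real)\<^sup>2 = 2 ^ (2 * m + 4)" by (simp add: power_mult[symmetric] power_add)
    also have "\<dots> \<le> 2 ^ (5 * n)" using n by (intro power_increasing) auto
    also have "\<dots> = 32 ^ n" by (simp add: power_mult)
    finally show "(2 ^ (m + 2) :: real)\<^sup>2 \<le> 32 ^ n" .
  qed auto
  also have "(18 :: real) ^ n * 32 ^ n = 576 ^ n" by (simp add: power_mult_distrib[symmetric])
  finally show ?thesis .
qed

text \<open>Too many eigenvalues below \<open>\<eta> * sqrt n\<close> with \<open>\<eta> = exp (- 8 / \<delta>)\<close> would multiply the bound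
  \<open>n\<^sup>n * exp (8 n)\<close> for \<open>(det A)\<^sup>2\<close> by \<open>\<eta> ^ (2 \<delta> n) = exp (- 16 n)\<close>. As \<open>exp 8 > 576\<close>, the result is below
  the square of \<open>det_floor n\<close>.\<close>
lemma few_small_eigenvalues:
  assumes sd: "spectral_decomp n A U d" and n: "2 \<le> n" and \<delta>: "0 < \<delta>"
    and fro: "fro_sq n A \<le> 8 * (real n)\<^sup>2" and D: "det_floor n \<le> \<bar>Determinant.det A\<bar>"
  shows "real (card {i. i < n \<and> \<bar>d i\<bar> \<le> exp (- 8 / \<delta>) * sqrt n}) < \<delta> * real n"
proof (rule ccontr)
  let ?k = "card {i. i < n \<and> \<bar>d i\<bar> \<le> exp (- 8 / \<delta>) * sqrt n}"
  assume "\<not> ?thesis"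
  then have k: "\<delta> * real n \<le> real ?k" by simp
  have n0: "0 < n" using n by simp
  have D0: "0 < det_floor n" by (simp add: det_floor_def)
  have "(det_floor n)\<^sup>2 \<le> (Determinant.det A)\<^sup>2"
    using D D0 by (metis abs_le_square_iff abs_of_pos)
  also have "\<dots> \<le> real (n ^ n) * exp (- 8 / \<delta>) ^ (2 * ?k) * exp (fro_sq n A / n)"
    using det_sq_le_small_eigenvalues[OF sd _ _ n0 order_refl, of "exp (- 8 / \<delta>)"] \<delta> by simp
  also have "\<dots> \<le> real (n ^ n) * exp (- 16 * real n) * exp (8 * real n)"
  proof (intro mult_mono mult_left_mono)
    have "exp (- 8 / \<delta>) ^ (2 * ?k) = exp (- 16 * (real ?k / \<delta>))"
      by (simp add: exp_of_nat_mult[symmetric])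
    also have "\<dots> \<le> exp (- 16 * real n)" using k \<delta> by (simp add: field_simps)
    finally show "exp (- 8 / \<delta>) ^ (2 * ?k) \<le> exp (- 16 * real n)" .
    show "exp (fro_sq n A / n) \<le> exp (8 * real n)"
      using fro n0 by (simp add: field_simps power2_eq_square)
  qed auto
  also have "\<dots> = real n ^ n * exp (- 8 * real n)"
    by (simp add: exp_add[symmetric] mult.assoc)
  also have "\<dots> \<le> 576 ^ n * (det_floor n)\<^sup>2 * exp (- 8 * real n)"
    using det_floor_sq_ge[OF n] by (rule mult_right_mono) simp
  finally have "1 * (det_floor n)\<^sup>2 \<le> (576 ^ n * exp (- 8 * real n)) * (det_floor n)\<^sup>2"
    by (simp add: mult_ac)
  then have "1 \<le> 576 ^ n * exp (- 8 * real n)" using D0 by simp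
  moreover have "576 ^ n < exp (8 * real n)"
  proof -
    have "(5 / 2 :: real) \<le> exp 1" using exp_lower_Taylor_quadratic[of 1] by simp
    then have "(5 / 2 :: real) ^ 8 \<le> exp 1 ^ 8" by (rule power_mono) simp
    also have "exp 1 ^ 8 = exp (8 :: real)" by (simp add: exp_of_nat_mult[symmetric])
    finally have "(576 :: real) < exp 8" by (simp add: power_divide)
    then have "(576 :: real) ^ n < exp 8 ^ n" using n0 by (intro power_strict_mono) auto
    then show ?thesis by (simp add: exp_of_nat_mult[symmetric] mult.commute)
  qed
  ultimately show False by (simp add: exp_minus field_simps)
qed

section \<open>Separating few from many positive eigenvalues\<close>

definition bulk_set :: "nat \<Rightarrow> (nat \<times> nat \<Rightarrow> real) set" where
  "bulk_set n = {x \<in> space (goe n). radius_sq n x \<le> 4 * (real n)\<^sup>2 \<and>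
     det_floor n \<le> \<bar>Determinant.det (sym_of_coords n x)\<bar>}"

text \<open>Matrices for which nearly half of the eigenvalues are positive and not small; for \<open>\<delta>\<close> close
  to \<open>0\<close> the required proportion approaches \<open>1/2\<close>, while the threshold decreases to \<open>0\<close>.\<close>
definition half_positive_set :: "real \<Rightarrow> nat \<Rightarrow> (nat \<times> nat \<Rightarrow> real) set" where
  "half_positive_set \<delta> n = {x \<in> space (goe n).
     (1 - \<delta>) * real n / 2 \<le> real (eig_count (sym_of_coords n x) {exp (- 8 / \<delta>) * sqrt n<..})}"

definition few_positive_set :: "real \<Rightarrow> nat \<Rightarrow> (nat \<times> nat \<Rightarrow> real) set" where
  "few_positive_set \<alpha> n = {x \<in> space (goe n). real (eig_count (sym_of_coords n x) {0<..}) \<le> \<alpha> * real n}"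

lemma bulk_set_measurable [measurable]: "bulk_set n \<in> sets (goe n)"
  unfolding bulk_set_def by measurable

lemma half_positive_set_measurable [measurable]: "half_positive_set \<delta> n \<in> sets (goe n)"
proof -
  have "half_positive_set \<delta> n = {x \<in> space (goe n). nat \<lceil>(1 - \<delta>) * real n / 2\<rceil> \<le>
      eig_count (sym_of_coords n x) {exp (- 8 / \<delta>) * sqrt n<..}}"
    unfolding half_positive_set_def by (simp only: nat_ceiling_le_eq)
  then show ?thesis by (simp only: eig_count_ge_measurable)
qed

lemma few_positive_set_measurable [measurable]: "few_positive_set \<alpha> n \<in> sets (goe n)"
proof (cases "0 \<le> \<alpha> * real n")
  case True
  have "real c \<le> \<alpha> * real n \<longleftrightarrow> \<not> (nat \<lfloor>\<alpha> * real n\<rfloor> + 1 \<le> c)" for c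
    using True by (simp add: le_nat_floor not_le less_Suc_eq_le) (metis le_nat_floor of_nat_floor order.trans of_nat_mono)
  then have "few_positive_set \<alpha> n = space (goe n) - {x \<in> space (goe n). nat \<lfloor>\<alpha> * real n\<rfloor> + 1 \<le>
      eig_count (sym_of_coords n x) {0<..}}"
    unfolding few_positive_set_def by auto
  then show ?thesis by (simp only: sets.compl_sets eig_count_ge_measurable)
next
  case False
  then have "few_positive_set \<alpha> n = {}" unfolding few_positive_set_def by (auto simp: not_le intro: less_le_trans)
  then show ?thesis by simp
qed

lemma tail_indicator_measurable:
  "(\<lambda>x. indicator {x. r < radius_sq n x} x :: ennreal) \<in> borel_measurable (goe n)"
proof -
  have "{x \<in> space (goe n). r < radius_sq n x} \<in> sets (goe n)" by measurable
  then have "(indicator {x \<in> space (goe n). r < radius_sq n x} :: _ \<Rightarrow> ennreal) \<in> borel_measurable (goe n)"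
    by (rule borel_measurable_indicator)
  then show ?thesis by (rule measurable_cong[THEN iffD1, rotated]) (simp add: indicator_def)
qed

text \<open>Of the mean of \<open>\<bar>det A\<bar>\<close>, which is at least \<open>2 * det_floor n\<close>, the values below \<open>det_floor n\<close>
  account for at most \<open>det_floor n\<close> and the large matrices for at most half as much. The remainder
  is carried by \<open>bulk_set n\<close>, on which the integrand is bounded.\<close>
lemma prob_bulk_set:
  assumes n: "0 < n" and tail: "tail_bound n \<le> det_floor n / 2"
  shows "det_floor n / 2 \<le> bulk_bound n * measure (goe n) (bulk_set n)"
proof -
  interpret prob_space "goe n" by (rule prob_space_goe)
  let ?D = "\<lambda>x. \<bar>Determinant.det (sym_of_coords n x)\<bar>" and ?\<theta> = "det_floor n"
  let ?T = "{x. 4 * (real n)\<^sup>2 < radius_sq n x}"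
  have \<theta>: "0 < ?\<theta>" by (simp add: det_floor_def)
  have B: "0 \<le> bulk_bound n" by (simp add: bulk_bound_def)
  note tail_indicator_measurable [measurable]
  have "ennreal (2 * ?\<theta>) \<le> (\<integral>\<^sup>+x. ennreal (?D x) \<partial>goe n)"
    using mean_abs_det_ge[of n] by (simp add: det_floor_def mult_ac)
  also have "\<dots> \<le> (\<integral>\<^sup>+x. (ennreal (?D x) * indicator ?T x + ennreal (bulk_bound n) * indicator (bulk_set n) x) + ennreal ?\<theta> \<partial>goe n)"
  proof (rule nn_integral_mono)
    fix x assume x: "x \<in> space (goe n)"
    consider "x \<in> ?T" | "x \<in> bulk_set n" | "?D x \<le> ?\<theta>"
      using x unfolding bulk_set_def by fastforce
    then show "ennreal (?D x) \<le> (ennreal (?D x) * indicator ?T x + ennreal (bulk_bound n) * indicator (bulk_set n) x) + ennreal ?\<theta>"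
    proof cases
      case 1
      then show ?thesis by (simp add: add_increasing2)
    next
      case 2
      then have "?D x \<le> bulk_bound n"
        using abs_det_le_bulk[OF n, of x] by (simp add: bulk_set_def)
      then have "ennreal (?D x) \<le> ennreal (bulk_bound n)" by (rule ennreal_leI)
      with 2 show ?thesis by (simp add: add_increasing add_increasing2)
    next
      case 3
      then have "ennreal (?D x) \<le> ennreal ?\<theta>" by (rule ennreal_leI)
      then show ?thesis by (simp add: add_increasing)
    qed
  qed
  also have "\<dots> = ((\<integral>\<^sup>+x. ennreal (?D x) * indicator ?T x \<partial>goe n) + ennreal (bulk_bound n) * emeasure (goe n) (bulk_set n)) + ennreal ?\<theta>"
    by (subst nn_integral_add; (subst nn_integral_add)?; simp add: nn_integral_cmult emeasure_space_1)
  also have "\<dots> \<le> (ennreal (tail_bound n) + ennreal (bulk_bound n) * emeasure (goe n) (bulk_set n)) + ennreal ?\<theta>"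
    by (intro add_right_mono det_tail)
  also have "\<dots> = ennreal (tail_bound n + bulk_bound n * measure (goe n) (bulk_set n) + ?\<theta>)"
    using \<theta> B by (simp add: emeasure_eq_measure ennreal_mult ennreal_plus tail_bound_def)
  finally have "2 * ?\<theta> \<le> tail_bound n + bulk_bound n * measure (goe n) (bulk_set n) + ?\<theta>"
    using \<theta> B by (subst (asm) ennreal_le_iff) (auto simp: tail_bound_def)
  then show ?thesis using tail by linarith
qed

text \<open>A matrix in \<open>bulk_set n\<close> has fewer than \<open>\<delta> n\<close> small eigenvalues. The others are either
  mostly positive or mostly negative, so \<open>A\<close> or \<open>- A\<close> has enough large positive ones, and \<open>A\<close> and
  \<open>- A\<close> have the same law.\<close>
lemma prob_bulk_le_prob_half_positive:
  assumes n: "2 \<le> n" and \<delta>: "0 < \<delta>"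
  shows "measure (goe n) (bulk_set n) \<le> 2 * measure (goe n) (half_positive_set \<delta> n)"
proof -
  interpret prob_space "goe n" by (rule prob_space_goe)
  define neg where "neg = compose (sym_index n) (uminus :: real \<Rightarrow> real)"
  have distr: "distr (goe n) (goe n) neg = goe n"
    unfolding goe_def neg_def by (rule distr_PiM_gauss_uminus) simp
  have neg_m [measurable]: "neg \<in> goe n \<rightarrow>\<^sub>M goe n"
    unfolding goe_def neg_def compose_def
    by (rule measurable_PiM_single') (auto simp: space_PiM PiM_gauss_component)
  have M_neg: "sym_of_coords n (neg x) = - sym_of_coords n x" for x
    by (rule eq_matI) (auto simp: sym_of_coords_def neg_def compose_def sum_negf[symmetric] intro!: sum.cong)
  have split: "bulk_set n \<subseteq> half_positive_set \<delta> n \<union> (neg -` half_positive_set \<delta> n \<inter> space (goe n))"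
  proof
    fix x assume x: "x \<in> bulk_set n"
    let ?h = "exp (- 8 / \<delta>) * sqrt n"
    obtain U d where sd: "spectral_decomp n (sym_of_coords n x) U d"
      using spectral_theorem[OF sym_of_coords_in] by blast
    let ?S = "{i. i < n \<and> \<bar>d i\<bar> \<le> ?h}" and ?P = "{i. i < n \<and> ?h < d i}" and ?Q = "{i. i < n \<and> ?h < - d i}"
    have S: "real (card ?S) < \<delta> * real n"
    proof (rule few_small_eigenvalues[OF sd n \<delta>])
      show "fro_sq n (sym_of_coords n x) \<le> 8 * (real n)\<^sup>2"
        using x unfolding fro_sq_sym_of_coords bulk_set_def radius_sq_def by simp
    qed (use x in \<open>simp add: bulk_set_def\<close>)
    have "{..<n} \<subseteq> ?S \<union> (?P \<union> ?Q)" by auto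
    then have "n \<le> card (?S \<union> (?P \<union> ?Q))" using card_mono[of "?S \<union> (?P \<union> ?Q)" "{..<n}"] by simp
    also have "\<dots> \<le> card ?S + (card ?P + card ?Q)"
      by (meson add_left_mono card_Un_le order.trans)
    finally have "(1 - \<delta>) * real n \<le> real (card ?P) + real (card ?Q)"
      using S by (simp add: algebra_simps)
    then consider "(1 - \<delta>) * real n / 2 \<le> real (card ?P)" | "(1 - \<delta>) * real n / 2 \<le> real (card ?Q)"
      by linarith
    then show "x \<in> half_positive_set \<delta> n \<union> (neg -` half_positive_set \<delta> n \<inter> space (goe n))"
    proof cases
      case 1
      then show ?thesis using x by (simp add: half_positive_set_def bulk_set_def eig_count_spectral[OF sd])
    next
      case 2
      have xs: "x \<in> space (goe n)" using x by (simp add: bulk_set_def)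
      have "neg x \<in> space (goe n)" using neg_m xs by (rule measurable_space)
      then show ?thesis
        using 2 xs by (simp add: half_positive_set_def M_neg eig_count_spectral[OF spectral_uminus[OF sd]])
    qed
  qed
  have m: "neg -` half_positive_set \<delta> n \<inter> space (goe n) \<in> sets (goe n)" by measurable
  have "measure (goe n) (bulk_set n) \<le> measure (goe n) (half_positive_set \<delta> n \<union> (neg -` half_positive_set \<delta> n \<inter> space (goe n)))"
    using split m by (intro finite_measure_mono) auto
  also have "\<dots> \<le> measure (goe n) (half_positive_set \<delta> n) + measure (goe n) (neg -` half_positive_set \<delta> n \<inter> space (goe n))"
    using m by (intro measure_Un_le) auto
  also have "measure (goe n) (neg -` half_positive_set \<delta> n \<inter> space (goe n)) = measure (distr (goe n) (goe n) neg) (half_positive_set \<delta> n)"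
    by (subst measure_distr) auto
  finally show ?thesis unfolding distr by simp
qed

lemma few_half_positive_distance:
  assumes x: "x \<in> few_positive_set \<alpha> n" and y: "y \<in> half_positive_set (1 / 2 - \<alpha>) n" and \<alpha>: "\<alpha> < 1 / 2"
  shows "(1 / 2 - \<alpha>) * (exp (- 8 / (1 / 2 - \<alpha>)))\<^sup>2 * (real n)\<^sup>2 / 4 \<le> (\<Sum>p\<in>sym_index n. (x p - y p)\<^sup>2)"
proof -
  define \<delta> where "\<delta> = 1 / 2 - \<alpha>"
  define h where "h = exp (- 8 / \<delta>) * sqrt n"
  have h0: "0 \<le> h" by (simp add: h_def)
  obtain U d where A: "spectral_decomp n (sym_of_coords n x) U d" using spectral_theorem[OF sym_of_coords_in] by blast
  obtain V e where B: "spectral_decomp n (sym_of_coords n y) V e" using spectral_theorem[OF sym_of_coords_in] by blast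
  let ?I = "{i. i < n \<and> d i \<le> 0}" and ?P = "{i. i < n \<and> 0 < d i}" and ?J = "{j. j < n \<and> h < e j}"
  have "card ?I + card ?P = n"
  proof -
    have "?I \<union> ?P = {..<n}" "?I \<inter> ?P = {}" by auto
    then show ?thesis by (metis card_Un_disjoint card_lessThan finite_Un finite_lessThan)
  qed
  then have "real (card ?I) + real (card ?P) = real n" by (metis of_nat_add)
  moreover have "real (card ?P) \<le> \<alpha> * real n"
    using x by (simp add: few_positive_set_def eig_count_spectral[OF A])
  moreover have "(1 - \<delta>) * real n / 2 \<le> real (card ?J)"
    using y by (simp add: half_positive_set_def eig_count_spectral[OF B] \<delta>_def h_def)
  ultimately have c: "\<delta> * real n / 2 \<le> real (card ?I) + real (card ?J) - real n"
    by (simp add: \<delta>_def field_simps)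
  have "\<delta> * real n / 2 * h\<^sup>2 \<le> (real (card ?I) + real (card ?J) - real n) * h\<^sup>2"
    using c by (rule mult_right_mono) simp
  also have "\<dots> \<le> fro_sq n (sym_of_coords n x - sym_of_coords n y)"
    by (rule spectral_distance[OF A B _ _ h0]) auto
  also have "\<dots> = 2 * (\<Sum>p\<in>sym_index n. (x p - y p)\<^sup>2)" by (rule fro_sq_sym_of_coords_diff)
  finally have le: "\<delta> * real n / 4 * h\<^sup>2 \<le> (\<Sum>p\<in>sym_index n. (x p - y p)\<^sup>2)" by simp
  have eq: "\<delta> * real n / 4 * h\<^sup>2 = \<delta> * (exp (- 8 / \<delta>))\<^sup>2 * (real n)\<^sup>2 / 4"
    by (simp add: h_def power_mult_distrib power2_eq_square)
  from le[unfolded eq] show ?thesis unfolding \<delta>_def .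
qed

definition decay_rate :: "real \<Rightarrow> real" where
  "decay_rate \<alpha> = (1 / 2 - \<alpha>) * (exp (- 8 / (1 / 2 - \<alpha>)))\<^sup>2 / 8"

text \<open>The two-set inequality, divided by the lower bound for the probability of
  \<open>half_positive_set\<close>.\<close>
lemma prob_few_positive_set:
  assumes n: "2 \<le> n" and tail: "tail_bound n \<le> det_floor n / 2" and \<alpha>: "\<alpha> < 1 / 2"
  shows "measure (goe n) (few_positive_set \<alpha> n) \<le> 4 * bulk_bound n / det_floor n * exp (- decay_rate \<alpha> * (real n)\<^sup>2)"
proof -
  let ?N = "measure (goe n) (few_positive_set \<alpha> n)" and ?P = "measure (goe n) (half_positive_set (1 / 2 - \<alpha>) n)"
  have \<theta>: "0 < det_floor n" by (simp add: det_floor_def)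
  have B: "0 \<le> bulk_bound n" by (simp add: bulk_bound_def)
  have "?N * ?P \<le> exp (- ((1 / 2 - \<alpha>) * (exp (- 8 / (1 / 2 - \<alpha>)))\<^sup>2 * (real n)\<^sup>2 / 4) / 2)"
    unfolding goe_def
    by (rule gauss_two_set_inequality)
      (use few_positive_set_measurable[of \<alpha> n] half_positive_set_measurable[of "1 / 2 - \<alpha>" n] few_half_positive_distance[OF _ _ \<alpha>]
        in \<open>auto simp: goe_def\<close>)
  then have NP: "?N * ?P \<le> exp (- decay_rate \<alpha> * (real n)\<^sup>2)" by (simp add: decay_rate_def)
  have "det_floor n / 2 \<le> bulk_bound n * measure (goe n) (bulk_set n)"
    using n tail by (intro prob_bulk_set) auto
  also have "\<dots> \<le> bulk_bound n * (2 * ?P)"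
    using prob_bulk_le_prob_half_positive[OF n] \<alpha> B by (intro mult_left_mono) auto
  finally have "det_floor n \<le> 4 * bulk_bound n * ?P" by simp
  then have "det_floor n * ?N \<le> (4 * bulk_bound n * ?P) * ?N" by (rule mult_right_mono) simp
  also have "\<dots> = 4 * bulk_bound n * (?N * ?P)" by simp
  also have "\<dots> \<le> 4 * bulk_bound n * exp (- decay_rate \<alpha> * (real n)\<^sup>2)"
    using NP B by (intro mult_left_mono) auto
  finally show ?thesis using \<theta> by (simp add: field_simps)
qed

text \<open>Every signature \<open>(i, n - i)\<close> with \<open>i \<le> \<alpha> n\<close> is contained in the single set of matrices with at
  most \<open>\<alpha> n\<close> positive eigenvalues, so one bound serves for all terms of the sum. The integral is
  split according to the norm of the matrix.\<close>
lemma e_real_le: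
  assumes n: "0 < n" and i: "i \<le> n" "real i \<le> \<alpha> * real n"
  shows "e_real i (n - i) \<le> ennreal (tail_bound n + bulk_bound n * measure (goe n) (few_positive_set \<alpha> n))"
proof -
  interpret prob_space "goe n" by (rule prob_space_goe)
  let ?D = "\<lambda>x. \<bar>Determinant.det (sym_of_coords n x)\<bar>"
  let ?T = "{x. 4 * (real n)\<^sup>2 < radius_sq n x}"
  let ?K = "{A. real (eig_count A {0<..}) \<le> \<alpha> * real n}"
  have B: "0 \<le> bulk_bound n" by (simp add: bulk_bound_def)
  have ind: "indicator ?K (sym_of_coords n x) = (indicator (few_positive_set \<alpha> n) x :: ennreal)" if "x \<in> space (goe n)" for x
    using that by (simp add: few_positive_set_def indicator_def)
  note tail_indicator_measurable [measurable]
  have "e_real i (n - i) \<le> (\<integral>\<^sup>+A. ennreal \<bar>Determinant.det A\<bar> * indicator ?K A \<partial>sym_gauss n)"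
    unfolding e_real_def using i
    by (simp, intro nn_integral_mono mult_left_mono)
      (auto simp: sym_sig_def pos_index_def eig_count_def indicator_def)
  also have "\<dots> = (\<integral>\<^sup>+x. ennreal (?D x) * indicator ?K (sym_of_coords n x) \<partial>goe n)"
  proof (rule nn_integral_sym_gauss)
    have "(\<lambda>x. ennreal (?D x) * indicator (few_positive_set \<alpha> n) x) \<in> borel_measurable (goe n)" by measurable
    then show "(\<lambda>x. ennreal (?D x) * indicator ?K (sym_of_coords n x)) \<in> borel_measurable (goe n)"
      by (rule measurable_cong[THEN iffD1, rotated]) (simp add: ind)
  qed
  also have "\<dots> \<le> (\<integral>\<^sup>+x. ennreal (?D x) * indicator ?T x + ennreal (bulk_bound n) * indicator (few_positive_set \<alpha> n) x \<partial>goe n)"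
  proof (rule nn_integral_mono)
    fix x assume x: "x \<in> space (goe n)"
    show "ennreal (?D x) * indicator ?K (sym_of_coords n x)
        \<le> ennreal (?D x) * indicator ?T x + ennreal (bulk_bound n) * indicator (few_positive_set \<alpha> n) x"
      unfolding ind[OF x]
    proof (cases "x \<in> ?T")
      case True
      then show "ennreal (?D x) * indicator (few_positive_set \<alpha> n) x
          \<le> ennreal (?D x) * indicator ?T x + ennreal (bulk_bound n) * indicator (few_positive_set \<alpha> n) x"
        by (simp add: indicator_def)
    next
      case False
      then have "?D x \<le> bulk_bound n" by (intro abs_det_le_bulk[OF n]) simp
      then show "ennreal (?D x) * indicator (few_positive_set \<alpha> n) x
          \<le> ennreal (?D x) * indicator ?T x + ennreal (bulk_bound n) * indicator (few_positive_set \<alpha> n) x"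
        by (intro add_increasing mult_right_mono ennreal_leI) auto
    qed
  qed
  also have "\<dots> = (\<integral>\<^sup>+x. ennreal (?D x) * indicator ?T x \<partial>goe n) + ennreal (bulk_bound n) * emeasure (goe n) (few_positive_set \<alpha> n)"
    by (subst nn_integral_add) (simp_all add: nn_integral_cmult)
  also have "\<dots> \<le> ennreal (tail_bound n) + ennreal (bulk_bound n) * emeasure (goe n) (few_positive_set \<alpha> n)"
    by (intro add_right_mono det_tail)
  also have "\<dots> = ennreal (tail_bound n + bulk_bound n * measure (goe n) (few_positive_set \<alpha> n))"
    using B by (simp add: emeasure_eq_measure ennreal_mult ennreal_plus tail_bound_def)
  finally show ?thesis .
qed

lemma det_floor_ge: "(1 / 2) ^ (n + 2) \<le> det_floor n"
proof -
  have "(1 / 2 :: real) ^ (n + 2) \<le> (1 / 2) ^ (n div 2 + 2)" by (intro power_decreasing) auto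
  also have "\<dots> \<le> fact (n div 2) * (1 / 2) ^ (n div 2 + 2)"
    using fact_ge_1[of "n div 2", where ?'a = real] by simp
  finally show ?thesis by (simp add: det_floor_def)
qed

lemma tail_bound_eventually: "\<forall>\<^sub>F n in sequentially. tail_bound n \<le> det_floor n / 2"
proof -
  have "\<forall>\<^sub>F n in sequentially. 2 * 8 ^ n * exp (- (real n)\<^sup>2 / 2) \<le> (1 / 2 :: real) ^ (n + 2) / 2"
    by real_asymp
  then show ?thesis
  proof eventually_elim
    case (elim n)
    then show ?case using det_floor_ge[of n] by (simp add: tail_bound_def)
  qed
qed

text \<open>Any loss in the rate of decay absorbs the number of terms and the factors \<open>exp (O (n * ln n))\<close>.\<close>
lemma growth_eventually:
  fixes c \<kappa> :: real
  assumes "0 < c" "c < 1 / 2" "c < \<kappa>"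
  shows "\<forall>\<^sub>F n in sequentially. (real n + 1) * (2 * 8 ^ n * exp (- (real n)\<^sup>2 / 2) +
    (2 * (8 * real n) ^ n * exp (real n))\<^sup>2 * 4 * 2 ^ (n + 2) * exp (- \<kappa> * (real n)\<^sup>2)) \<le> exp (- c * (real n)\<^sup>2)"
proof -
  have pos: "0 < 1 / 2 - c" "0 < \<kappa> - c" using assms by auto
  have 1: "\<forall>\<^sub>F n in sequentially. (real n + 1) * (2 * 8 ^ n) * exp (- ((1 / 2 - c) * (real n)\<^sup>2)) \<le> 1 / 2"
    using pos(1) by real_asymp
  have 2: "\<forall>\<^sub>F n in sequentially. (real n + 1) * ((2 * (8 * real n) ^ n * exp (real n))\<^sup>2 * 4 * 2 ^ (n + 2)) *
      exp (- ((\<kappa> - c) * (real n)\<^sup>2)) \<le> 1 / 2"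
    using pos(2) by real_asymp
  from 1 2 show ?thesis
  proof eventually_elim
    case (elim n)
    let ?a = "(real n + 1) * (2 * 8 ^ n)" and ?b = "(real n + 1) * ((2 * (8 * real n) ^ n * exp (real n))\<^sup>2 * 4 * 2 ^ (n + 2))"
    let ?E = "exp (- c * (real n)\<^sup>2)"
    have e1: "exp (- (real n)\<^sup>2 / 2) = exp (- ((1 / 2 - c) * (real n)\<^sup>2)) * ?E"
      by (simp add: exp_add[symmetric] algebra_simps)
    have e2: "exp (- \<kappa> * (real n)\<^sup>2) = exp (- ((\<kappa> - c) * (real n)\<^sup>2)) * ?E"
      by (simp add: exp_add[symmetric] algebra_simps)
    have "(real n + 1) * (2 * 8 ^ n * exp (- (real n)\<^sup>2 / 2) +
        (2 * (8 * real n) ^ n * exp (real n))\<^sup>2 * 4 * 2 ^ (n + 2) * exp (- \<kappa> * (real n)\<^sup>2))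
      = (?a * exp (- ((1 / 2 - c) * (real n)\<^sup>2)) + ?b * exp (- ((\<kappa> - c) * (real n)\<^sup>2))) * ?E"
      unfolding e1 e2 by (simp only: distrib_left distrib_right mult.assoc)
    also have "\<dots> \<le> 1 * ?E"
      by (rule mult_right_mono) (use elim in linarith, simp)
    finally show ?case by simp
  qed
qed

theorem theorem4:
  fixes \<alpha> :: real
  assumes "0 \<le> \<alpha>" and "\<alpha> < 1 / 2"
  shows "\<exists>c>0. \<forall>\<^sub>F n in sequentially.
    (\<Sum>i = 0..nat \<lfloor>\<alpha> * real n\<rfloor>. e_real i (n - i)) \<le> ennreal (exp (- c * (real n)\<^sup>2))"
proof -
  define \<kappa> where "\<kappa> = decay_rate \<alpha>"
  define c where "c = min \<kappa> (1 / 2) / 2"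
  have \<kappa>: "0 < \<kappa>" using assms by (simp add: \<kappa>_def decay_rate_def)
  have c: "0 < c" "c < 1 / 2" "c < \<kappa>" using \<kappa> by (auto simp: c_def min_def)
  have "\<forall>\<^sub>F n in sequentially.
    (\<Sum>i = 0..nat \<lfloor>\<alpha> * real n\<rfloor>. e_real i (n - i)) \<le> ennreal (exp (- c * (real n)\<^sup>2))"
    using tail_bound_eventually growth_eventually[OF c] eventually_ge_at_top[of 2]
  proof eventually_elim
    case (elim n)
    let ?B = "bulk_bound n" and ?\<theta> = "det_floor n" and ?N = "measure (goe n) (few_positive_set \<alpha> n)"
    let ?bd = "tail_bound n + ?B * ?N"
    have n: "2 \<le> n" "0 < n" using elim by auto
    have B: "0 \<le> ?B" by (simp add: bulk_bound_def)
    have \<theta>: "0 < ?\<theta>" by (simp add: det_floor_def)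
    have an: "0 \<le> \<alpha> * real n" using assms by simp
    have le_n: "nat \<lfloor>\<alpha> * real n\<rfloor> \<le> n"
    proof -
      have "\<alpha> * real n \<le> 1 * real n" using assms by (intro mult_right_mono) auto
      then show ?thesis by (simp add: floor_le_iff nat_le_iff)
    qed
    have bd0: "0 \<le> ?bd" using B by (simp add: tail_bound_def)
    have each: "e_real i (n - i) \<le> ennreal ?bd" if "i \<in> {0..nat \<lfloor>\<alpha> * real n\<rfloor>}" for i
    proof (rule e_real_le[OF n(2)])
      show "i \<le> n" using that le_n by simp
      show "real i \<le> \<alpha> * real n" using that an by (simp add: le_nat_iff le_floor_iff)
    qed
    have "(\<Sum>i = 0..nat \<lfloor>\<alpha> * real n\<rfloor>. e_real i (n - i)) \<le> (\<Sum>i = 0..nat \<lfloor>\<alpha> * real n\<rfloor>. ennreal ?bd)"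
      by (rule sum_mono) (rule each)
    also have "\<dots> = ennreal ((real (nat \<lfloor>\<alpha> * real n\<rfloor>) + 1) * ?bd)"
      using bd0 by (simp add: ennreal_mult ennreal_of_nat_eq_real_of_nat add.commute)
    also have "\<dots> \<le> ennreal (exp (- c * (real n)\<^sup>2))"
    proof (rule ennreal_leI)
      have "?B * ?N \<le> ?B * (4 * ?B / ?\<theta> * exp (- \<kappa> * (real n)\<^sup>2))"
        unfolding \<kappa>_def using elim(1) n assms B by (intro mult_left_mono prob_few_positive_set) auto
      also have "\<dots> = ?B\<^sup>2 * 4 * (1 / ?\<theta>) * exp (- \<kappa> * (real n)\<^sup>2)"
        by (simp add: power2_eq_square)
      also have "\<dots> \<le> ?B\<^sup>2 * 4 * 2 ^ (n + 2) * exp (- \<kappa> * (real n)\<^sup>2)"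
      proof (intro mult_right_mono mult_left_mono)
        have "1 \<le> 2 ^ (n + 2) * ?\<theta>"
          using mult_left_mono[OF det_floor_ge[of n], of "2 ^ (n + 2)"]
          by (simp add: power_one_over)
        then show "1 / ?\<theta> \<le> 2 ^ (n + 2)" using \<theta> by (simp add: pos_divide_le_eq)
      qed auto
      finally have "?bd \<le> 2 * 8 ^ n * exp (- (real n)\<^sup>2 / 2) +
          (2 * (8 * real n) ^ n * exp (real n))\<^sup>2 * 4 * 2 ^ (n + 2) * exp (- \<kappa> * (real n)\<^sup>2)"
        by (simp add: tail_bound_def bulk_bound_def)
      then have "(real n + 1) * ?bd \<le> exp (- c * (real n)\<^sup>2)"
        using elim(2) by (meson mult_left_mono order.trans of_nat_0_le_iff add_nonneg_nonneg zero_le_one)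
      moreover have "(real (nat \<lfloor>\<alpha> * real n\<rfloor>) + 1) * ?bd \<le> (real n + 1) * ?bd"
        using le_n bd0 by (intro mult_right_mono) auto
      ultimately show "(real (nat \<lfloor>\<alpha> * real n\<rfloor>) + 1) * ?bd \<le> exp (- c * (real n)\<^sup>2)" by linarith
    qed
    finally show ?case .
  qed
  then show ?thesis using c(1) by blast
qed

end
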